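(* Let $K$ be a field of characteristic zero, $n\ge1$, $\mathcal O\in K^n/\mathbb Z^n$ and $\mathcal D_{\mathcal O}\subseteq\mathbb D_{\mathcal O}$. All modules in $\mathrm{GW}(\mathbb I_n,\mathcal D_{\mathcal O})$ and in $\mathrm W(\mathbb I_n,\mathcal D_{\mathcal O})$ are equidimensional, and the length of the module is equal to the dimension of any of its (generalized) weight components (at points of the support). In particular, all indecomposable generalized weight $\mathbb I_n$-modules are equidimensional.
   Context: $\otimes=\otimes_K$. $P_n=K[x_1,\dots,x_n]$. $\mathbb I_n$ is the $K$-subalgebra of $\mathrm{End}_K(P_n)$ generated by the multiplications by $x_i$, the partial derivatives $\partial_i$, and the integrations $\int_i$ ($K$-linear, $x^\alpha\mapsto x_ix^\alpha/(\alpha_i+1)$), $i=1,\dots,n$; $\mathbb I_n=\mathbb I_1(1)\otimes\cdots\otimes\mathbb I_1(n)$ with $\mathbb I_1(i)=K\langle x_i,\partial_i,\int_i\rangle\simeq\mathbb I_1$. $H_i=\partial_ix_i$ and $D_n=K[H_1,\dots,H_n]\subset\mathbb I_n$ is a polynomial algebra. For $\lambda\in K^n$, $\mathfrak m_\lambda=(H_1-\lambda_1,\dots,H_n-\lambda_n)\subset D_n$. For a left $\mathbb I_n$-module $M$, $M_\lambda=\{v:\mathfrak m_\lambda v=0\}$ and $M^\lambda=\{v:\mathfrak m_\lambda^iv=0\text{ for some }i\}$; $M$ is a weight (resp. generalized weight) module if $M=\bigoplus_\lambda M_\lambda$ (resp. $M=\bigoplus_{\lambda}M^\lambda$), and $\mathrm{Supp}(M)=\{\lambda:M^\lambda\neq0\}$.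 A generalized weight (resp. weight) module $M$ is equidimensional if $\dim_KM^\lambda=\dim_KM^\mu$ (resp. $\dim_KM_\lambda=\dim_KM_\mu$) for all $\lambda,\mu\in\mathrm{Supp}(M)$. $\mathbb Z^n$ acts on $K^n$ by translations; an orbit is a product $\mathcal O=\mathcal O_1\times\cdots\times\mathcal O_n$ with $\mathcal O_i\in K/\mathbb Z$; $\mathbb D_{\mathcal O}=\{i:\mathcal O_i=\mathbb Z\}$. $\mathrm{GW}(\mathbb I_n,\mathcal O)$ is the full subcategory of generalized weight $\mathbb I_n$-modules with $\mathrm{Supp}(M)\subseteq\mathcal O$. $\mathbb I_1$ (with $x,\partial,\int,H$) has a unique proper nonzero ideal $F$, spanned by $\int^s\partial^t-\int^{s+1}\partial^{t+1}$ ($s,t\ge0$); $B_1=\mathbb I_1/F$ is the skew Laurent polynomial algebra $K[H][\partial^{\pm1}]$ with $\partial H=(H+1)\partial$, $\int\mapsto\partial^{-1}$. For $\lambda\in K$, $M(1,\lambda)=B_1/B_1(H-\lambda)$. Choose $\lambda_{\mathcal O_i}\in\mathcal O_i$ (with $\lambda_{\mathbb Z}=0$). For $\mathcal D_{\mathcal O}\subseteq\mathbb D_{\mathcal O}$ let $M(\mathcal D_{\mathcal O})=\bigotimes_{i=1}^nM_i$ with $M_i=K[x_i]$ if $i\in\mathcal D_{\mathcal O}$ and $M_i=M(1,\lambda_{\mathcal O_i})$ otherwise; it is a simple weight $\mathbb I_n$-module. $\mathrm{GW}(\mathbb I_n,\mathcal D_{\mathcal O})$ is the full subcategory of $\mathrm{GW}(\mathbb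 I_n,\mathcal O)$ generated by $M(\mathcal D_{\mathcal O})$, i.e. consisting of the modules all of whose simple subquotients are isomorphic to $M(\mathcal D_{\mathcal O})$; $\mathrm W(\mathbb I_n,\mathcal D_{\mathcal O})$ is its full subcategory of weight modules. If the module has infinite length, the equality of length and dimension means that both are infinite. *)

theory Defs
  imports
    "Jordan_Normal_Form.VS_Connect"
    "HOL-Algebra.Generated_Rings"
    "HOL-Algebra.Ideal_Product"
    "HOL-Algebra.QuotRing"
    "HOL-Library.Poly_Mapping"
    "HOL-Library.Equipollence"
    "HOL-Library.Extended_Nat"
begin

section \<open>Left modules over a not necessarily commutative ring\<close>

text \<open>The library locale \<open>module\<close> requires a commutative ring. The record type is reused; its fields
  \<open>mult\<close> and \<open>one\<close> have no meaning for modules.\<close>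

locale left_module = R?: ring R + M?: abelian_group M
  for R :: "('a, 'd) ring_scheme" (structure) and M :: "('a, 'm, 'c) module_scheme" (structure) +
  assumes smult_closed: "\<lbrakk>a \<in> carrier R; x \<in> carrier M\<rbrakk> \<Longrightarrow> a \<odot>\<^bsub>M\<^esub> x \<in> carrier M"
    and smult_l_distr: "\<lbrakk>a \<in> carrier R; b \<in> carrier R; x \<in> carrier M\<rbrakk>
      \<Longrightarrow> (a \<oplus>\<^bsub>R\<^esub> b) \<odot>\<^bsub>M\<^esub> x = a \<odot>\<^bsub>M\<^esub> x \<oplus>\<^bsub>M\<^esub> b \<odot>\<^bsub>M\<^esub> x"
    and smult_r_distr: "\<lbrakk>a \<in> carrier R; x \<in> carrier M; y \<in> carrier M\<rbrakk>
      \<Longrightarrow> a \<odot>\<^bsub>M\<^esub> (x \<oplus>\<^bsub>M\<^esub> y) = a \<odot>\<^bsub>M\<^esub> x \<oplus>\<^bsub>M\<^esub> a \<odot>\<^bsub>M\<^esub> y"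
    and smult_assoc: "\<lbrakk>a \<in> carrier R; b \<in> carrier R; x \<in> carrier M\<rbrakk>
      \<Longrightarrow> (a \<otimes>\<^bsub>R\<^esub> b) \<odot>\<^bsub>M\<^esub> x = a \<odot>\<^bsub>M\<^esub> (b \<odot>\<^bsub>M\<^esub> x)"
    and smult_one: "x \<in> carrier M \<Longrightarrow> \<one>\<^bsub>R\<^esub> \<odot>\<^bsub>M\<^esub> x = x"

text \<open>Closure under negation follows from closure under the action of \<open>-1\<close>.\<close>

definition left_submodule :: "('a, 'c) ring_scheme \<Rightarrow> 'm set \<Rightarrow> ('a, 'm, 'd) module_scheme \<Rightarrow> bool" where
  "left_submodule R N M \<longleftrightarrow> N \<subseteq> carrier M \<and> \<zero>\<^bsub>M\<^esub> \<in> N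
     \<and> (\<forall>x\<in>N. \<forall>y\<in>N. x \<oplus>\<^bsub>M\<^esub> y \<in> N) \<and> (\<forall>a\<in>carrier R. \<forall>x\<in>N. a \<odot>\<^bsub>M\<^esub> x \<in> N)"

definition with_smult :: "('a, 'm, 'c) module_scheme \<Rightarrow> ('b \<Rightarrow> 'm \<Rightarrow> 'm) \<Rightarrow> ('b, 'm) module" where
  "with_smult M s = \<lparr>carrier = carrier M, mult = mult M, one = one M, zero = zero M, add = add M,
     smult = s\<rparr>"

definition restrict_scalars :: "('b \<Rightarrow> 'a) \<Rightarrow> ('a, 'm, 'c) module_scheme \<Rightarrow> ('b, 'm) module" where
  "restrict_scalars \<phi> M = with_smult M (\<lambda>b. smult M (\<phi> b))"

definition regular_module :: "('a, 'c) ring_scheme \<Rightarrow> ('a, 'a) module" where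
  "regular_module R = \<lparr>carrier = carrier R, mult = mult R, one = one R, zero = zero R, add = add R,
     smult = mult R\<rparr>"

definition quot_module :: "('a, 'm, 'c) module_scheme \<Rightarrow> 'm set \<Rightarrow> ('a, 'm set) module" where
  "quot_module M N = \<lparr>carrier = a_rcosets\<^bsub>M\<^esub> N, mult = undefined, one = undefined, zero = N,
     add = set_add M, smult = (\<lambda>a X. \<Union>x\<in>X. N +>\<^bsub>M\<^esub> (a \<odot>\<^bsub>M\<^esub> x))\<rparr>"

definition transport_module :: "('m \<Rightarrow> 'n) \<Rightarrow> ('a, 'm, 'c) module_scheme \<Rightarrow> ('a, 'n) module" where
  "transport_module f M =
     (let g = inv_into (carrier M) f in
      \<lparr>carrier = f ` carrier M, mult = undefined, one = undefined, zero = f \<zero>\<^bsub>M\<^esub>,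
       add = (\<lambda>x y. f (g x \<oplus>\<^bsub>M\<^esub> g y)), smult = (\<lambda>a x. f (a \<odot>\<^bsub>M\<^esub> g x))\<rparr>)"

definition isomorphic_modules ::
  "('a, 'c) ring_scheme \<Rightarrow> ('a, 'm, 'd) module_scheme \<Rightarrow> ('a, 'n, 'e) module_scheme \<Rightarrow> bool" where
  "isomorphic_modules R M N \<longleftrightarrow> (\<exists>f\<in>LinearCombinations.module_hom R M N. bij_betw f (carrier M) (carrier N))"

definition simple_module :: "('a, 'c) ring_scheme \<Rightarrow> ('a, 'm, 'd) module_scheme \<Rightarrow> bool" where
  "simple_module R M \<longleftrightarrow> left_module R M \<and> carrier M \<noteq> {\<zero>\<^bsub>M\<^esub>}
     \<and> (\<forall>N. left_submodule R N M \<longrightarrow> N = {\<zero>\<^bsub>M\<^esub>} \<or> N = carrier M)"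

definition indecomposable_module :: "('a, 'c) ring_scheme \<Rightarrow> ('a, 'm, 'd) module_scheme \<Rightarrow> bool" where
  "indecomposable_module R M \<longleftrightarrow> left_module R M \<and> carrier M \<noteq> {\<zero>\<^bsub>M\<^esub>}
     \<and> (\<forall>N\<^sub>1 N\<^sub>2. left_submodule R N\<^sub>1 M \<and> left_submodule R N\<^sub>2 M
          \<and> N\<^sub>1 \<inter> N\<^sub>2 = {\<zero>\<^bsub>M\<^esub>} \<and> N\<^sub>1 <+>\<^bsub>M\<^esub> N\<^sub>2 = carrier M
          \<longrightarrow> N\<^sub>1 = {\<zero>\<^bsub>M\<^esub>} \<or> N\<^sub>2 = {\<zero>\<^bsub>M\<^esub>})"

definition module_length :: "('a, 'c) ring_scheme \<Rightarrow> ('a, 'm, 'd) module_scheme \<Rightarrow> enat" where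
  "module_length R M = Sup {enat k | k. \<exists>N :: nat \<Rightarrow> 'm set.
     (\<forall>j\<le>k. left_submodule R (N j) M) \<and> (\<forall>j<k. N j \<subset> N (Suc j))}"

definition internal_direct_sum :: "('a, 'm, 'c) module_scheme \<Rightarrow> ('i \<Rightarrow> 'm set) \<Rightarrow> bool" where
  "internal_direct_sum M A \<longleftrightarrow> (\<forall>v\<in>carrier M. \<exists>!f.
     (\<forall>i. f i \<in> A i) \<and> finite {i. f i \<noteq> \<zero>\<^bsub>M\<^esub>} \<and> v = finsum M f {i. f i \<noteq> \<zero>\<^bsub>M\<^esub>})"

text \<open>\<open>same_dim\<close> compares dimensions as cardinal numbers; \<open>vs_dim\<close> does not distinguish infinite
  cardinals.\<close>

definition same_dim :: "('k::field, 'm) module \<Rightarrow> ('k, 'n) module \<Rightarrow> bool" where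
  "same_dim V W \<longleftrightarrow>
     (\<exists>A B. vectorspace.basis class_ring V A \<and> vectorspace.basis class_ring W B \<and> A \<approx> B)"

definition vs_dim :: "('k::field, 'm) module \<Rightarrow> enat" where
  "vs_dim V = (if vectorspace.fin_dim class_ring V then enat (vectorspace.dim class_ring V) else \<infinity>)"


section \<open>The algebra of polynomial integro-differential operators\<close>

text \<open>Polynomials in the variables indexed by \<open>'n\<close>: finitely supported functions on exponents, which
  are themselves finitely supported functions. The case of one variable is \<open>'n = unit\<close>.\<close>

type_synonym ('n, 'k) pol = "('n \<Rightarrow>\<^sub>0 nat) \<Rightarrow>\<^sub>0 'k"
type_synonym ('n, 'k) op = "('n, 'k) pol \<Rightarrow> ('n, 'k) pol"

definition scal :: "'k::field_char_0 \<Rightarrow> ('n, 'k) op" where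
  "scal c p = Poly_Mapping.single 0 c * p"

definition x_op :: "'n \<Rightarrow> ('n, 'k::field_char_0) op" where
  "x_op i p = Poly_Mapping.single (Poly_Mapping.single i 1) 1 * p"

definition d_op :: "'n \<Rightarrow> ('n, 'k::field_char_0) op" where
  "d_op i p = (\<Sum>\<alpha>\<in>Poly_Mapping.keys p. Poly_Mapping.single (\<alpha> - Poly_Mapping.single i 1)
     (of_nat (Poly_Mapping.lookup \<alpha> i) * Poly_Mapping.lookup p \<alpha>))"

definition int_op :: "'n \<Rightarrow> ('n, 'k::field_char_0) op" where
  "int_op i p = (\<Sum>\<alpha>\<in>Poly_Mapping.keys p. Poly_Mapping.single (\<alpha> + Poly_Mapping.single i 1)
     (Poly_Mapping.lookup p \<alpha> / of_nat (Poly_Mapping.lookup \<alpha> i + 1)))"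

definition H_op :: "'n \<Rightarrow> ('n, 'k::field_char_0) op" where
  "H_op i = d_op i \<circ> x_op i"

definition End_P :: "('n, 'k::field_char_0) op ring" where
  "End_P = \<lparr>carrier = {f. (\<forall>p q. f (p + q) = f p + f q) \<and> (\<forall>c p. f (scal c p) = scal c (f p))},
     mult = (\<circ>), one = id, zero = (\<lambda>_. 0), add = (\<lambda>f g p. f p + g p)\<rparr>"

definition I_alg :: "('n, 'k::field_char_0) op ring" where
  "I_alg = End_P\<lparr>carrier :=
     generate_ring End_P (range scal \<union> range x_op \<union> range d_op \<union> range int_op)\<rparr>"

definition D_alg :: "('n, 'k::field_char_0) op ring" where
  "D_alg = End_P\<lparr>carrier := generate_ring End_P (range scal \<union> range H_op)\<rparr>"

definition max_ideal :: "('n \<Rightarrow> 'k::field_char_0) \<Rightarrow> ('n, 'k) op set" where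
  "max_ideal w = Idl\<^bsub>D_alg\<^esub> (range (\<lambda>i p. H_op i p - scal (w i) p))"

primrec ideal_power :: "('a, 'c) ring_scheme \<Rightarrow> 'a set \<Rightarrow> nat \<Rightarrow> 'a set" where
  "ideal_power R J 0 = carrier R"
| "ideal_power R J (Suc k) = ideal_prod R J (ideal_power R J k)"


section \<open>Weight modules and generalized weight modules\<close>

definition weight_comp ::
  "(('n, 'k::field_char_0) op, 'm) module \<Rightarrow> ('n \<Rightarrow> 'k) \<Rightarrow> 'm set" where
  "weight_comp M w = {v \<in> carrier M. \<forall>a\<in>max_ideal w. a \<odot>\<^bsub>M\<^esub> v = \<zero>\<^bsub>M\<^esub>}"

definition gen_weight_comp ::
  "(('n, 'k::field_char_0) op, 'm) module \<Rightarrow> ('n \<Rightarrow> 'k) \<Rightarrow> 'm set" where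
  "gen_weight_comp M w =
     {v \<in> carrier M. \<exists>k. \<forall>a\<in>ideal_power D_alg (max_ideal w) k. a \<odot>\<^bsub>M\<^esub> v = \<zero>\<^bsub>M\<^esub>}"

definition weight_module :: "(('n, 'k::field_char_0) op, 'm) module \<Rightarrow> bool" where
  "weight_module M \<longleftrightarrow> left_module I_alg M \<and> internal_direct_sum M (weight_comp M)"

definition gen_weight_module :: "(('n, 'k::field_char_0) op, 'm) module \<Rightarrow> bool" where
  "gen_weight_module M \<longleftrightarrow> left_module I_alg M \<and> internal_direct_sum M (gen_weight_comp M)"

definition Supp :: "(('n, 'k::field_char_0) op, 'm) module \<Rightarrow> ('n \<Rightarrow> 'k) set" where
  "Supp M = {w. gen_weight_comp M w \<noteq> {\<zero>\<^bsub>M\<^esub>}}"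

text \<open>A subset of a module over the operator algebra, viewed as a \<open>K\<close>-vector space (meaningful if it is
  a \<open>K\<close>-subspace).\<close>

definition K_subspace ::
  "(('n, 'k::field_char_0) op, 'm) module \<Rightarrow> 'm set \<Rightarrow> ('k, 'm) module" where
  "K_subspace M W = (restrict_scalars scal M)\<lparr>carrier := W\<rparr>"

definition gen_equidimensional :: "(('n, 'k::field_char_0) op, 'm) module \<Rightarrow> bool" where
  "gen_equidimensional M \<longleftrightarrow> (\<forall>w\<in>Supp M. \<forall>w'\<in>Supp M.
     same_dim (K_subspace M (gen_weight_comp M w)) (K_subspace M (gen_weight_comp M w')))"

definition equidimensional :: "(('n, 'k::field_char_0) op, 'm) module \<Rightarrow> bool" where
  "equidimensional M \<longleftrightarrow> (\<forall>w\<in>Supp M. \<forall>w'\<in>Supp M.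
     same_dim (K_subspace M (weight_comp M w)) (K_subspace M (weight_comp M w')))"

definition orbits :: "('n \<Rightarrow> 'k::field_char_0) set set" where
  "orbits = UNIV // {(v, w). \<exists>z :: 'n \<Rightarrow> int. \<forall>i. w i = v i + of_int (z i)}"

definition cosets_Z :: "'k::field_char_0 set set" where
  "cosets_Z = UNIV // {(a, b). \<exists>z :: int. b = a + of_int z}"

definition orbit_comp :: "('n \<Rightarrow> 'k) set \<Rightarrow> 'n \<Rightarrow> 'k set" where
  "orbit_comp \<O> i = (\<lambda>w. w i) ` \<O>"

definition integral_indices :: "('n \<Rightarrow> 'k::field_char_0) set \<Rightarrow> 'n set" where
  "integral_indices \<O> = {i. orbit_comp \<O> i = \<int>}"


section \<open>The simple weight modules\<close>

definition pol_module :: "((unit, 'k::field_char_0) op, (unit, 'k) pol) module" where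
  "pol_module = \<lparr>carrier = UNIV, mult = undefined, one = undefined, zero = 0, add = (+),
     smult = (\<lambda>a p. a p)\<rparr>"

definition F_ideal :: "(unit, 'k::field_char_0) op set" where
  "F_ideal = LinearCombinations.module.span class_ring (restrict_scalars scal (regular_module I_alg))
     {(\<lambda>p. (int_op () ^^ s) ((d_op () ^^ t) p) - (int_op () ^^ Suc s) ((d_op () ^^ Suc t) p)) | s t. True}"

definition B1_alg :: "(unit, 'k::field_char_0) op set ring" where
  "B1_alg = I_alg Quot F_ideal"

text \<open>\<open>B\<^sub>1 / B\<^sub>1 (H - \<lambda>)\<close>, with operators acting through the projection to \<open>B\<^sub>1\<close>.\<close>

definition M1 :: "'k::field_char_0 \<Rightarrow> ((unit, 'k) op, (unit, 'k) op set set) module" where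
  "M1 c = restrict_scalars (\<lambda>a. F_ideal +>\<^bsub>I_alg\<^esub> a)
     (quot_module (regular_module B1_alg)
        {b \<otimes>\<^bsub>B1_alg\<^esub> (F_ideal +>\<^bsub>I_alg\<^esub> (\<lambda>p. H_op () p - scal c p)) | b. b \<in> carrier B1_alg})"

text \<open>The tensor product over \<open>K\<close> of a family of \<open>K\<close>-vector spaces: the free vector space on the product
  of the carriers modulo the relations of multilinearity.\<close>

definition free_space :: "('i \<Rightarrow> ('k::field, 'm) module) \<Rightarrow> ('k, ('i \<Rightarrow> 'm) \<Rightarrow>\<^sub>0 'k) module" where
  "free_space V = \<lparr>carrier = {p. Poly_Mapping.keys p \<subseteq> {m. \<forall>i. m i \<in> carrier (V i)}},
     mult = undefined, one = undefined, zero = 0, add = (+), smult = (\<lambda>c. Poly_Mapping.map ((*) c))\<rparr>"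

definition tensor_relations :: "('i \<Rightarrow> ('k::field, 'm) module) \<Rightarrow> (('i \<Rightarrow> 'm) \<Rightarrow>\<^sub>0 'k) set" where
  "tensor_relations V = LinearCombinations.module.span class_ring (free_space V)
     ({Poly_Mapping.single (m(i := u \<oplus>\<^bsub>V i\<^esub> v)) 1 - Poly_Mapping.single (m(i := u)) 1
         - Poly_Mapping.single (m(i := v)) 1
       | m i u v. (\<forall>j. m j \<in> carrier (V j)) \<and> u \<in> carrier (V i) \<and> v \<in> carrier (V i)}
      \<union> {Poly_Mapping.single (m(i := c \<odot>\<^bsub>V i\<^esub> u)) 1 - Poly_Mapping.single (m(i := u)) c
       | m i u c. (\<forall>j. m j \<in> carrier (V j)) \<and> u \<in> carrier (V i)})"

definition tensor_space ::
  "('i \<Rightarrow> ('k::field, 'm) module) \<Rightarrow> ('k, (('i \<Rightarrow> 'm) \<Rightarrow>\<^sub>0 'k) set) module" where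
  "tensor_space V = quot_module (free_space V) (tensor_relations V)"

definition pure_tensor ::
  "('i \<Rightarrow> ('k::field, 'm) module) \<Rightarrow> ('i \<Rightarrow> 'm) \<Rightarrow> (('i \<Rightarrow> 'm) \<Rightarrow>\<^sub>0 'k) set" where
  "pure_tensor V m = tensor_relations V +>\<^bsub>free_space V\<^esub> Poly_Mapping.single m 1"

text \<open>\<open>tensor_action N s\<close>: \<open>s\<close> is the action of the operator algebra in the variables \<open>'n\<close>, as the
  tensor product of its subalgebras generated by \<open>x_op i\<close>, \<open>d_op i\<close>, \<open>int_op i\<close>, on the tensor product
  of modules \<open>N i\<close> over the one variable algebra; these generators act on the factor with index \<open>i\<close>.
  On the carriers there is exactly one such action, so the choice in \<open>tensor_module\<close> is immaterial.\<close>

definition tensor_action ::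
  "('n \<Rightarrow> ((unit, 'k::field_char_0) op, 'm) module) \<Rightarrow>
   (('n, 'k) op \<Rightarrow> (('n \<Rightarrow> 'm) \<Rightarrow>\<^sub>0 'k) set \<Rightarrow> (('n \<Rightarrow> 'm) \<Rightarrow>\<^sub>0 'k) set) \<Rightarrow> bool" where
  "tensor_action N s \<longleftrightarrow>
     (let V = (\<lambda>i. restrict_scalars scal (N i)); T = tensor_space V in
      left_module I_alg (with_smult T s)
      \<and> (\<forall>c. \<forall>t\<in>carrier T. s (scal c) t = c \<odot>\<^bsub>T\<^esub> t)
      \<and> (\<forall>m i. (\<forall>j. m j \<in> carrier (N j)) \<longrightarrow>
           s (x_op i) (pure_tensor V m) = pure_tensor V (m(i := x_op () \<odot>\<^bsub>N i\<^esub> m i))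
           \<and> s (d_op i) (pure_tensor V m) = pure_tensor V (m(i := d_op () \<odot>\<^bsub>N i\<^esub> m i))
           \<and> s (int_op i) (pure_tensor V m) = pure_tensor V (m(i := int_op () \<odot>\<^bsub>N i\<^esub> m i))))"

definition tensor_module ::
  "('n \<Rightarrow> ((unit, 'k::field_char_0) op, 'm) module) \<Rightarrow>
   (('n, 'k) op, (('n \<Rightarrow> 'm) \<Rightarrow>\<^sub>0 'k) set) module" where
  "tensor_module N =
     with_smult (tensor_space (\<lambda>i. restrict_scalars scal (N i))) (SOME s. tensor_action N s)"

text \<open>The two kinds of factors have different element types and are transported to a sum type.\<close>

definition M_factor :: "('n \<Rightarrow> 'k::field_char_0) set \<Rightarrow> 'n set \<Rightarrow> ('k set \<Rightarrow> 'k) \<Rightarrow> 'n \<Rightarrow>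
   ((unit, 'k) op, (unit, 'k) pol + (unit, 'k) op set set) module" where
  "M_factor \<O> \<D> rep i =
     (if i \<in> \<D> then transport_module Inl pol_module
      else transport_module Inr (M1 (rep (orbit_comp \<O> i))))"

definition M_simple :: "('n \<Rightarrow> 'k::field_char_0) set \<Rightarrow> 'n set \<Rightarrow> ('k set \<Rightarrow> 'k) \<Rightarrow>
   (('n, 'k) op, (('n \<Rightarrow> (unit, 'k) pol + (unit, 'k) op set set) \<Rightarrow>\<^sub>0 'k) set) module" where
  "M_simple \<O> \<D> rep = tensor_module (M_factor \<O> \<D> rep)"


section \<open>The module categories\<close>

definition GW_orbit ::
  "('n \<Rightarrow> 'k::field_char_0) set \<Rightarrow> (('n, 'k) op, 'm) module set" where
  "GW_orbit \<O> = {M. gen_weight_module M \<and> Supp M \<subseteq> \<O>}"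

definition GW :: "('n \<Rightarrow> 'k::field_char_0) set \<Rightarrow> 'n set \<Rightarrow> ('k set \<Rightarrow> 'k) \<Rightarrow>
   (('n, 'k) op, 'm) module set" where
  "GW \<O> \<D> rep = {M \<in> GW_orbit \<O>. \<forall>L N.
     left_submodule I_alg L M \<and> left_submodule I_alg N M \<and> N \<subseteq> L
     \<and> simple_module I_alg (quot_module (M\<lparr>carrier := L\<rparr>) N)
     \<longrightarrow> isomorphic_modules I_alg (quot_module (M\<lparr>carrier := L\<rparr>) N) (M_simple \<O> \<D> rep)}"

definition W :: "('n \<Rightarrow> 'k::field_char_0) set \<Rightarrow> 'n set \<Rightarrow> ('k set \<Rightarrow> 'k) \<Rightarrow>
   (('n, 'k) op, 'm) module set" where
  "W \<O> \<D> rep = {M \<in> GW \<O> \<D> rep. weight_module M}"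

end

theory Submission
  imports Defs
begin

text \<open>The operators \<open>\<integral>\<^sub>i\<close> and \<open>\<partial>\<^sub>i\<close> shift weights by \<open>1\<close> and \<open>-1\<close>, \<open>\<partial>\<^sub>i \<integral>\<^sub>i = 1\<close>, and \<open>H\<^sub>i\<close> acts by \<open>1\<close> on the
  kernel of \<open>\<partial>\<^sub>i\<close>. Hence a generalized weight module splits, for every \<open>i\<close>, into the submodule where
  \<open>\<partial>\<^sub>i\<close> is locally nilpotent and the one where \<open>\<partial>\<^sub>i\<close> is invertible. For an indecomposable module one
  part vanishes. The same holds if all simple subquotients are isomorphic, since \<open>\<partial>\<^sub>i\<close> is locally nilpotent
  on those of the first part and injective on those of the second. If for each \<open>i\<close> one part
  vanishes, products of powers of the \<open>\<integral>\<^sub>i\<close> and \<open>\<partial>\<^sub>i\<close> identify any two nonzero weight components in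
  an orbit. Then a submodule is determined by its component at one weight of the support, every
  subspace stable under the \<open>H\<^sub>i\<close> arises as such a component, and these subspaces form full flags because
  the \<open>H\<^sub>i - \<lambda>\<^sub>i\<close> commute and are locally nilpotent.\<close>

section \<open>The operators on polynomials\<close>

text \<open>Shifting down can lose information only at \<open>w i = 1\<close>. The defect
  \<open>1 - \<integral>\<^sub>i\<partial>\<^sub>i\<close> preserves weights and is killed by
  \<open>H\<^sub>i - 1\<close>, a consequence of the Weyl relation, so it vanishes on all weight
  spaces with \<open>w i \<noteq> 1\<close>. Along v, \<partial>v, \<partial>\<partial>v, ... the
  weight drops by 1 and, in characteristic zero, meets 1 at most once; beyond that point
  \<integral>\<partial> is the identity, and v splits as (v - y) + y with
  \<open>y = \<integral>^m \<partial>^m v\<close>. If the invertible part is zero, the support has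
  \<open>w i\<close> in {1, 2, ...}, so a path between two of its weights never steps from 1 to 0;
  hence transport is invertible in both cases. The weight components may be infinite dimensional and
  need not be semisimple over \<open>D_alg\<close>. Length and dimension are therefore both treated
  as suprema over natural numbers k, and for each k a chain of k strict inclusions is exchanged for
  k independent vectors. From vectors to chains arbitrary subspaces are not enough: stability under
  the \<open>H\<^sub>i\<close> forces each new vector to be a simultaneous eigenvector modulo the
  previous step.\<close>

lemma additive_eqI:
  fixes f g :: "('a \<Rightarrow>\<^sub>0 'k::comm_monoid_add) \<Rightarrow> 'b::cancel_comm_monoid_add"
  assumes "\<And>p q. f (p + q) = f p + f q" and "\<And>p q. g (p + q) = g p + g q"
    and single: "\<And>\<alpha> c. f (Poly_Mapping.single \<alpha> c) = g (Poly_Mapping.single \<alpha> c)"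
  shows "f = g"
proof (rule ext)
  fix p show "f p = g p"
  proof (induction p rule: update_induct)
  case const
  \<comment> \<open>The zero polynomial is a monomial with coefficient 0, so the base case is an
    instance of the hypothesis on monomials.\<close>
  show ?case using single[of undefined 0] by simp
next
  case (update p \<alpha> c)
  have "Poly_Mapping.update \<alpha> c p = Poly_Mapping.single \<alpha> c + p"
    using update.hyps
    by (intro poly_mapping_eqI) (auto simp: lookup_update lookup_add lookup_single when_def in_keys_iff)
  then show ?case using assms update by simp
  qed
qed

lemma scal_add: "scal c (p + q) = scal c p + scal c q"
  by (simp add: scal_def algebra_simps)

lemma scal_single: "scal c (Poly_Mapping.single \<alpha> b) = Poly_Mapping.single \<alpha> (c * b)"
  by (simp add: scal_def mult_single)

lemma x_op_add: "x_op i (p + q) = x_op i p + x_op i q"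
  by (simp add: x_op_def algebra_simps)

lemma x_op_single:
  "x_op i (Poly_Mapping.single \<alpha> b) = Poly_Mapping.single (\<alpha> + Poly_Mapping.single i 1) b"
  by (simp add: x_op_def mult_single add.commute)

lemma d_op_add: "d_op i (p + q) = d_op i p + d_op i q"
  unfolding d_op_def by (rule setsum_keys_plus_distrib) (simp_all add: algebra_simps single_add)

lemma d_op_single: "d_op i (Poly_Mapping.single \<alpha> b) =
    Poly_Mapping.single (\<alpha> - Poly_Mapping.single i 1) (of_nat (Poly_Mapping.lookup \<alpha> i) * b)"
  by (auto simp: d_op_def)

lemma int_op_add: "int_op i (p + q) = int_op i p + int_op i q"
  unfolding int_op_def
  by (rule setsum_keys_plus_distrib) (simp_all add: add_divide_distrib single_add)

lemma int_op_single: "int_op i (Poly_Mapping.single \<alpha> b) =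
    Poly_Mapping.single (\<alpha> + Poly_Mapping.single i 1) (b / of_nat (Poly_Mapping.lookup \<alpha> i + 1))"
  by (auto simp: int_op_def)

lemma H_op_add: "H_op i (p + q) = H_op i p + H_op i q"
  by (simp add: H_op_def d_op_add x_op_add)

lemma H_op_single: "H_op i (Poly_Mapping.single \<alpha> b) =
    Poly_Mapping.single \<alpha> (of_nat (Poly_Mapping.lookup \<alpha> i + 1) * b)"
  by (simp add: H_op_def d_op_single x_op_single lookup_add)

lemmas op_add = scal_add x_op_add d_op_add int_op_add H_op_add
lemmas op_single = scal_single x_op_single d_op_single int_op_single H_op_single

lemma op_zero [simp]: "d_op i 0 = 0" "int_op i 0 = 0" "x_op i 0 = 0" "H_op i 0 = 0" "scal c 0 = 0"
  by (simp_all add: d_op_def int_op_def x_op_def H_op_def scal_def)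

lemma minus_single_commute:
  fixes \<alpha> :: "'n \<Rightarrow>\<^sub>0 nat"
  shows "\<alpha> - Poly_Mapping.single i a - Poly_Mapping.single j b = \<alpha> - Poly_Mapping.single j b - Poly_Mapping.single i a"
  by (intro poly_mapping_eqI) (simp add: lookup_minus)

text \<open>Subtraction of exponents is truncated at 0: within one variable, lowering the exponent 0
  and then raising it gives 1, while the other order gives 0.\<close>

lemma plus_minus_single_commute:
  fixes \<alpha> :: "'n \<Rightarrow>\<^sub>0 nat"
  shows "i \<noteq> j \<Longrightarrow> \<alpha> + Poly_Mapping.single i a - Poly_Mapping.single j b = \<alpha> - Poly_Mapping.single j b + Poly_Mapping.single i a"
  by (intro poly_mapping_eqI) (auto simp add: lookup_minus lookup_add lookup_single when_def)

lemma minus_plus_single: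
  fixes \<alpha> :: "'n \<Rightarrow>\<^sub>0 nat"
  shows "Poly_Mapping.lookup \<alpha> i \<noteq> 0 \<Longrightarrow> \<alpha> - Poly_Mapping.single i 1 + Poly_Mapping.single i 1 = \<alpha>"
  by (intro poly_mapping_eqI) (simp add: lookup_minus lookup_add lookup_single when_def, auto)

section \<open>Relations between the generators\<close>

lemma d_int_op: "d_op i \<circ> int_op i = id"
  by (rule additive_eqI) (simp_all add: op_add op_single lookup_add del: of_nat_add of_nat_Suc)

lemma int_H_op: "int_op i \<circ> H_op i = x_op i"
  by (rule additive_eqI) (simp_all add: op_add op_single lookup_add del: of_nat_add of_nat_Suc)

lemma H_int_op: "H_op i \<circ> int_op i = (\<lambda>p. (int_op i \<circ> H_op i) p + int_op i p)"
proof (rule additive_eqI)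
  fix \<alpha> :: "'a \<Rightarrow>\<^sub>0 nat" and c :: 'b
  \<comment> \<open>The eigenvalue of \<open>H_op i\<close> on this monomial, nonzero in
    characteristic zero.\<close>
  define m :: 'b where "m = of_nat (Poly_Mapping.lookup \<alpha> i + 1)"
  have "m \<noteq> 0" unfolding m_def by (metis Suc_eq_plus1 of_nat_neq_0)
  then have "(m + 1) * (c / m) = (m * c) / m + c / m" by (simp add: field_simps)
  then show "(H_op i \<circ> int_op i) (Poly_Mapping.single \<alpha> c) =
      (int_op i \<circ> H_op i) (Poly_Mapping.single \<alpha> c) + int_op i (Poly_Mapping.single \<alpha> c)"
    by (simp add: op_single lookup_add single_add[symmetric] m_def algebra_simps)
qed (simp_all add: op_add)

lemma d_H_op: "d_op i \<circ> H_op i = (\<lambda>p. (H_op i \<circ> d_op i) p + d_op i p)"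
proof (rule additive_eqI)
  fix \<alpha> :: "'a \<Rightarrow>\<^sub>0 nat" and c :: 'b
  show "(d_op i \<circ> H_op i) (Poly_Mapping.single \<alpha> c) =
      (H_op i \<circ> d_op i) (Poly_Mapping.single \<alpha> c) + d_op i (Poly_Mapping.single \<alpha> c)"
    by (cases "Poly_Mapping.lookup \<alpha> i")
      (simp_all add: op_single lookup_minus single_add[symmetric] algebra_simps)
qed (simp_all add: op_add)

text \<open>Since \<open>\<integral>H = x\<close> by \<open>int_H_op\<close> and
  \<open>H = \<partial>x\<close>, this is the Weyl relation
  \<open>\<partial>x = 1 + x\<partial>\<close>, written without x.\<close>

lemma H_op_eq: "H_op i = (\<lambda>p. p + (int_op i \<circ> (H_op i \<circ> d_op i)) p)"
proof (rule additive_eqI)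
  fix \<alpha> :: "'a \<Rightarrow>\<^sub>0 nat" and c :: 'b
  show "H_op i (Poly_Mapping.single \<alpha> c) =
      Poly_Mapping.single \<alpha> c + (int_op i \<circ> (H_op i \<circ> d_op i)) (Poly_Mapping.single \<alpha> c)"
  proof (cases "Poly_Mapping.lookup \<alpha> i")
    case (Suc m)
    define k :: 'b where "k = of_nat (Suc m)"
    have "k \<noteq> 0" unfolding k_def by (rule of_nat_neq_0)
    then show ?thesis
      using Suc minus_plus_single[of \<alpha> i]
      by (simp add: op_single lookup_minus single_add[symmetric] k_def[symmetric] del: of_nat_Suc)
       (simp add: k_def field_simps)
  qed (simp add: op_single)
qed (simp_all add: op_add add_ac)

lemma H_H_op: "H_op i \<circ> H_op j = H_op j \<circ> H_op i"
  by (rule additive_eqI) (simp_all add: op_add op_single algebra_simps)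

lemma H_d_op: "i \<noteq> j \<Longrightarrow> H_op i \<circ> d_op j = d_op j \<circ> H_op i"
  by (rule additive_eqI) (simp_all add: op_add op_single lookup_minus lookup_single algebra_simps)

lemma H_int_op_commute: "i \<noteq> j \<Longrightarrow> H_op i \<circ> int_op j = int_op j \<circ> H_op i"
  by (rule additive_eqI) (simp_all add: op_add op_single lookup_add lookup_single algebra_simps)

lemma d_d_op: "d_op i \<circ> d_op j = d_op j \<circ> d_op i"
  by (cases "i = j", simp, rule additive_eqI)
   (simp_all add: op_add op_single lookup_minus lookup_single minus_single_commute algebra_simps)

lemma d_int_op_commute: "i \<noteq> j \<Longrightarrow> d_op i \<circ> int_op j = int_op j \<circ> d_op i"
  by (rule additive_eqI)
   (simp_all add: op_add op_single lookup_minus lookup_add lookup_single plus_minus_single_commute algebra_simps)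

lemma int_int_op: "int_op i \<circ> int_op j = int_op j \<circ> int_op i"
  by (cases "i = j", simp, rule additive_eqI)
   (simp_all add: op_add op_single lookup_add lookup_single algebra_simps)

lemma scal_H_op: "scal c \<circ> H_op i = H_op i \<circ> scal c"
  by (rule additive_eqI) (simp_all add: op_add op_single algebra_simps)

lemma scal_d_op: "scal c \<circ> d_op i = d_op i \<circ> scal c"
  by (rule additive_eqI) (simp_all add: op_add op_single algebra_simps)

lemma scal_int_op: "scal c \<circ> int_op i = int_op i \<circ> scal c"
  by (rule additive_eqI) (simp_all add: op_add op_single algebra_simps)

lemma scal_x_op: "scal c \<circ> x_op i = x_op i \<circ> scal c"
  by (rule additive_eqI) (simp_all add: op_add op_single algebra_simps)

lemma scal_scal: "scal b \<circ> scal c = scal (b * c)"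
  by (rule additive_eqI) (simp_all add: op_add op_single algebra_simps)

lemma scal_plus: "scal (b + c) = (\<lambda>p. scal b p + scal c p)"
  by (rule ext) (simp add: scal_def single_add algebra_simps)

lemma scal_one: "scal 1 = id"
  by (rule ext) (simp add: scal_def)

lemma scal_zero: "scal 0 = (\<lambda>_. 0)"
  by (rule ext) (simp add: scal_def)

section \<open>The operator algebras\<close>

lemma End_P_simps [simp]:
  "mult End_P = (\<circ>)" "one End_P = id" "zero End_P = (\<lambda>_. 0)" "add End_P = (\<lambda>f g p. f p + g p)"
  by (simp_all add: End_P_def)

lemma End_P_carrier: "f \<in> carrier End_P \<longleftrightarrow>
    (\<forall>p q. f (p + q) = f p + f q) \<and> (\<forall>c p. f (scal c p) = scal c (f p))"
  by (simp add: End_P_def)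

lemma ring_End_P: "ring (End_P :: ('n, 'k::field_char_0) op ring)"
proof (rule ringI)
  have scal_0: "scal c (0 :: ('n, 'k) pol) = 0" and scal_uminus: "scal c (- q) = - scal c q"
    for c and q :: "('n, 'k) pol"
    by (simp_all add: scal_def)
  show "abelian_group (End_P :: ('n, 'k) op ring)"
  proof (rule abelian_groupI)
    fix f :: "('n, 'k) op" assume f: "f \<in> carrier End_P"
    show "\<exists>g\<in>carrier End_P. g \<oplus>\<^bsub>End_P\<^esub> f = \<zero>\<^bsub>End_P\<^esub>"
      by (rule bexI[of _ "\<lambda>p. - f p"]) (use f in \<open>auto simp: End_P_carrier scal_uminus\<close>)
  qed (auto simp: End_P_carrier scal_add scal_0 algebra_simps)
  show "Group.monoid (End_P :: ('n, 'k) op ring)"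
    by (rule monoidI) (auto simp: End_P_carrier)
qed (auto simp: End_P_carrier scal_add)

interpretation End_P: ring "End_P :: ('n, 'k::field_char_0) op ring"
  by (rule ring_End_P)

lemma scal_comm_op: "scal b (scal c p) = scal c (scal b p)"
  using scal_scal[of b c] scal_scal[of c b] by (metis comp_apply mult.commute)

lemma ops_End_P: "scal c \<in> carrier End_P" "x_op i \<in> carrier End_P" "d_op i \<in> carrier End_P"
    "int_op i \<in> carrier End_P" "H_op i \<in> carrier End_P"
  by (simp_all add: End_P_carrier op_add scal_comm_op fun_cong[OF scal_H_op, unfolded comp_apply]
      fun_cong[OF scal_d_op, unfolded comp_apply] fun_cong[OF scal_int_op, unfolded comp_apply]
      fun_cong[OF scal_x_op, unfolded comp_apply])

text \<open>Inductions over \<open>generate_ring\<close> have a case for additive inverses; as a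
  composition with a scalar, an inverse is covered by what is known about products.\<close>

lemma a_inv_End_P:
  assumes "f \<in> carrier End_P"
  shows "\<ominus>\<^bsub>End_P\<^esub> f = scal (- 1) \<circ> f"
proof -
  have "f p = - scal (- 1) (f p)" for p
    by (simp add: scal_def single_uminus)
  then have "f \<oplus>\<^bsub>End_P\<^esub> (scal (- 1) \<circ> f) = \<zero>\<^bsub>End_P\<^esub>"
    by (simp add: fun_eq_iff scal_def single_uminus)
  moreover have "scal (- 1) \<circ> f \<in> carrier End_P"
    using assms ops_End_P(1)[of "- 1"] by (metis End_P.m_closed End_P_simps(1))
  ultimately show ?thesis
    using assms by (metis End_P.add.m_comm End_P.minus_equality)
qed

abbreviation (input) I_gens :: "('n, 'k::field_char_0) op set" where
  "I_gens \<equiv> range scal \<union> range x_op \<union> range d_op \<union> range int_op"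

lemma I_gens_subset: "I_gens \<subseteq> carrier End_P"
  using ops_End_P by auto

lemma I_alg_simps [simp]:
  "mult I_alg = (\<circ>)" "one I_alg = id" "zero I_alg = (\<lambda>_. 0)" "add I_alg = (\<lambda>f g p. f p + g p)"
  by (simp_all add: I_alg_def)

lemma carrier_I_alg: "carrier I_alg = generate_ring End_P I_gens"
  by (simp add: I_alg_def)

lemma I_alg_closed [simp, intro]:
  "id \<in> carrier I_alg"
  "f \<in> carrier I_alg \<Longrightarrow> g \<in> carrier I_alg \<Longrightarrow> f \<circ> g \<in> carrier I_alg"
  "f \<in> carrier I_alg \<Longrightarrow> g \<in> carrier I_alg \<Longrightarrow> (\<lambda>p. f p + g p) \<in> carrier I_alg"
  using generate_ring.one[of End_P I_gens] generate_ring.eng_mult[of f End_P I_gens g]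
    generate_ring.eng_add[of f End_P I_gens g]
  by (auto simp: carrier_I_alg)

lemma ops_I_alg [simp, intro]: "scal c \<in> carrier I_alg" "x_op i \<in> carrier I_alg"
    "d_op i \<in> carrier I_alg" "int_op i \<in> carrier I_alg" "H_op i \<in> carrier I_alg"
  unfolding H_op_def by (auto simp: carrier_I_alg intro: generate_ring.incl I_alg_closed)
   (metis I_alg_closed(2) UnCI carrier_I_alg generate_ring.incl rangeI)

abbreviation (input) D_gens :: "('n, 'k::field_char_0) op set" where
  "D_gens \<equiv> range scal \<union> range H_op"

lemma D_gens_subset: "D_gens \<subseteq> carrier End_P"
  using ops_End_P by auto

lemma D_alg_simps [simp]:
  "mult D_alg = (\<circ>)" "one D_alg = id" "zero D_alg = (\<lambda>_. 0)" "add D_alg = (\<lambda>f g p. f p + g p)"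
  by (simp_all add: D_alg_def)

lemma carrier_D_alg: "carrier D_alg = generate_ring End_P D_gens"
  by (simp add: D_alg_def)

lemma ring_D_alg: "ring D_alg"
  unfolding D_alg_def by (rule End_P.generate_ring_is_ring[OF D_gens_subset])

text \<open>The \<open>H_op i\<close> are composites of generators of the larger algebra, not
  generators themselves, so this is an induction and not mere monotonicity.\<close>

lemma D_alg_subset_I_alg: "carrier D_alg \<subseteq> carrier I_alg"
proof
  fix a :: "('n, 'k::field_char_0) op" assume "a \<in> carrier D_alg"
  then have "a \<in> generate_ring End_P D_gens" by (simp add: carrier_D_alg)
  then show "a \<in> carrier I_alg"
  proof induction
    case (a_inv h)
    then show ?case by (auto simp: carrier_I_alg intro: generate_ring.a_inv)
  qed (simp_all only: End_P_simps I_alg_closed, use ops_I_alg in blast)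
qed

lemma generate_ring_commute:
  assumes "X \<subseteq> carrier End_P" and "a \<in> generate_ring End_P X" and f: "f \<in> carrier End_P"
    and comm: "\<And>g. g \<in> X \<Longrightarrow> f \<circ> g = g \<circ> f"
  shows "f \<circ> a = a \<circ> f"
  using assms(2)
proof induction
  case (a_inv h)
  have h: "h \<in> carrier End_P"
    using End_P.generate_ring_in_carrier[OF assms(1)] a_inv by blast
  show ?case
    using a_inv.IH f unfolding a_inv_End_P[OF h] End_P_carrier by (metis comp_apply comp_assoc fun_eq_iff)
next
  case (eng_add a b)
  then show ?case using f by (auto simp: End_P_carrier fun_eq_iff)
next
  case (eng_mult a b)
  then show ?case by (metis End_P_simps(1) comp_assoc)
qed (use comm in auto)

text \<open>A centralizer is closed under the ring operations. This is applied twice: with a fixed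
  generator it gives commutation with all of \<open>D_alg\<close>, and then with an arbitrary fixed
  \<open>b\<close>.\<close>

lemma D_alg_commute:
  assumes a: "a \<in> carrier D_alg" and b: "b \<in> carrier D_alg"
  shows "a \<circ> b = b \<circ> a"
proof -
  have E: "a \<in> carrier End_P" "b \<in> carrier End_P"
    using End_P.generate_ring_in_carrier[OF D_gens_subset] a b by (auto simp: carrier_D_alg)
  have comm: "g \<circ> h = h \<circ> g" if "g \<in> D_gens" "h \<in> D_gens" for g h :: "('a, 'b) op"
  proof -
    have 1: "scal b \<circ> scal c = (scal c \<circ> scal b :: ('a, 'b) op)" for b c
      by (simp add: scal_scal mult.commute)
    from that consider b c where "g = scal b" "h = scal c" | b i where "g = scal b" "h = H_op i"
      | b i where "g = H_op i" "h = scal b" | i j where "g = H_op i" "h = H_op j"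
      by blast
    then show ?thesis
      by cases (simp_all only: 1 scal_H_op, rule H_H_op)
  qed
  have "g \<circ> b = b \<circ> g" if g: "g \<in> D_gens" for g
    by (rule generate_ring_commute[OF D_gens_subset b[unfolded carrier_D_alg]])
      (use g D_gens_subset in blast, rule comm[OF g])
  then have "b \<circ> g = g \<circ> b" if "g \<in> D_gens" for g
    using that by simp
  from generate_ring_commute[OF D_gens_subset a[unfolded carrier_D_alg] E(2) this]
  show ?thesis by simp
qed

section \<open>Submodules and quotients of left modules\<close>

lemma left_submoduleD:
  assumes "left_submodule R N M"
  shows "N \<subseteq> carrier M" "\<zero>\<^bsub>M\<^esub> \<in> N" "x \<in> N \<Longrightarrow> y \<in> N \<Longrightarrow> x \<oplus>\<^bsub>M\<^esub> y \<in> N"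
    "a \<in> carrier R \<Longrightarrow> x \<in> N \<Longrightarrow> a \<odot>\<^bsub>M\<^esub> x \<in> N"
  using assms by (auto simp: left_submodule_def)

context left_module
begin

lemma smult_zero_right [simp]: "a \<in> carrier R \<Longrightarrow> a \<odot>\<^bsub>M\<^esub> \<zero>\<^bsub>M\<^esub> = \<zero>\<^bsub>M\<^esub>"
  using smult_r_distr[of a "\<zero>\<^bsub>M\<^esub>" "\<zero>\<^bsub>M\<^esub>"] smult_closed[of a "\<zero>\<^bsub>M\<^esub>"]
  by (metis M.add.r_cancel_one' M.zero_closed M.l_zero)

lemma smult_zero_left [simp]: "x \<in> carrier M \<Longrightarrow> \<zero>\<^bsub>R\<^esub> \<odot>\<^bsub>M\<^esub> x = \<zero>\<^bsub>M\<^esub>"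
  using smult_l_distr[of "\<zero>\<^bsub>R\<^esub>" "\<zero>\<^bsub>R\<^esub>" x] smult_closed[of "\<zero>\<^bsub>R\<^esub>" x]
  by (metis M.add.r_cancel_one' R.zero_closed R.l_zero)

lemma smult_uminus_one: "x \<in> carrier M \<Longrightarrow> (\<ominus>\<^bsub>R\<^esub> \<one>\<^bsub>R\<^esub>) \<odot>\<^bsub>M\<^esub> x = \<ominus>\<^bsub>M\<^esub> x"
  using smult_l_distr[of "\<ominus>\<^bsub>R\<^esub> \<one>\<^bsub>R\<^esub>" "\<one>\<^bsub>R\<^esub>" x] smult_closed[of "\<ominus>\<^bsub>R\<^esub> \<one>\<^bsub>R\<^esub>" x]
  by (simp add: R.l_neg smult_one M.minus_equality)

lemma smult_minus_right:
  assumes a: "a \<in> carrier R" and x: "x \<in> carrier M"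
  shows "a \<odot>\<^bsub>M\<^esub> (\<ominus>\<^bsub>M\<^esub> x) = \<ominus>\<^bsub>M\<^esub> (a \<odot>\<^bsub>M\<^esub> x)"
proof -
  have "a \<odot>\<^bsub>M\<^esub> (\<ominus>\<^bsub>M\<^esub> x) \<oplus>\<^bsub>M\<^esub> a \<odot>\<^bsub>M\<^esub> x = \<zero>\<^bsub>M\<^esub>"
    using a x by (simp add: smult_r_distr[symmetric] M.l_neg)
  then show ?thesis using a x by (simp add: M.minus_equality smult_closed)
qed

lemma left_submodule_uminus:
  assumes "left_submodule R N M" "x \<in> N"
  shows "\<ominus>\<^bsub>M\<^esub> x \<in> N"
  using left_submoduleD(4)[OF assms(1), of "\<ominus>\<^bsub>R\<^esub> \<one>\<^bsub>R\<^esub>" x] left_submoduleD(1)[OF assms(1)] assms(2)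
  by (auto simp: smult_uminus_one subset_iff)

lemma left_submodule_minus:
  assumes "left_submodule R N M" "x \<in> N" "y \<in> N"
  shows "x \<ominus>\<^bsub>M\<^esub> y \<in> N"
  using left_submodule_uminus[OF assms(1,3)] left_submoduleD(3)[OF assms(1,2)]
  by (simp add: M.minus_eq)

lemma smult_finsum:
  assumes "finite S" and a: "a \<in> carrier R" and "f \<in> S \<rightarrow> carrier M"
  shows "a \<odot>\<^bsub>M\<^esub> finsum M f S = finsum M (\<lambda>x. a \<odot>\<^bsub>M\<^esub> f x) S"
  using assms(1,3)
proof induction
  case (insert x S)
  have "f x \<in> carrier M" "f \<in> S \<rightarrow> carrier M" using insert.prems by auto
  moreover have "(\<lambda>x. a \<odot>\<^bsub>M\<^esub> f x) \<in> S \<rightarrow> carrier M" using insert.prems smult_closed[OF a] by auto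
  ultimately show ?case
    using insert a by (simp add: M.finsum_insert smult_r_distr smult_closed M.finsum_closed)
qed (use a in simp)

lemma left_submodule_finsum:
  assumes N: "left_submodule R N M" and "finite S" and "\<And>x. x \<in> S \<Longrightarrow> f x \<in> N"
  shows "finsum M f S \<in> N"
  using assms(2,3)
proof induction
  case (insert x S)
  then have "f x \<in> carrier M" "f \<in> S \<rightarrow> carrier M" using left_submoduleD(1)[OF N] by auto
  then show ?case using insert left_submoduleD(3)[OF N] by (simp add: M.finsum_insert)
qed (use left_submoduleD(2)[OF N] in simp)

lemma left_submodule_zero: "left_submodule R {\<zero>\<^bsub>M\<^esub>} M"
  by (simp add: left_submodule_def)

lemma left_submodule_Inter:
  assumes "\<N> \<noteq> {}" and "\<And>N. N \<in> \<N> \<Longrightarrow> left_submodule R N M"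
  shows "left_submodule R (\<Inter>\<N>) M"
proof -
  note D = left_submoduleD[OF assms(2)]
  have "\<Inter>\<N> \<subseteq> carrier M" using assms(1) D(1) by blast
  moreover have "\<zero>\<^bsub>M\<^esub> \<in> \<Inter>\<N>" using D(2) by simp
  moreover have "x \<oplus>\<^bsub>M\<^esub> y \<in> \<Inter>\<N>" if "x \<in> \<Inter>\<N>" "y \<in> \<Inter>\<N>" for x y
    using D(3) that by simp
  moreover have "a \<odot>\<^bsub>M\<^esub> x \<in> \<Inter>\<N>" if "a \<in> carrier R" "x \<in> \<Inter>\<N>" for a x
    using D(4) that by simp
  ultimately show ?thesis unfolding left_submodule_def by simp
qed

text \<open>The predicate \<open>P\<close> is carried along so that chains in a family cut out by a
  further condition, as in an application of Zorn's lemma, fit directly.\<close>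

lemma left_submodule_Union_chain:
  assumes "\<C> \<noteq> {}" and "subset.chain {N. left_submodule R N M \<and> P N} \<C>"
  shows "left_submodule R (\<Union>\<C>) M"
proof -
  have sub: "left_submodule R N M" if "N \<in> \<C>" for N
    using assms(2) that by (auto simp: subset_chain_def)
  have "x \<oplus>\<^bsub>M\<^esub> y \<in> \<Union>\<C>" if "x \<in> X" "y \<in> Y" "X \<in> \<C>" "Y \<in> \<C>" for x y X Y
  proof -
    have "X \<subseteq> Y \<or> Y \<subseteq> X" using assms(2) that by (auto simp: subset_chain_def)
    then show ?thesis
      using left_submoduleD(3)[OF sub[OF that(3)], of x y] left_submoduleD(3)[OF sub[OF that(4)], of x y] that
      by auto
  qed
  moreover have "a \<odot>\<^bsub>M\<^esub> x \<in> \<Union>\<C>" if "a \<in> carrier R" "x \<in> X" "X \<in> \<C>" for a x X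
    using left_submoduleD(4)[OF sub[OF that(3)] that(1,2)] that(3) by blast
  moreover have "\<Union>\<C> \<subseteq> carrier M" "\<zero>\<^bsub>M\<^esub> \<in> \<Union>\<C>"
    using sub left_submoduleD(1,2) assms(1) by blast+
  ultimately show ?thesis unfolding left_submodule_def by blast
qed

lemma left_module_restrict:
  assumes "left_submodule R N M"
  shows "left_module R (M\<lparr>carrier := N\<rparr>)"
proof -
  note D = left_submoduleD[OF assms]
  have c: "x \<in> N \<Longrightarrow> x \<in> carrier M" for x using D(1) by blast
  have "abelian_group (M\<lparr>carrier := N\<rparr>)"
  proof (rule abelian_groupI)
    fix x assume "x \<in> carrier (M\<lparr>carrier := N\<rparr>)"
    then show "\<exists>y\<in>carrier (M\<lparr>carrier := N\<rparr>). y \<oplus>\<^bsub>M\<lparr>carrier := N\<rparr>\<^esub> x = \<zero>\<^bsub>M\<lparr>carrier := N\<rparr>\<^esub>"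
      using left_submodule_uminus[OF assms] c by (auto intro!: bexI[of _ "\<ominus>\<^bsub>M\<^esub> x"] M.l_neg)
  qed (use D c M.a_assoc M.a_comm in auto)
  then show ?thesis
    unfolding left_module_def left_module_axioms_def
    using D(4) c by (auto simp: R.ring_axioms smult_l_distr smult_r_distr smult_assoc smult_one)
qed

lemma left_submodule_restrict_iff:
  assumes "left_submodule R L M"
  shows "left_submodule R N (M\<lparr>carrier := L\<rparr>) \<longleftrightarrow> left_submodule R N M \<and> N \<subseteq> L"
  using left_submoduleD(1)[OF assms] by (auto simp: left_submodule_def)

lemma left_submodule_abelian_subgroup:
  assumes "left_submodule R N M"
  shows "abelian_subgroup N M"
proof (rule abelian_subgroupI3)
  have "subgroup N (add_monoid M)"
    using left_submoduleD[OF assms] left_submodule_uminus[OF assms]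
    by (auto simp: subgroup_def a_inv_def)
  then show "additive_subgroup N M" by (rule additive_subgroupI)
qed (rule M.abelian_group_axioms)

section \<open>Cosets and quotient modules\<close>

context
  fixes N assumes N: "left_submodule R N M"
begin

interpretation N: abelian_subgroup N M
  by (rule left_submodule_abelian_subgroup[OF N])

lemma coset_eq_iff:
  assumes "x \<in> carrier M" "y \<in> carrier M"
  shows "N +>\<^bsub>M\<^esub> x = N +>\<^bsub>M\<^esub> y \<longleftrightarrow> x \<ominus>\<^bsub>M\<^esub> y \<in> N"
proof -
  have "x \<in> N +>\<^bsub>M\<^esub> y \<longleftrightarrow> x \<ominus>\<^bsub>M\<^esub> y \<in> N"
    using N.a_rcos_module[OF assms(2,1)] by (simp add: M.minus_eq)
  then show ?thesis
    using N.a_repr_independence'[OF _ assms(2), of x] N.a_repr_independenceD[OF assms(1), of y] by auto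
qed

lemma coset_eq_zero_iff:
  assumes "x \<in> carrier M"
  shows "N +>\<^bsub>M\<^esub> x = N \<longleftrightarrow> x \<in> N"
  using assms N.a_rcos_const N.a_rcos_self by blast

lemma quot_module_simps [simp]:
  "carrier (quot_module M N) = a_rcosets\<^bsub>M\<^esub> N" "zero (quot_module M N) = N"
  "add (quot_module M N) = set_add M"
  by (simp_all add: quot_module_def)

lemma quot_carrierE:
  assumes "X \<in> a_rcosets\<^bsub>M\<^esub> N"
  obtains x where "x \<in> carrier M" "X = N +>\<^bsub>M\<^esub> x"
  using assms by (auto simp: A_RCOSETS_def')

text \<open>The action on a coset is defined as a union over its representatives. Representatives
  differ by elements of \<open>N\<close>, which \<open>a\<close> keeps in \<open>N\<close>, so all
  cosets in the union coincide.\<close>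

lemma quot_smult:
  assumes a: "a \<in> carrier R" and x: "x \<in> carrier M"
  shows "a \<odot>\<^bsub>quot_module M N\<^esub> (N +>\<^bsub>M\<^esub> x) = N +>\<^bsub>M\<^esub> (a \<odot>\<^bsub>M\<^esub> x)"
proof -
  have "N +>\<^bsub>M\<^esub> (a \<odot>\<^bsub>M\<^esub> y) = N +>\<^bsub>M\<^esub> (a \<odot>\<^bsub>M\<^esub> x)" if y: "y \<in> N +>\<^bsub>M\<^esub> x" for y
  proof -
    have yc: "y \<in> carrier M" using N.a_elemrcos_carrier[OF x y] .
    have "y \<ominus>\<^bsub>M\<^esub> x \<in> N" using N.a_rcos_module[OF x yc] y by (simp add: M.minus_eq)
    then have "a \<odot>\<^bsub>M\<^esub> (y \<ominus>\<^bsub>M\<^esub> x) \<in> N" by (rule left_submoduleD(4)[OF N a])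
    then have "a \<odot>\<^bsub>M\<^esub> y \<ominus>\<^bsub>M\<^esub> a \<odot>\<^bsub>M\<^esub> x \<in> N"
      using a x yc by (simp add: M.minus_eq smult_r_distr smult_minus_right)
    then show ?thesis using coset_eq_iff[OF smult_closed[OF a yc] smult_closed[OF a x]] by simp
  qed
  then have "(\<Union>y\<in>N +>\<^bsub>M\<^esub> x. N +>\<^bsub>M\<^esub> (a \<odot>\<^bsub>M\<^esub> y)) = (\<Union>y\<in>N +>\<^bsub>M\<^esub> x. N +>\<^bsub>M\<^esub> (a \<odot>\<^bsub>M\<^esub> x))"
    by (rule SUP_cong[OF refl])
  also have "\<dots> = N +>\<^bsub>M\<^esub> (a \<odot>\<^bsub>M\<^esub> x)" using N.a_rcos_self[OF x] by (subst UN_constant) auto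
  finally show ?thesis by (simp add: quot_module_def)
qed

lemma left_module_quot: "left_module R (quot_module M N)"
proof -
  interpret Q: comm_group "M A_Mod N" by (rule N.a_factorgroup_is_comm_group)
  have A_Mod: "carrier (M A_Mod N) = a_rcosets\<^bsub>M\<^esub> N" "one (M A_Mod N) = N"
    by (simp_all add: A_FactGroup_def FactGroup_def A_RCOSETS_def)
  have "abelian_group (quot_module M N)"
  proof (rule abelian_groupI)
    fix X assume "X \<in> carrier (quot_module M N)"
    then show "\<exists>Y\<in>carrier (quot_module M N). Y \<oplus>\<^bsub>quot_module M N\<^esub> X = \<zero>\<^bsub>quot_module M N\<^esub>"
      using Q.l_inv_ex[of X] by (simp add: A_Mod)
  qed (use Q.m_closed Q.one_closed Q.m_assoc Q.m_comm Q.l_one in \<open>simp_all add: A_Mod\<close>)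
  moreover have add: "(N +>\<^bsub>M\<^esub> x) \<oplus>\<^bsub>quot_module M N\<^esub> (N +>\<^bsub>M\<^esub> y) = N +>\<^bsub>M\<^esub> (x \<oplus>\<^bsub>M\<^esub> y)"
    if "x \<in> carrier M" "y \<in> carrier M" for x y
    using N.a_rcos_sum[OF that] by simp
  ultimately show ?thesis
    unfolding left_module_def left_module_axioms_def
    by (auto elim!: quot_carrierE simp: quot_smult smult_closed smult_l_distr smult_r_distr smult_assoc
        smult_one R.ring_axioms M.a_rcosetsI[OF left_submoduleD(1)[OF N]])
qed

lemma simple_quotI:
  assumes "N \<noteq> carrier M"
    and max: "\<And>X. left_submodule R X M \<Longrightarrow> N \<subseteq> X \<Longrightarrow> X = N \<or> X = carrier M"
  shows "simple_module R (quot_module M N)"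
  unfolding simple_module_def
proof (intro conjI allI impI left_module_quot)
  have cos: "N +>\<^bsub>M\<^esub> x \<in> a_rcosets\<^bsub>M\<^esub> N" if "x \<in> carrier M" for x
    using M.a_rcosetsI[OF left_submoduleD(1)[OF N] that] .
  obtain v where v: "v \<in> carrier M" "v \<notin> N" using assms(1) left_submoduleD(1)[OF N] by blast
  then show "carrier (quot_module M N) \<noteq> {\<zero>\<^bsub>quot_module M N\<^esub>}"
    using cos[OF v(1)] coset_eq_zero_iff[OF v(1)] by auto
  fix Y assume Y: "left_submodule R Y (quot_module M N)"
  note Y' = left_submoduleD[OF Y]
  \<comment> \<open>The preimage of \<open>Y\<close> under the projection; maximality of
    \<open>N\<close> is applied to it.\<close>
  define X where "X = {x \<in> carrier M. N +>\<^bsub>M\<^esub> x \<in> Y}"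
  have "left_submodule R X M"
    unfolding left_submodule_def
  proof (intro conjI ballI)
    show "\<zero>\<^bsub>M\<^esub> \<in> X"
      using Y'(2) coset_eq_zero_iff[of "\<zero>\<^bsub>M\<^esub>"] left_submoduleD(2)[OF N] by (simp add: X_def)
    show "x \<oplus>\<^bsub>M\<^esub> y \<in> X" if "x \<in> X" "y \<in> X" for x y
      using Y'(3)[of "N +>\<^bsub>M\<^esub> x" "N +>\<^bsub>M\<^esub> y"] that N.a_rcos_sum[of x y] by (simp add: X_def)
    show "a \<odot>\<^bsub>M\<^esub> x \<in> X" if "a \<in> carrier R" "x \<in> X" for a x
      using Y'(4)[of a "N +>\<^bsub>M\<^esub> x"] that quot_smult[of a x] by (simp add: X_def smult_closed)
  qed (auto simp: X_def)
  moreover have "N \<subseteq> X"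
  proof
    fix x assume x: "x \<in> N"
    then have "x \<in> carrier M" using left_submoduleD(1)[OF N] by blast
    then show "x \<in> X" using x Y'(2) coset_eq_zero_iff[of x] by (simp add: X_def)
  qed
  moreover have Yc: "Y \<subseteq> a_rcosets\<^bsub>M\<^esub> N" using Y'(1) by simp
  ultimately consider "X = N" | "X = carrier M" using max by blast
  then show "Y = {\<zero>\<^bsub>quot_module M N\<^esub>} \<or> Y = carrier (quot_module M N)"
  proof cases
    case 1
    have "y = N" if y: "y \<in> Y" for y
    proof -
      obtain x where "x \<in> carrier M" "y = N +>\<^bsub>M\<^esub> x" using quot_carrierE[OF subsetD[OF Yc y]] .
      then have "x \<in> X" using y by (simp add: X_def)
      then show ?thesis using 1 coset_eq_zero_iff[OF \<open>x \<in> carrier M\<close>] \<open>y = N +>\<^bsub>M\<^esub> x\<close> by simp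
    qed
    then have "Y \<subseteq> {N}" by blast
    moreover have "N \<in> Y" using Y'(2) by simp
    ultimately have "Y = {N}" by blast
    then show ?thesis by simp
  next
    case 2
    have "y \<in> Y" if y: "y \<in> a_rcosets\<^bsub>M\<^esub> N" for y
    proof -
      obtain x where "x \<in> carrier M" "y = N +>\<^bsub>M\<^esub> x" using quot_carrierE[OF y] .
      then show ?thesis using 2 unfolding X_def by blast
    qed
    then have "Y = a_rcosets\<^bsub>M\<^esub> N" using Yc by blast
    then show ?thesis by simp
  qed
qed

end

text \<open>A submodule \<open>Q\<close> maximal among those not containing \<open>v\<close> becomes a maximal submodule of the
  submodule generated by \<open>Q\<close> and \<open>v\<close>.\<close>

lemma exists_simple_subquotient:
  assumes L: "left_submodule R L M" and v: "v \<in> L" "v \<noteq> \<zero>\<^bsub>M\<^esub>"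
  obtains L' Q where "left_submodule R L' M" "left_submodule R Q M" "Q \<subseteq> L'" "L' \<subseteq> L"
    "simple_module R (quot_module (M\<lparr>carrier := L'\<rparr>) Q)"
proof -
  define \<A> where "\<A> = {N. left_submodule R N M \<and> N \<subseteq> L \<and> v \<notin> N}"
  have "{\<zero>\<^bsub>M\<^esub>} \<in> \<A>"
    using left_submodule_zero left_submoduleD(2)[OF L] v by (auto simp: \<A>_def)
  moreover have "\<Union>\<C> \<in> \<A>" if "\<C> \<noteq> {}" "subset.chain \<A> \<C>" for \<C>
    using left_submodule_Union_chain[OF that(1), of "\<lambda>N. N \<subseteq> L \<and> v \<notin> N"] that(2)
    by (auto simp: \<A>_def subset_chain_def)
  ultimately obtain Q where Q: "Q \<in> \<A>" and max: "\<And>X. X \<in> \<A> \<Longrightarrow> Q \<subseteq> X \<Longrightarrow> X = Q"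
    using subset_Zorn_nonempty[of \<A>] by blast
  define \<N> where "\<N> = {X. left_submodule R X M \<and> Q \<subseteq> X \<and> v \<in> X}"
  have Qs: "left_submodule R Q M" and QL: "Q \<subseteq> L" and vQ: "v \<notin> Q" using Q by (auto simp: \<A>_def)
  have LN: "L \<in> \<N>" using L v QL by (simp add: \<N>_def)
  have L's: "left_submodule R (\<Inter>\<N>) M"
    by (rule left_submodule_Inter) (use LN in \<open>auto simp: \<N>_def\<close>)
  have QL': "Q \<subseteq> \<Inter>\<N>" and vL': "v \<in> \<Inter>\<N>" and L'L: "\<Inter>\<N> \<subseteq> L"
    using LN by (auto simp: \<N>_def)
  interpret L': left_module R "M\<lparr>carrier := \<Inter>\<N>\<rparr>" by (rule left_module_restrict[OF L's])
  have "simple_module R (quot_module (M\<lparr>carrier := \<Inter>\<N>\<rparr>) Q)"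
  proof (rule L'.simple_quotI)
    show "left_submodule R Q (M\<lparr>carrier := \<Inter>\<N>\<rparr>)"
      using left_submodule_restrict_iff[OF L's] Qs QL' by blast
    show "Q \<noteq> carrier (M\<lparr>carrier := \<Inter>\<N>\<rparr>)" using vL' vQ by auto
  next
    fix X assume "left_submodule R X (M\<lparr>carrier := \<Inter>\<N>\<rparr>)" and QX: "Q \<subseteq> X"
    then have X: "left_submodule R X M" "X \<subseteq> \<Inter>\<N>"
      using left_submodule_restrict_iff[OF L's] by blast+
    \<comment> \<open>A submodule in between that contains \<open>v\<close> is everything, by
      minimality of the generated submodule; one that misses \<open>v\<close> competes with
      \<open>Q\<close> and equals it by maximality.\<close>
    show "X = Q \<or> X = carrier (M\<lparr>carrier := \<Inter>\<N>\<rparr>)"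
    proof (cases "v \<in> X")
      case True
      then have "X \<in> \<N>" using X QX by (simp add: \<N>_def)
      then show ?thesis using X(2) by auto
    next
      case False
      then have "X \<in> \<A>" using X L'L by (auto simp: \<A>_def)
      then show ?thesis using max QX by blast
    qed
  qed
  then show ?thesis using that L's Qs QL' L'L by blast
qed

end

text \<open>The isomorphism is \<open>f\<close> followed by the inverse of \<open>g\<close>;
  linearity follows by writing the values of \<open>f\<close> as values of \<open>g\<close>. It
  compares two simple subquotients through their common isomorphic image.\<close>

lemma isomorphic_modules_common:
  assumes "isomorphic_modules R S\<^sub>1 T" and "isomorphic_modules R S\<^sub>2 T"
    and S\<^sub>2: "left_module R S\<^sub>2"
  shows "isomorphic_modules R S\<^sub>1 S\<^sub>2"
proof -
  interpret left_module R S\<^sub>2 by (rule S\<^sub>2)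
  obtain f g where f: "f \<in> LinearCombinations.module_hom R S\<^sub>1 T" "bij_betw f (carrier S\<^sub>1) (carrier T)"
    and g: "g \<in> LinearCombinations.module_hom R S\<^sub>2 T" "bij_betw g (carrier S\<^sub>2) (carrier T)"
    using assms(1,2) unfolding isomorphic_modules_def by blast
  define h where "h = inv_into (carrier S\<^sub>2) g"
  have h: "bij_betw h (carrier T) (carrier S\<^sub>2)" unfolding h_def using g(2) by (rule bij_betw_inv_into)
  have gh: "g (h t) = t" if "t \<in> carrier T" for t
    unfolding h_def using g(2) that by (simp add: bij_betw_inv_into_right)
  have hg: "h (g s) = s" if "s \<in> carrier S\<^sub>2" for s
    unfolding h_def using g(2) that by (simp add: bij_betw_inv_into_left)
  have fc: "f x \<in> carrier T" if "x \<in> carrier S\<^sub>1" for x using f(1) that by (auto simp: LinearCombinations.module_hom_def)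
  have hc: "h t \<in> carrier S\<^sub>2" if "t \<in> carrier T" for t using h that by (auto simp: bij_betw_def)
  have "h \<circ> f \<in> LinearCombinations.module_hom R S\<^sub>1 S\<^sub>2"
    unfolding LinearCombinations.module_hom_def
  proof (intro CollectI conjI allI impI)
    show "h \<circ> f \<in> carrier S\<^sub>1 \<rightarrow> carrier S\<^sub>2" using fc hc by auto
  next
    fix x y assume "x \<in> carrier S\<^sub>1 \<and> y \<in> carrier S\<^sub>1"
    then have xy: "x \<in> carrier S\<^sub>1" "y \<in> carrier S\<^sub>1" by auto
    have "f (x \<oplus>\<^bsub>S\<^sub>1\<^esub> y) = g (h (f x)) \<oplus>\<^bsub>T\<^esub> g (h (f y))"
      using LinearCombinations.module_hom_add[OF f(1) xy] gh fc xy by simp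
    also have "\<dots> = g (h (f x) \<oplus>\<^bsub>S\<^sub>2\<^esub> h (f y))"
      using LinearCombinations.module_hom_add[OF g(1)] hc fc xy by simp
    finally show "(h \<circ> f) (x \<oplus>\<^bsub>S\<^sub>1\<^esub> y) = (h \<circ> f) x \<oplus>\<^bsub>S\<^sub>2\<^esub> (h \<circ> f) y"
      using hg hc fc xy by simp
  next
    fix a x assume "a \<in> carrier R \<and> x \<in> carrier S\<^sub>1"
    then have ax: "a \<in> carrier R" "x \<in> carrier S\<^sub>1" by auto
    have "f (a \<odot>\<^bsub>S\<^sub>1\<^esub> x) = a \<odot>\<^bsub>T\<^esub> g (h (f x))"
      using LinearCombinations.module_hom_smult[OF f(1) ax] gh fc ax by simp
    also have "\<dots> = g (a \<odot>\<^bsub>S\<^sub>2\<^esub> h (f x))"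
      using LinearCombinations.module_hom_smult[OF g(1)] hc fc ax by simp
    finally show "(h \<circ> f) (a \<odot>\<^bsub>S\<^sub>1\<^esub> x) = a \<odot>\<^bsub>S\<^sub>2\<^esub> (h \<circ> f) x"
      using hg hc fc ax smult_closed by simp
  qed
  moreover have "bij_betw (h \<circ> f) (carrier S\<^sub>1) (carrier S\<^sub>2)" using f(2) h by (rule bij_betw_trans)
  ultimately show ?thesis unfolding isomorphic_modules_def by blast
qed

section \<open>Shifted Euler operators\<close>

text \<open>For \<open>c = w i\<close> these generate \<open>max_ideal w\<close>. The constant is a
  parameter because passing \<open>int_op i\<close> or \<open>d_op i\<close> changes it by
  one.\<close>

definition G_op :: "'n \<Rightarrow> 'k \<Rightarrow> ('n, 'k::field_char_0) op" where
  "G_op i c p = H_op i p - scal c p"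

lemma scal_diff: "scal (b - c) p = scal b p - scal c p"
  using scal_plus[of "b - c" c] by (metis add_diff_cancel_right' diff_add_cancel)

lemma op_diff: "d_op i (p - q) = d_op i p - d_op i q" "int_op i (p - q) = int_op i p - int_op i q"
   "H_op i (p - q) = H_op i p - H_op i q" "scal c (p - q) = scal c p - scal c q"
  by (metis op_add(3) add_diff_cancel_right' diff_add_cancel, metis op_add(4) add_diff_cancel_right' diff_add_cancel,
   metis op_add(5) add_diff_cancel_right' diff_add_cancel, metis op_add(1) add_diff_cancel_right' diff_add_cancel)

lemma G_op_eq: "G_op i c = (\<lambda>p. H_op i p + scal (- c) p)"
  by (rule ext) (simp add: G_op_def scal_def single_uminus)

lemma G_op_0: "G_op i 0 = H_op i"
  by (rule ext) (simp add: G_op_def scal_zero)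

lemma G_op_change: "G_op i c = (\<lambda>p. G_op i b p + scal (b - c) p)"
  by (rule ext) (simp add: G_op_def scal_diff)

lemma G_op_I_alg [simp, intro]: "G_op i c \<in> carrier I_alg"
  unfolding G_op_eq by blast

lemma G_op_D_alg: "G_op i c \<in> carrier D_alg"
  unfolding carrier_D_alg G_op_eq
  using generate_ring.eng_add[of "H_op i" End_P "D_gens" "scal (- c)"] by (auto intro: generate_ring.incl)

lemmas H_op_apply = H_int_op[THEN fun_cong, unfolded comp_apply] d_H_op[THEN fun_cong, unfolded comp_apply]
lemmas scal_op_apply = scal_H_op[THEN fun_cong, unfolded comp_apply] scal_d_op[THEN fun_cong, unfolded comp_apply]
  scal_int_op[THEN fun_cong, unfolded comp_apply]

lemma G_int_op: "G_op i (c + 1) \<circ> int_op i = int_op i \<circ> G_op i c"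
  by (rule ext) (simp add: G_op_def H_op_apply op_diff scal_plus scal_one scal_op_apply)

lemma G_d_op: "G_op i (c - 1) \<circ> d_op i = d_op i \<circ> G_op i c"
  by (rule ext) (simp add: G_op_def H_op_apply op_diff scal_diff scal_one scal_op_apply)

lemma G_commute:
  assumes "H_op i \<circ> a = a \<circ> H_op i" and "scal c \<circ> a = a \<circ> scal c" and "\<And>p q. a (p - q) = a p - a q"
  shows "G_op i c \<circ> a = a \<circ> G_op i c"
  using assms(1,2)[THEN fun_cong, unfolded comp_apply] by (auto simp: G_op_def assms(3))

lemma G_int_op_commute: "i \<noteq> j \<Longrightarrow> G_op i c \<circ> int_op j = int_op j \<circ> G_op i c"
  by (rule G_commute) (simp_all add: H_int_op_commute scal_int_op op_diff)

lemma G_d_op_commute: "i \<noteq> j \<Longrightarrow> G_op i c \<circ> d_op j = d_op j \<circ> G_op i c"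
  by (rule G_commute) (simp_all add: H_d_op scal_d_op op_diff)

lemma G_H_op_commute: "G_op i c \<circ> H_op j = H_op j \<circ> G_op i c"
  by (rule G_commute) (simp_all add: H_H_op[of i j] scal_H_op op_diff)

lemma G_scal_commute: "G_op i c \<circ> scal b = scal b \<circ> G_op i c"
  by (rule G_commute) (simp_all add: scal_H_op op_diff scal_scal mult.commute)

lemma G_G_commute: "G_op i c \<circ> G_op j b = G_op j b \<circ> G_op i c"
  by (rule D_alg_commute) (simp_all add: G_op_D_alg)

text \<open>\<open>1 - \<integral>\<partial>\<close> is the projection onto the constants in the variable \<open>i\<close>, where \<open>H\<close> acts by \<open>1\<close>.\<close>

definition E_op :: "'n \<Rightarrow> ('n, 'k::field_char_0) op" where
  "E_op i p = p - int_op i (d_op i p)"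

lemma E_op_eq: "E_op i = (\<lambda>p. p + scal (- 1) (int_op i (d_op i p)))"
  by (rule ext) (simp add: E_op_def scal_def single_uminus)

lemma E_op_I_alg [simp, intro]: "E_op i \<in> carrier I_alg"
proof -
  have "(\<lambda>p. id p + (scal (- 1) \<circ> (int_op i \<circ> d_op i)) p) \<in> carrier (I_alg :: ('a, 'b) op ring)"
    by (intro I_alg_closed ops_I_alg)
  then show ?thesis unfolding E_op_eq by simp
qed

text \<open>In the same variable the shifts by -1 and +1 cancel; different variables commute. Hence
  \<integral>\<partial>, and with it \<open>E_op\<close>, preserves weights.\<close>

lemma G_int_d_op: "G_op j c \<circ> (int_op i \<circ> d_op i) = (int_op i \<circ> d_op i) \<circ> G_op j c"
proof (cases "i = j")
  case True
  then show ?thesis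
    using G_int_op[of i "c - 1"] G_d_op[of i c] by (metis comp_assoc diff_add_cancel)
next
  case False
  then show ?thesis
    using G_int_op_commute[of j i c] G_d_op_commute[of j i c] by (metis comp_assoc)
qed

lemma G_diff: "G_op i c (p - q) = G_op i c p - G_op i c q"
  by (simp add: G_op_def op_diff)

lemma G_E_op: "G_op j c \<circ> E_op i = E_op i \<circ> G_op j c"
  using G_int_d_op[of j c i, THEN fun_cong] by (auto simp: E_op_def G_diff)

text \<open>By \<open>H\<integral>\<partial> = \<integral>H\<partial> +
  \<integral>\<partial>\<close> and the Weyl relation \<open>H = 1 + \<integral>H\<partial>\<close>,
  the difference \<open>H - H\<integral>\<partial>\<close> collapses to
  \<open>1 - \<integral>\<partial>\<close>.\<close>

lemma G_E_op_1: "G_op i 1 \<circ> E_op i = (\<lambda>_. 0)"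
proof
  fix p
  have "H_op i (E_op i p) = H_op i p - H_op i (int_op i (d_op i p))" by (simp add: E_op_def op_diff)
  also have "\<dots> = E_op i p"
    using fun_cong[OF H_op_eq, of i p] by (simp add: E_op_def H_op_apply)
  finally show "(G_op i 1 \<circ> E_op i) p = 0" by (simp add: G_op_def scal_one)
qed

lemma funpow_I_alg [simp, intro]: "f \<in> carrier I_alg \<Longrightarrow> f ^^ m \<in> carrier I_alg"
  by (induction m) auto

lemma funpow_comm:
  fixes f g :: "'a \<Rightarrow> 'a"
  shows "f \<circ> g = g \<circ> f \<Longrightarrow> (f ^^ m) \<circ> g = g \<circ> (f ^^ m)"
proof (induction m)
  case (Suc m)
  then show ?case by (metis comp_assoc funpow.simps(2))
qed simp

lemma funpow_cancel:
  fixes f g :: "'a \<Rightarrow> 'a"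
  shows "f \<circ> g = id \<Longrightarrow> (f ^^ m) \<circ> (g ^^ m) = id"
proof (induction m)
  case (Suc m)
  have "(f ^^ Suc m) \<circ> (g ^^ Suc m) = (f ^^ m) \<circ> (f \<circ> g) \<circ> (g ^^ m)"
    unfolding funpow_Suc_right[of m f] funpow.simps(2)[of m g] by (simp add: comp_assoc)
  then show ?case by (simp only: Suc comp_id)
qed simp

lemma G_d_op_funpow: "G_op i (c - of_nat m) \<circ> (d_op i ^^ m) = (d_op i ^^ m) \<circ> G_op i c"
proof (induction m)
  case (Suc m)
  have "G_op i (c - of_nat (Suc m)) \<circ> (d_op i ^^ Suc m) = (G_op i (c - of_nat m - 1) \<circ> d_op i) \<circ> (d_op i ^^ m)"
    by (simp only: funpow.simps(2) comp_assoc of_nat_Suc diff_diff_eq add.commute)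
  also have "\<dots> = d_op i \<circ> (G_op i (c - of_nat m) \<circ> (d_op i ^^ m))"
    by (simp only: G_d_op comp_assoc)
  also have "\<dots> = (d_op i ^^ Suc m) \<circ> G_op i c"
    by (simp only: Suc comp_assoc funpow.simps(2))
  finally show ?case .
qed simp

section \<open>Generalized weight spaces\<close>

text \<open>Finite sums built one summand at a time, so that statements about sums of weight vectors
  go by rule induction without index sets.\<close>

inductive_set additive_hull :: "('a, 'm, 'c) module_scheme \<Rightarrow> 'm set \<Rightarrow> 'm set" for M G where
  zero: "\<zero>\<^bsub>M\<^esub> \<in> additive_hull M G"
| plus: "x \<in> G \<Longrightarrow> y \<in> additive_hull M G \<Longrightarrow> x \<oplus>\<^bsub>M\<^esub> y \<in> additive_hull M G"

context left_module
begin

lemma additive_hull_carrier: "v \<in> additive_hull M G \<Longrightarrow> G \<subseteq> carrier M \<Longrightarrow> v \<in> carrier M"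
  by (induction rule: additive_hull.induct) auto

lemma additive_hull_incl:
  assumes "x \<in> G" "G \<subseteq> carrier M" shows "x \<in> additive_hull M G"
proof -
  have "x \<oplus>\<^bsub>M\<^esub> \<zero>\<^bsub>M\<^esub> \<in> additive_hull M G"
    by (rule additive_hull.plus[OF assms(1) additive_hull.zero])
  then show ?thesis using assms by (simp add: subset_iff)
qed

lemma additive_hull_add:
  assumes "v \<in> additive_hull M G" "w \<in> additive_hull M G" "G \<subseteq> carrier M"
  shows "v \<oplus>\<^bsub>M\<^esub> w \<in> additive_hull M G"
  using assms(1)
proof induction
  case zero
  then show ?case using assms additive_hull_carrier by simp
next
  case (plus x y)
  have "x \<in> carrier M" "y \<in> carrier M" "w \<in> carrier M"
    using plus assms additive_hull_carrier by auto
  then have "x \<oplus>\<^bsub>M\<^esub> y \<oplus>\<^bsub>M\<^esub> w = x \<oplus>\<^bsub>M\<^esub> (y \<oplus>\<^bsub>M\<^esub> w)" by (rule M.a_assoc)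
  then show ?case using plus additive_hull.plus by simp
qed

text \<open>Summands with the same index are collected, using closure of each \<open>A w\<close>
  under addition, until every index occurs at most once.\<close>

lemma additive_hull_decomp:
  assumes "v \<in> additive_hull M (\<Union>w. A w)"
    and A: "\<And>w. A w \<subseteq> carrier M" "\<And>w. \<zero>\<^bsub>M\<^esub> \<in> A w"
      "\<And>w x y. x \<in> A w \<Longrightarrow> y \<in> A w \<Longrightarrow> x \<oplus>\<^bsub>M\<^esub> y \<in> A w"
  obtains S f where "finite S" "\<And>w. f w \<in> A w" "v = finsum M f S"
proof -
  have "\<exists>S f. finite S \<and> (\<forall>w. f w \<in> A w) \<and> v = finsum M f S"
    using assms(1)
  proof induction
    case zero
    show ?case by (rule exI[of _ "{}"], rule exI[of _ "\<lambda>_. \<zero>\<^bsub>M\<^esub>"]) (simp add: A(2))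
  next
    case (plus x y)
    then obtain w S f where x: "x \<in> A w" and S: "finite S" and f: "\<And>w. f w \<in> A w" and y: "y = finsum M f S"
      by auto
    have fc: "f u \<in> carrier M" for u using f A(1) by blast
    have xc: "x \<in> carrier M" using x A(1) by blast
    define r where "r = finsum M f (S - {w})"
    have rc: "r \<in> carrier M" unfolding r_def using fc by (intro M.finsum_closed) auto
    \<comment> \<open>The component already present at \<open>w\<close>, or zero; the new summand
      \<open>x\<close> is merged into it.\<close>
    define t where "t = (if w \<in> S then f w else \<zero>\<^bsub>M\<^esub>)"
    have t: "t \<in> A w" "t \<in> carrier M" using f A(2) fc by (auto simp: t_def)
    have "y = t \<oplus>\<^bsub>M\<^esub> r"
    proof (cases "w \<in> S")
      case True
      then have "finsum M f (insert w (S - {w})) = f w \<oplus>\<^bsub>M\<^esub> r"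
        unfolding r_def using S fc by (intro M.finsum_insert) auto
      then show ?thesis using True y by (simp add: insert_absorb t_def)
    qed (use y rc in \<open>simp add: t_def r_def\<close>)
    define g where "g = f(w := x \<oplus>\<^bsub>M\<^esub> t)"
    have g: "g u \<in> A u" for u using f A(3)[OF x t(1)] by (simp add: g_def)
    have gc: "g u \<in> carrier M" for u using g A(1) by blast
    have "finsum M g (insert w (S - {w})) = g w \<oplus>\<^bsub>M\<^esub> finsum M g (S - {w})"
      using S gc by (intro M.finsum_insert) auto
    also have "finsum M g (S - {w}) = r"
      unfolding r_def using fc by (intro M.finsum_cong') (auto simp: g_def)
    also have "g w \<oplus>\<^bsub>M\<^esub> r = x \<oplus>\<^bsub>M\<^esub> y"
      using xc t(2) rc \<open>y = t \<oplus>\<^bsub>M\<^esub> r\<close> by (simp add: g_def M.a_assoc)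
    finally show ?case using S g by (intro exI[of _ "insert w (S - {w})"] exI[of _ g]) auto
  qed
  then show ?thesis using that by blast
qed

end

section \<open>Modules over the operator algebra and their weight filtration\<close>

locale I_module = left_module I_alg M for M :: "(('n::finite, 'k::field_char_0) op, 'm) module"
begin

lemma op_closed [simp, intro]: "a \<in> carrier I_alg \<Longrightarrow> v \<in> carrier M \<Longrightarrow> a \<odot>\<^bsub>M\<^esub> v \<in> carrier M"
  by (rule smult_closed)

lemma op_comp: "a \<in> carrier I_alg \<Longrightarrow> b \<in> carrier I_alg \<Longrightarrow> v \<in> carrier M \<Longrightarrow>
    (a \<circ> b) \<odot>\<^bsub>M\<^esub> v = a \<odot>\<^bsub>M\<^esub> (b \<odot>\<^bsub>M\<^esub> v)"
  using smult_assoc[of a b v] by simp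

lemma op_plus: "a \<in> carrier I_alg \<Longrightarrow> b \<in> carrier I_alg \<Longrightarrow> v \<in> carrier M \<Longrightarrow>
    (\<lambda>p. a p + b p) \<odot>\<^bsub>M\<^esub> v = a \<odot>\<^bsub>M\<^esub> v \<oplus>\<^bsub>M\<^esub> b \<odot>\<^bsub>M\<^esub> v"
  using smult_l_distr[of a b v] by simp

lemma op_id [simp]: "v \<in> carrier M \<Longrightarrow> id \<odot>\<^bsub>M\<^esub> v = v"
  using smult_one by simp

lemma op_0 [simp]: "v \<in> carrier M \<Longrightarrow> (\<lambda>_. 0) \<odot>\<^bsub>M\<^esub> v = \<zero>\<^bsub>M\<^esub>"
  using smult_zero_left by simp

lemma op_swap:
  assumes "a \<circ> b = c \<circ> d" "a \<in> carrier I_alg" "b \<in> carrier I_alg" "c \<in> carrier I_alg" "d \<in> carrier I_alg"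
    "v \<in> carrier M"
  shows "a \<odot>\<^bsub>M\<^esub> (b \<odot>\<^bsub>M\<^esub> v) = c \<odot>\<^bsub>M\<^esub> (d \<odot>\<^bsub>M\<^esub> v)"
  using op_comp[of a b v] op_comp[of c d v] assms by simp

lemma d_int [simp]: "v \<in> carrier M \<Longrightarrow> d_op i \<odot>\<^bsub>M\<^esub> (int_op i \<odot>\<^bsub>M\<^esub> v) = v"
  using op_comp[of "d_op i" "int_op i" v] by (simp add: d_int_op)

lemma scal_inverse:
  assumes "c \<noteq> 0" "v \<in> carrier M"
  shows "scal (inverse c) \<odot>\<^bsub>M\<^esub> (scal c \<odot>\<^bsub>M\<^esub> v) = v"
  using op_comp[of "scal (inverse c)" "scal c" v] assms by (simp add: scal_scal scal_one)

lemma scal_uminus_one: "v \<in> carrier M \<Longrightarrow> scal (- 1) \<odot>\<^bsub>M\<^esub> v = \<ominus>\<^bsub>M\<^esub> v"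
proof -
  have "scal (- 1) \<oplus>\<^bsub>I_alg\<^esub> \<one>\<^bsub>I_alg\<^esub> = (\<zero>\<^bsub>I_alg\<^esub> :: ('n, 'k) op)"
    by (simp add: fun_eq_iff scal_def single_uminus)
  then have "\<ominus>\<^bsub>I_alg\<^esub> \<one>\<^bsub>I_alg\<^esub> = (scal (- 1) :: ('n, 'k) op)"
    by (rule R.minus_equality) auto
  then show "v \<in> carrier M \<Longrightarrow> scal (- 1) \<odot>\<^bsub>M\<^esub> v = \<ominus>\<^bsub>M\<^esub> v" using smult_uminus_one[of v] by simp
qed

lemma E_smult: "v \<in> carrier M \<Longrightarrow> E_op i \<odot>\<^bsub>M\<^esub> v = v \<ominus>\<^bsub>M\<^esub> int_op i \<odot>\<^bsub>M\<^esub> (d_op i \<odot>\<^bsub>M\<^esub> v)"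
proof -
  assume v: "v \<in> carrier M"
  define u where "u = int_op i \<odot>\<^bsub>M\<^esub> (d_op i \<odot>\<^bsub>M\<^esub> v)"
  have u: "u \<in> carrier M" using v by (simp add: u_def)
  have "E_op i = (\<lambda>p. id p + (scal (- 1) \<circ> (int_op i \<circ> d_op i)) p)" by (simp add: E_op_eq)
  then have "E_op i \<odot>\<^bsub>M\<^esub> v = (\<lambda>p. id p + (scal (- 1) \<circ> (int_op i \<circ> d_op i)) p) \<odot>\<^bsub>M\<^esub> v" by (rule arg_cong)
  also have "\<dots> = id \<odot>\<^bsub>M\<^esub> v \<oplus>\<^bsub>M\<^esub> (scal (- 1) \<circ> (int_op i \<circ> d_op i)) \<odot>\<^bsub>M\<^esub> v"
    by (intro op_plus I_alg_closed ops_I_alg v)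
  also have "(scal (- 1) \<circ> (int_op i \<circ> d_op i)) \<odot>\<^bsub>M\<^esub> v = scal (- 1) \<odot>\<^bsub>M\<^esub> u"
    using v by (simp add: op_comp u_def I_alg_closed(2))
  also have "scal (- 1) \<odot>\<^bsub>M\<^esub> u = \<ominus>\<^bsub>M\<^esub> u" by (rule scal_uminus_one[OF u])
  also have "id \<odot>\<^bsub>M\<^esub> v = v" by (rule op_id[OF v])
  finally show ?thesis by (simp only: u_def M.minus_eq)
qed

text \<open>Since \<open>x\<^sub>i = \<integral>\<^sub>i H\<^sub>i\<close>, the operators \<open>H\<^sub>i\<close> can replace the \<open>x\<^sub>i\<close> as generators.\<close>

lemma I_submoduleI:
  assumes N: "N \<subseteq> carrier M" "\<zero>\<^bsub>M\<^esub> \<in> N" "\<And>x y. x \<in> N \<Longrightarrow> y \<in> N \<Longrightarrow> x \<oplus>\<^bsub>M\<^esub> y \<in> N"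
    and gens: "\<And>c x. x \<in> N \<Longrightarrow> scal c \<odot>\<^bsub>M\<^esub> x \<in> N" "\<And>i x. x \<in> N \<Longrightarrow> d_op i \<odot>\<^bsub>M\<^esub> x \<in> N"
      "\<And>i x. x \<in> N \<Longrightarrow> int_op i \<odot>\<^bsub>M\<^esub> x \<in> N" "\<And>i x. x \<in> N \<Longrightarrow> H_op i \<odot>\<^bsub>M\<^esub> x \<in> N"
  shows "left_submodule I_alg N M"
proof -
  have "\<forall>x\<in>N. a \<odot>\<^bsub>M\<^esub> x \<in> N" if "a \<in> generate_ring End_P I_gens" for a
    using that
  proof induction
    case one
    then show ?case using N(1) by (metis End_P_simps(2) op_id subset_iff)
  next
    case (incl h)
    have "x_op i \<odot>\<^bsub>M\<^esub> v \<in> N" if "v \<in> N" for i v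
    proof -
      have "x_op i \<odot>\<^bsub>M\<^esub> v = int_op i \<odot>\<^bsub>M\<^esub> (H_op i \<odot>\<^bsub>M\<^esub> v)"
        using op_comp[of "int_op i" "H_op i" v] N(1) that by (auto simp: int_H_op)
      then show ?thesis using gens that by simp
    qed
    then show ?case using incl gens by blast
  next
    case (a_inv h)
    have E: "h \<in> carrier End_P" using End_P.generate_ring_in_carrier[OF I_gens_subset] a_inv by blast
    have h: "h \<in> carrier I_alg" using a_inv by (simp add: carrier_I_alg)
    show ?case
    proof
      fix x assume x: "x \<in> N"
      then have "(scal (- 1) \<circ> h) \<odot>\<^bsub>M\<^esub> x = scal (- 1) \<odot>\<^bsub>M\<^esub> (h \<odot>\<^bsub>M\<^esub> x)"
        using op_comp[OF _ h, of "scal (- 1)" x] N(1) by blast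
      then show "(\<ominus>\<^bsub>End_P\<^esub> h) \<odot>\<^bsub>M\<^esub> x \<in> N" using a_inv_End_P[OF E] a_inv.IH gens(1) x by simp
    qed
  next
    case (eng_add a b)
    then have ab: "a \<in> carrier I_alg" "b \<in> carrier I_alg" by (simp_all add: carrier_I_alg)
    show ?case
    proof
      fix x assume x: "x \<in> N"
      then have "(\<lambda>p. a p + b p) \<odot>\<^bsub>M\<^esub> x = a \<odot>\<^bsub>M\<^esub> x \<oplus>\<^bsub>M\<^esub> b \<odot>\<^bsub>M\<^esub> x" using op_plus[OF ab] N(1) by blast
      then show "(a \<oplus>\<^bsub>End_P\<^esub> b) \<odot>\<^bsub>M\<^esub> x \<in> N" using eng_add.IH x N(3) by simp
    qed
  next
    case (eng_mult a b)
    then have ab: "a \<in> carrier I_alg" "b \<in> carrier I_alg" by (simp_all add: carrier_I_alg)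
    show ?case
    proof
      fix x assume x: "x \<in> N"
      then have "(a \<circ> b) \<odot>\<^bsub>M\<^esub> x = a \<odot>\<^bsub>M\<^esub> (b \<odot>\<^bsub>M\<^esub> x)" using op_comp[OF ab] N(1) by blast
      then show "(a \<otimes>\<^bsub>End_P\<^esub> b) \<odot>\<^bsub>M\<^esub> x \<in> N" using eng_mult.IH x by simp
    qed
  qed
  then show ?thesis using N unfolding left_submodule_def carrier_I_alg by blast
qed

text \<open>The vectors killed by all products of k factors \<open>G_op i (w i)\<close>. The
  recursion peels off one factor per induction step; \<open>gw_eq\<close> relates it to powers of
  the maximal ideal.\<close>

primrec gw :: "nat \<Rightarrow> ('n \<Rightarrow> 'k) \<Rightarrow> 'm set" where
  "gw 0 w = {\<zero>\<^bsub>M\<^esub>}"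
| "gw (Suc k) w = {v \<in> carrier M. \<forall>i. G_op i (w i) \<odot>\<^bsub>M\<^esub> v \<in> gw k w}"

lemma gw_carrier: "v \<in> gw k w \<Longrightarrow> v \<in> carrier M"
  by (cases k) auto

lemma gw_zero: "\<zero>\<^bsub>M\<^esub> \<in> gw k w"
  by (induction k) auto

lemma gw_add: "u \<in> gw k w \<Longrightarrow> v \<in> gw k w \<Longrightarrow> u \<oplus>\<^bsub>M\<^esub> v \<in> gw k w"
  by (induction k arbitrary: u v) (auto simp: smult_r_distr)

lemma gw_shift:
  assumes a: "a \<in> carrier I_alg" and "\<And>i. G_op i (w' i) \<circ> a = a \<circ> G_op i (w i)" and "v \<in> gw k w"
  shows "a \<odot>\<^bsub>M\<^esub> v \<in> gw k w'"
  using assms(3)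
proof (induction k arbitrary: v)
  case 0
  then show ?case using a by simp
next
  case (Suc k)
  have v: "v \<in> carrier M" using Suc.prems by simp
  have "G_op i (w' i) \<odot>\<^bsub>M\<^esub> (a \<odot>\<^bsub>M\<^esub> v) \<in> gw k w'" for i
    using op_swap[OF assms(2)[of i] G_op_I_alg a a G_op_I_alg v] Suc by simp
  then show ?case using a v by simp
qed

lemma gw_G: "v \<in> gw k w \<Longrightarrow> G_op i c \<odot>\<^bsub>M\<^esub> v \<in> gw k w"
  by (rule gw_shift) (simp_all add: G_G_commute)

lemma gw_Suc: "v \<in> gw k w \<Longrightarrow> v \<in> gw (Suc k) w"
  using gw_G gw_carrier by simp

lemma gw_mono: "v \<in> gw k w \<Longrightarrow> k \<le> l \<Longrightarrow> v \<in> gw l w"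
proof (induction l)
  case (Suc l)
  then show ?case by (cases "k = Suc l") (simp_all only: gw_Suc le_Suc_eq simp_thms)
qed simp

text \<open>\<open>H\<^sub>i - c\<close> is a unipotent perturbation of the nonzero scalar \<open>w i - c\<close>, hence invertible within any
  submodule.\<close>

lemma gw_cancel:
  assumes N: "left_submodule I_alg N M" and "v \<in> gw k w" "G_op i c \<odot>\<^bsub>M\<^esub> v \<in> N" and c: "c \<noteq> w i"
  shows "v \<in> N"
  using assms(2,3)
proof (induction k arbitrary: v)
  case 0
  then show ?case using left_submoduleD(2)[OF N] by simp
next
  case (Suc k)
  define y where "y = G_op i (w i) \<odot>\<^bsub>M\<^esub> v"
  have v: "v \<in> carrier M" and y: "y \<in> gw k w" using Suc.prems by (simp_all add: y_def)
  have "G_op i c \<odot>\<^bsub>M\<^esub> y = G_op i (w i) \<odot>\<^bsub>M\<^esub> (G_op i c \<odot>\<^bsub>M\<^esub> v)"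
    unfolding y_def by (rule op_swap[OF G_G_commute]) (use v in auto)
  then have "G_op i c \<odot>\<^bsub>M\<^esub> y \<in> N" using left_submoduleD(4)[OF N G_op_I_alg] Suc.prems(2) by simp
  then have yN: "y \<in> N" using Suc.IH y by blast
  \<comment> \<open>Now \<open>G_op i c\<close> sends \<open>v\<close> to
    \<open>y \<oplus> s\<close> with \<open>y\<close> already in \<open>N\<close>, so the nonzero
    multiple \<open>s\<close> of \<open>v\<close> lies in \<open>N\<close> too.\<close>
  define s where "s = scal (w i - c) \<odot>\<^bsub>M\<^esub> v"
  have s: "s \<in> carrier M" using v by (simp add: s_def)
  have yc: "y \<in> carrier M" using y gw_carrier by blast
  have "G_op i c \<odot>\<^bsub>M\<^esub> v = (\<lambda>p. G_op i (w i) p + scal (w i - c) p) \<odot>\<^bsub>M\<^esub> v"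
    by (rule arg_cong[OF G_op_change])
  also have "\<dots> = y \<oplus>\<^bsub>M\<^esub> s" unfolding y_def s_def by (rule op_plus) (use v in auto)
  finally have "y \<oplus>\<^bsub>M\<^esub> s \<in> N" using Suc.prems(2) by simp
  then have "(y \<oplus>\<^bsub>M\<^esub> s) \<ominus>\<^bsub>M\<^esub> y \<in> N" using left_submodule_minus[OF N] yN by blast
  moreover have "(y \<oplus>\<^bsub>M\<^esub> s) \<ominus>\<^bsub>M\<^esub> y = s"
    using yc s by (simp add: M.minus_eq M.a_comm[of y s] M.a_assoc M.r_neg)
  ultimately have "s \<in> N" by simp
  then have "scal (inverse (w i - c)) \<odot>\<^bsub>M\<^esub> s \<in> N" by (rule left_submoduleD(4)[OF N, rotated]) simp
  then show ?case unfolding s_def using scal_inverse[of "w i - c" v] c v by simp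
qed

definition GW_space :: "('n \<Rightarrow> 'k) \<Rightarrow> 'm set" where
  "GW_space w = (\<Union>k. gw k w)"

lemma GW_space_carrier: "GW_space w \<subseteq> carrier M"
  using gw_carrier by (auto simp: GW_space_def)

lemma GW_space_zero: "\<zero>\<^bsub>M\<^esub> \<in> GW_space w"
  using gw_zero by (auto simp: GW_space_def)

lemma GW_space_add:
  assumes "u \<in> GW_space w" "v \<in> GW_space w"
  shows "u \<oplus>\<^bsub>M\<^esub> v \<in> GW_space w"
proof -
  obtain k l where "u \<in> gw k w" "v \<in> gw l w" using assms by (auto simp: GW_space_def)
  then have "u \<in> gw (max k l) w" "v \<in> gw (max k l) w" by (auto intro: gw_mono)
  then have "u \<oplus>\<^bsub>M\<^esub> v \<in> gw (max k l) w" by (rule gw_add)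
  then show ?thesis by (auto simp: GW_space_def)
qed

lemma GW_space_shift:
  assumes "a \<in> carrier I_alg" and "\<And>i. G_op i (w' i) \<circ> a = a \<circ> G_op i (w i)" and "v \<in> GW_space w"
  shows "a \<odot>\<^bsub>M\<^esub> v \<in> GW_space w'"
  using gw_shift[OF assms(1,2)] assms(3) by (auto simp: GW_space_def)

lemma GW_space_scal: "v \<in> GW_space w \<Longrightarrow> scal c \<odot>\<^bsub>M\<^esub> v \<in> GW_space w"
  by (rule GW_space_shift) (simp_all add: G_scal_commute)

lemma GW_space_G: "v \<in> GW_space w \<Longrightarrow> G_op i c \<odot>\<^bsub>M\<^esub> v \<in> GW_space w"
  by (rule GW_space_shift) (simp_all add: G_G_commute)

lemma GW_space_H: "v \<in> GW_space w \<Longrightarrow> H_op i \<odot>\<^bsub>M\<^esub> v \<in> GW_space w"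
  by (rule GW_space_shift) (simp_all add: G_H_op_commute)

lemma GW_space_int: "v \<in> GW_space w \<Longrightarrow> int_op i \<odot>\<^bsub>M\<^esub> v \<in> GW_space (w(i := w i + 1))"
  by (rule GW_space_shift) (auto simp: G_int_op G_int_op_commute)

lemma GW_space_d: "v \<in> GW_space w \<Longrightarrow> d_op i \<odot>\<^bsub>M\<^esub> v \<in> GW_space (w(i := w i - 1))"
  by (rule GW_space_shift) (auto simp: G_d_op G_d_op_commute)

lemma GW_space_uminus: "v \<in> GW_space w \<Longrightarrow> \<ominus>\<^bsub>M\<^esub> v \<in> GW_space w"
  using GW_space_scal[of v w "- 1"] scal_uminus_one[of v] GW_space_carrier[of w] by auto

lemma GW_space_cancel:
  assumes "left_submodule I_alg N M" "v \<in> GW_space w" "G_op i c \<odot>\<^bsub>M\<^esub> v \<in> N" "c \<noteq> w i"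
  shows "v \<in> N"
proof -
  obtain k where "v \<in> gw k w" using assms(2) by (auto simp: GW_space_def)
  then show ?thesis using gw_cancel assms by blast
qed

text \<open>Double induction: on the set of weights, and inside it on the nilpotency exponent k of
  the component at the new weight \<open>w\<^sub>0\<close>. Applying
  \<open>G_op j (w\<^sub>0 j)\<close> to the sum lowers k and keeps all weights; on the other
  components this operator can be cancelled for a suitable j.\<close>

lemma submodule_graded:
  assumes N: "left_submodule I_alg N M" and "finite S" and "\<And>w. w \<in> S \<Longrightarrow> f w \<in> GW_space w"
    and "finsum M f S \<in> N" and "w \<in> S"
  shows "f w \<in> N"
proof -
  have "\<forall>f. (\<forall>w\<in>S. f w \<in> GW_space w) \<longrightarrow> finsum M f S \<in> N \<longrightarrow> (\<forall>w\<in>S. f w \<in> N)"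
    using assms(2)
  proof induction
    case (insert w\<^sub>0 S)
    have "\<forall>w\<in>insert w\<^sub>0 S. f w \<in> N"
      if "\<forall>w\<in>S. f w \<in> GW_space w" "f w\<^sub>0 \<in> gw k w\<^sub>0" "finsum M f (insert w\<^sub>0 S) \<in> N" for k f
      using that
    proof (induction k arbitrary: f)
      case 0
      have fc: "f \<in> S \<rightarrow> carrier M" using 0 GW_space_carrier by blast
      have f0: "f w\<^sub>0 = \<zero>\<^bsub>M\<^esub>" using 0 by simp
      have "finsum M f (insert w\<^sub>0 S) = finsum M f S"
        using M.finsum_insert[OF insert.hyps fc] f0 M.finsum_closed[OF fc] by simp
      then have "\<forall>w\<in>S. f w \<in> N" using 0 insert.IH by simp
      then show ?case using f0 left_submoduleD(2)[OF N] by simp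
    next
      case (Suc k)
      have fc: "f \<in> insert w\<^sub>0 S \<rightarrow> carrier M"
        using Suc.prems(1) gw_carrier[OF Suc.prems(2)] GW_space_carrier by blast
      have G: "\<forall>w\<in>insert w\<^sub>0 S. G_op j (w\<^sub>0 j) \<odot>\<^bsub>M\<^esub> f w \<in> N" for j
      proof (rule Suc.IH)
        show "\<forall>w\<in>S. G_op j (w\<^sub>0 j) \<odot>\<^bsub>M\<^esub> f w \<in> GW_space w"
          using Suc.prems(1) GW_space_G by blast
        show "G_op j (w\<^sub>0 j) \<odot>\<^bsub>M\<^esub> f w\<^sub>0 \<in> gw k w\<^sub>0" using Suc.prems(2) by simp
        show "finsum M (\<lambda>w. G_op j (w\<^sub>0 j) \<odot>\<^bsub>M\<^esub> f w) (insert w\<^sub>0 S) \<in> N"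
          using smult_finsum[OF _ G_op_I_alg fc] left_submoduleD(4)[OF N G_op_I_alg Suc.prems(3)] insert.hyps
          by simp
      qed
      have fS: "f w \<in> N" if w: "w \<in> S" for w
      proof -
        have "w\<^sub>0 \<noteq> w" using w insert.hyps by blast
        \<comment> \<open>The index j depends on \<open>w\<close>, so the inductive claim
          \<open>G\<close> has to be available for every j.\<close>
        then obtain j where "w\<^sub>0 j \<noteq> w j" by blast
        then show ?thesis using GW_space_cancel[OF N _ _ , of "f w" w j "w\<^sub>0 j"] G Suc.prems(1) w by blast
      qed
      define s where "s = finsum M f S"
      have sN: "s \<in> N" unfolding s_def by (rule left_submodule_finsum[OF N insert.hyps(1) fS])
      have c: "f w\<^sub>0 \<in> carrier M" "s \<in> carrier M" using fc sN left_submoduleD(1)[OF N] by auto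
      have "finsum M f (insert w\<^sub>0 S) = f w\<^sub>0 \<oplus>\<^bsub>M\<^esub> s"
        unfolding s_def using insert.hyps fc by (intro M.finsum_insert) auto
      then have "(f w\<^sub>0 \<oplus>\<^bsub>M\<^esub> s) \<ominus>\<^bsub>M\<^esub> s \<in> N" using left_submodule_minus[OF N _ sN] Suc.prems(3) by simp
      then have "f w\<^sub>0 \<in> N" using c by (simp add: M.minus_eq M.a_assoc M.r_neg)
      then show ?case using fS by simp
    qed
    then show ?case by (auto simp: GW_space_def)
  qed simp
  then show ?thesis using assms by blast
qed

text \<open>Independence of the weight spaces is \<open>submodule_graded\<close> for the zero
  submodule: the summands of a vanishing sum of vectors of distinct weights vanish.\<close>

lemma additive_hull_component:
  assumes v: "v \<in> additive_hull M (\<Union>w. A w)" "v \<in> GW_space u"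
    and A: "\<And>w. A w \<subseteq> GW_space w" "\<And>w. \<zero>\<^bsub>M\<^esub> \<in> A w"
      "\<And>w x y. x \<in> A w \<Longrightarrow> y \<in> A w \<Longrightarrow> x \<oplus>\<^bsub>M\<^esub> y \<in> A w"
  shows "v \<in> A u"
proof -
  have Ac: "A w \<subseteq> carrier M" for w using A(1)[of w] GW_space_carrier[of w] by blast
  obtain S f where S: "finite S" and f: "\<And>w. f w \<in> A w" and vf: "v = finsum M f S"
    using additive_hull_decomp[OF v(1) Ac A(2,3)] by metis
  have fc: "f w \<in> carrier M" for w using f Ac by blast
  define r where "r = finsum M f (S - {u})"
  define t where "t = (if u \<in> S then f u else \<zero>\<^bsub>M\<^esub>)"
  have t: "t \<in> A u" "t \<in> carrier M" using f A(2) fc by (auto simp: t_def)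
  have rc: "r \<in> carrier M" unfolding r_def using fc by (intro M.finsum_closed) auto
  have vtr: "v = t \<oplus>\<^bsub>M\<^esub> r"
  proof (cases "u \<in> S")
    case True
    then have "finsum M f (insert u (S - {u})) = f u \<oplus>\<^bsub>M\<^esub> r"
      unfolding r_def using S fc by (intro M.finsum_insert) auto
    then show ?thesis using True vf by (simp add: insert_absorb t_def)
  qed (use vf rc in \<open>simp add: t_def r_def\<close>)
  have vc: "v \<in> carrier M" using v(2) GW_space_carrier by blast
  \<comment> \<open>Subtracting \<open>v\<close> from the summand at \<open>u\<close> makes the
    total zero; its vanishing there identifies \<open>v\<close> with the summand \<open>t\<close> in
    \<open>A u\<close>.\<close>
  define g where "g = f(u := t \<oplus>\<^bsub>M\<^esub> (\<ominus>\<^bsub>M\<^esub> v))"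
  have "t \<oplus>\<^bsub>M\<^esub> (\<ominus>\<^bsub>M\<^esub> v) \<in> GW_space u"
    using t(1) A(1) GW_space_uminus[OF v(2)] by (intro GW_space_add) auto
  then have g: "g w \<in> GW_space w" for w
    using f A(1) by (auto simp: g_def)
  have "finsum M g (insert u (S - {u})) = g u \<oplus>\<^bsub>M\<^esub> finsum M g (S - {u})"
    using S g GW_space_carrier by (intro M.finsum_insert) blast+
  also have "finsum M g (S - {u}) = r"
    unfolding r_def using fc by (intro M.finsum_cong') (auto simp: g_def)
  also have "g u \<oplus>\<^bsub>M\<^esub> r = (t \<oplus>\<^bsub>M\<^esub> r) \<oplus>\<^bsub>M\<^esub> (\<ominus>\<^bsub>M\<^esub> v)"
    using t(2) rc vc by (simp add: g_def M.a_ac)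
  also have "\<dots> = \<zero>\<^bsub>M\<^esub>" unfolding vtr[symmetric] using vc by (rule M.r_neg)
  finally have "finsum M g (insert u (S - {u})) \<in> {\<zero>\<^bsub>M\<^esub>}" by simp
  then have "g u \<in> {\<zero>\<^bsub>M\<^esub>}"
    by (rule submodule_graded[OF left_submodule_zero _ g, rotated]) (use S in simp_all)
  then have "t \<oplus>\<^bsub>M\<^esub> (\<ominus>\<^bsub>M\<^esub> v) = \<zero>\<^bsub>M\<^esub>" by (simp add: g_def)
  then have "t = v" using t(2) vc M.minus_equality[of t "\<ominus>\<^bsub>M\<^esub> v"] by simp
  then show ?thesis using t(1) by simp
qed

text \<open>The pieces are indexed by weights so that the shifts by \<partial> and \<integral> enter
  the hypotheses. It is applied to whole weight spaces in \<open>block\<close> and to transported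
  subspaces in \<open>induced\<close>.\<close>

lemma additive_hull_submodule:
  assumes A: "\<And>w. A w \<subseteq> carrier M"
    and gens: "\<And>w c x. x \<in> A w \<Longrightarrow> scal c \<odot>\<^bsub>M\<^esub> x \<in> A w"
      "\<And>w i x. x \<in> A w \<Longrightarrow> d_op i \<odot>\<^bsub>M\<^esub> x \<in> A (w(i := w i - 1))"
      "\<And>w i x. x \<in> A w \<Longrightarrow> int_op i \<odot>\<^bsub>M\<^esub> x \<in> A (w(i := w i + 1))"
      "\<And>w i x. x \<in> A w \<Longrightarrow> H_op i \<odot>\<^bsub>M\<^esub> x \<in> A w"
  shows "left_submodule I_alg (additive_hull M (\<Union>w. A w)) M"
proof -
  have U: "(\<Union>w. A w) \<subseteq> carrier M" using A by blast
  have *: "a \<odot>\<^bsub>M\<^esub> v \<in> additive_hull M (\<Union>w. A w)"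
    if "v \<in> additive_hull M (\<Union>w. A w)" and a: "a \<in> carrier I_alg" "\<And>w x. x \<in> A w \<Longrightarrow> \<exists>w'. a \<odot>\<^bsub>M\<^esub> x \<in> A w'" for a v
    using that(1)
  proof induction
    case zero
    then show ?case using a(1) additive_hull.zero[of M] by simp
  next
    case (plus x y)
    have "x \<in> carrier M" "y \<in> carrier M" using plus U additive_hull_carrier[OF _ U] by auto
    then have "a \<odot>\<^bsub>M\<^esub> (x \<oplus>\<^bsub>M\<^esub> y) = a \<odot>\<^bsub>M\<^esub> x \<oplus>\<^bsub>M\<^esub> a \<odot>\<^bsub>M\<^esub> y" using a(1) by (simp add: smult_r_distr)
    moreover have "a \<odot>\<^bsub>M\<^esub> x \<in> (\<Union>w. A w)" using plus.hyps(1) a(2) by blast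
    ultimately show ?case using additive_hull.plus[OF _ plus.IH, of "a \<odot>\<^bsub>M\<^esub> x"] by simp
  qed
  show ?thesis
  proof (rule I_submoduleI)
    show "additive_hull M (\<Union>w. A w) \<subseteq> carrier M" using additive_hull_carrier[OF _ U] by blast
  next
    fix x y assume "x \<in> additive_hull M (\<Union>w. A w)" "y \<in> additive_hull M (\<Union>w. A w)"
    then show "x \<oplus>\<^bsub>M\<^esub> y \<in> additive_hull M (\<Union>w. A w)" by (rule additive_hull_add[OF _ _ U])
  next
    show "\<zero>\<^bsub>M\<^esub> \<in> additive_hull M (\<Union>w. A w)" by (rule additive_hull.zero)
  next
    fix c x assume "x \<in> additive_hull M (\<Union>w. A w)"
    then show "scal c \<odot>\<^bsub>M\<^esub> x \<in> additive_hull M (\<Union>w. A w)"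
      by (rule *) (use gens(1) in \<open>auto\<close>)
  next
    fix i x assume "x \<in> additive_hull M (\<Union>w. A w)"
    then show "d_op i \<odot>\<^bsub>M\<^esub> x \<in> additive_hull M (\<Union>w. A w)"
      by (rule *) (use gens(2) in \<open>auto\<close>)
  next
    fix i x assume "x \<in> additive_hull M (\<Union>w. A w)"
    then show "int_op i \<odot>\<^bsub>M\<^esub> x \<in> additive_hull M (\<Union>w. A w)"
      by (rule *) (use gens(3) in \<open>auto\<close>)
  next
    fix i x assume "x \<in> additive_hull M (\<Union>w. A w)"
    then show "H_op i \<odot>\<^bsub>M\<^esub> x \<in> additive_hull M (\<Union>w. A w)"
      by (rule *) (use gens(4) in \<open>auto\<close>)
  qed
qed

end

section \<open>Powers of the maximal ideals and direct sum decompositions\<close>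

interpretation D_alg: ring "D_alg :: ('n, 'k::field_char_0) op ring"
  by (rule ring_D_alg)

lemma max_ideal_eq: "max_ideal w = Idl\<^bsub>D_alg\<^esub> (range (\<lambda>i. G_op i (w i)))"
proof -
  have "(\<lambda>i p. H_op i p - scal (w i) p) = (\<lambda>i. G_op i (w i))" by (intro ext) (simp add: G_op_def)
  then show ?thesis unfolding max_ideal_def by (rule arg_cong[where f = "\<lambda>g. Idl\<^bsub>D_alg\<^esub> (range g)"])
qed

lemma range_G_op_D_alg: "range (\<lambda>i. G_op i (w i)) \<subseteq> carrier D_alg"
  using G_op_D_alg by (rule image_subsetI)

lemma ideal_max_ideal: "ideal (max_ideal w) D_alg"
  unfolding max_ideal_eq by (rule D_alg.genideal_ideal[OF range_G_op_D_alg])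

lemma G_op_max_ideal: "G_op i (w i) \<in> max_ideal w"
  unfolding max_ideal_eq using D_alg.genideal_self[OF range_G_op_D_alg[of w]] by blast

lemma ideal_power_max_ideal: "ideal (ideal_power D_alg (max_ideal w) k) D_alg"
  by (induction k) (simp_all add: D_alg.oneideal D_alg.ideal_prod_is_ideal ideal_max_ideal)

lemma ideal_power_max_ideal_carrier: "a \<in> ideal_power D_alg (max_ideal w) k \<Longrightarrow> a \<in> carrier D_alg"
  by (rule ideal.Icarr[OF ideal_power_max_ideal])

context left_module
begin

lemma finsum_additive_hull:
  assumes "finite S" and "\<And>x. x \<in> S \<Longrightarrow> f x \<in> G" and G: "G \<subseteq> carrier M"
  shows "finsum M f S \<in> additive_hull M G"
  using assms(1,2)
proof induction
  case empty
  then show ?case by (simp add: additive_hull.zero)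
next
  case (insert x S)
  have "f x \<in> carrier M" "f \<in> S \<rightarrow> carrier M" using insert.prems G by auto
  then have "finsum M f (insert x S) = f x \<oplus>\<^bsub>M\<^esub> finsum M f S" using insert.hyps by (intro M.finsum_insert)
  moreover have "f x \<oplus>\<^bsub>M\<^esub> finsum M f S \<in> additive_hull M G"
    by (rule additive_hull.plus) (use insert in auto)
  ultimately show ?case by simp
qed

lemma direct_sum_additive_hull:
  assumes "internal_direct_sum M A" and v: "v \<in> carrier M" and A: "\<And>i. A i \<subseteq> carrier M"
  shows "v \<in> additive_hull M (\<Union>i. A i)"
proof -
  obtain f where f: "\<forall>i. f i \<in> A i" "finite {i. f i \<noteq> \<zero>\<^bsub>M\<^esub>}" "v = finsum M f {i. f i \<noteq> \<zero>\<^bsub>M\<^esub>}"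
    using assms(1) v unfolding internal_direct_sum_def by metis
  have "finsum M f {i. f i \<noteq> \<zero>\<^bsub>M\<^esub>} \<in> additive_hull M (\<Union>i. A i)"
    by (rule finsum_additive_hull) (use f A in auto)
  then show ?thesis using f(3) by simp
qed

text \<open>A decomposition of \<open>v\<close> in \<open>B i\<close> along \<open>A\<close> is also
  one along \<open>B\<close>, and so is the family with the single entry \<open>v\<close> at i.
  Uniqueness along \<open>B\<close> makes them equal, which puts \<open>v\<close> into
  \<open>A i\<close>.\<close>

lemma direct_sum_eq:
  assumes A: "internal_direct_sum M A" and B: "internal_direct_sum M B"
    and AB: "\<And>i. A i \<subseteq> B i" and z: "\<And>i. \<zero>\<^bsub>M\<^esub> \<in> B i" and Bc: "\<And>i. B i \<subseteq> carrier M"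
  shows "A = B"
proof
  fix i
  have "v \<in> A i" if v: "v \<in> B i" for v
  proof -
    have vc: "v \<in> carrier M" using v Bc by blast
    obtain f where f: "\<forall>i. f i \<in> A i" "finite {i. f i \<noteq> \<zero>\<^bsub>M\<^esub>}" "v = finsum M f {i. f i \<noteq> \<zero>\<^bsub>M\<^esub>}"
      using A vc unfolding internal_direct_sum_def by metis
    define g where "g = (\<lambda>j. if j = i then v else \<zero>\<^bsub>M\<^esub>)"
    have "v = finsum M g {j. g j \<noteq> \<zero>\<^bsub>M\<^esub>}"
    proof (cases "v = \<zero>\<^bsub>M\<^esub>")
      case False
      then have "{j. g j \<noteq> \<zero>\<^bsub>M\<^esub>} = {i}" by (auto simp: g_def)
      then show ?thesis using vc by (simp add: M.finsum_insert g_def)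
    qed (simp add: g_def)
    moreover have "{j. g j \<noteq> \<zero>\<^bsub>M\<^esub>} \<subseteq> {i}" by (auto simp: g_def)
    then have "finite {j. g j \<noteq> \<zero>\<^bsub>M\<^esub>}" by (rule finite_subset) simp
    moreover have "\<forall>j. g j \<in> B j" using v z by (simp add: g_def)
    moreover have "\<forall>j. f j \<in> B j" using f(1) AB by blast
    moreover have "\<exists>!f. (\<forall>i. f i \<in> B i) \<and> finite {i. f i \<noteq> \<zero>\<^bsub>M\<^esub>} \<and> v = finsum M f {i. f i \<noteq> \<zero>\<^bsub>M\<^esub>}"
      using B vc unfolding internal_direct_sum_def by blast
    ultimately have "f = g" using f(2,3) by blast
    then show "v \<in> A i" using f(1) by (metis g_def)
  qed
  then show "A i = B i" using AB by blast
qed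

end

context I_module
begin

lemma D_I_alg: "a \<in> carrier D_alg \<Longrightarrow> a \<in> carrier I_alg"
  using D_alg_subset_I_alg by blast

lemma D_swap: "a \<in> carrier D_alg \<Longrightarrow> b \<in> carrier D_alg \<Longrightarrow> v \<in> carrier M \<Longrightarrow>
    a \<odot>\<^bsub>M\<^esub> (b \<odot>\<^bsub>M\<^esub> v) = b \<odot>\<^bsub>M\<^esub> (a \<odot>\<^bsub>M\<^esub> v)"
  by (rule op_swap[OF D_alg_commute]) (simp_all add: D_I_alg)

text \<open>These are the \<open>a\<close> that move \<open>v\<close> into the vectors killed by
  \<open>J\<close>. Once they form an ideal, it suffices to find the generators of
  \<open>max_ideal w\<close> in it.\<close>

lemma annihilator_ideal:
  assumes v: "v \<in> carrier M" and J: "J \<subseteq> carrier D_alg"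
  shows "ideal {a \<in> carrier D_alg. \<forall>b\<in>J. b \<odot>\<^bsub>M\<^esub> (a \<odot>\<^bsub>M\<^esub> v) = \<zero>\<^bsub>M\<^esub>} D_alg" (is "ideal ?A _")
proof (rule idealI)
  have JI: "b \<in> carrier I_alg" "b \<in> carrier D_alg" if "b \<in> J" for b using J D_I_alg that by auto
  have l: "x \<otimes>\<^bsub>D_alg\<^esub> a \<in> ?A" if a: "a \<in> ?A" and x: "x \<in> carrier D_alg" for a x
  proof -
    have "b \<odot>\<^bsub>M\<^esub> ((x \<circ> a) \<odot>\<^bsub>M\<^esub> v) = \<zero>\<^bsub>M\<^esub>" if b: "b \<in> J" for b
    proof -
      have "b \<odot>\<^bsub>M\<^esub> ((x \<circ> a) \<odot>\<^bsub>M\<^esub> v) = b \<odot>\<^bsub>M\<^esub> (x \<odot>\<^bsub>M\<^esub> (a \<odot>\<^bsub>M\<^esub> v))"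
        using a x v by (simp add: op_comp D_I_alg)
      also have "\<dots> = x \<odot>\<^bsub>M\<^esub> (b \<odot>\<^bsub>M\<^esub> (a \<odot>\<^bsub>M\<^esub> v))"
        by (rule D_swap) (use JI[OF b] x a v in \<open>auto simp: D_I_alg\<close>)
      finally show ?thesis using a b x by (simp add: D_I_alg)
    qed
    then show ?thesis using D_alg.m_closed[OF x, of a] a by simp
  qed
  then show "x \<otimes>\<^bsub>D_alg\<^esub> a \<in> ?A" if "a \<in> ?A" "x \<in> carrier D_alg" for a x using that by blast
  show "a \<otimes>\<^bsub>D_alg\<^esub> x \<in> ?A" if "a \<in> ?A" "x \<in> carrier D_alg" for a x
    using l[OF that] D_alg_commute[of a x] that by simp
  show "subgroup ?A (add_monoid D_alg)"
  proof
    fix a assume a: "a \<in> ?A"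
    \<comment> \<open>As a multiple of \<open>a\<close>, the negative is covered by closure under
      multiplication.\<close>
    have "\<ominus>\<^bsub>D_alg\<^esub> a = (\<ominus>\<^bsub>D_alg\<^esub> \<one>\<^bsub>D_alg\<^esub>) \<otimes>\<^bsub>D_alg\<^esub> a"
      using a by (metis (no_types, lifting) D_alg.l_minus D_alg.l_one D_alg.one_closed mem_Collect_eq)
    also have "\<dots> \<in> ?A" by (rule l[OF a]) (rule D_alg.a_inv_closed[OF D_alg.one_closed])
    finally show "inv\<^bsub>add_monoid D_alg\<^esub> a \<in> ?A" by (simp add: a_inv_def)
  next
    fix a b assume ab: "a \<in> ?A" "b \<in> ?A"
    then have "(\<lambda>p. a p + b p) \<odot>\<^bsub>M\<^esub> v = a \<odot>\<^bsub>M\<^esub> v \<oplus>\<^bsub>M\<^esub> b \<odot>\<^bsub>M\<^esub> v"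
      using v by (intro op_plus) (auto simp: D_I_alg)
    then show "a \<otimes>\<^bsub>add_monoid D_alg\<^esub> b \<in> ?A"
      using ab D_alg.a_closed[of a b] JI v by (simp add: smult_r_distr D_I_alg)
  next
    show "\<one>\<^bsub>add_monoid D_alg\<^esub> \<in> ?A"
      using D_alg.zero_closed JI v by simp
  qed auto
qed (rule ring_D_alg)

text \<open>Commutativity of \<open>D\<close> makes it enough to test the generators of the maximal ideal.\<close>

lemma gw_eq: "gw k w = {v \<in> carrier M. \<forall>a\<in>ideal_power D_alg (max_ideal w) k. a \<odot>\<^bsub>M\<^esub> v = \<zero>\<^bsub>M\<^esub>}"
proof (induction k)
  case 0
  have "id \<in> carrier (D_alg :: ('n, 'k) op ring)" using D_alg.one_closed by simp
  then have "v = \<zero>\<^bsub>M\<^esub>" if "v \<in> carrier M" "\<forall>a\<in>carrier D_alg. a \<odot>\<^bsub>M\<^esub> v = \<zero>\<^bsub>M\<^esub>" for v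
    using that op_id[OF that(1)] by metis
  then show ?case by (auto simp: D_I_alg)
next
  case (Suc k)
  define J where "J = ideal_power D_alg (max_ideal w) k"
  have J: "J \<subseteq> carrier D_alg" unfolding J_def using ideal_power_max_ideal_carrier by blast
  have m: "a \<in> carrier D_alg" if "a \<in> max_ideal w" for a by (rule ideal.Icarr[OF ideal_max_ideal that])
  have "v \<in> gw (Suc k) w \<longleftrightarrow> (\<forall>a\<in>ideal_power D_alg (max_ideal w) (Suc k). a \<odot>\<^bsub>M\<^esub> v = \<zero>\<^bsub>M\<^esub>)"
    if v: "v \<in> carrier M" for v
  proof
    assume gw: "v \<in> gw (Suc k) w"
    let ?A = "{a \<in> carrier D_alg. \<forall>b\<in>J. b \<odot>\<^bsub>M\<^esub> (a \<odot>\<^bsub>M\<^esub> v) = \<zero>\<^bsub>M\<^esub>}"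
    have "range (\<lambda>i. G_op i (w i)) \<subseteq> ?A"
      using gw Suc.IH G_op_D_alg by (auto simp: J_def)
    then have A: "max_ideal w \<subseteq> ?A"
      unfolding max_ideal_eq by (rule D_alg.genideal_minimal[OF annihilator_ideal[OF v J]])
    show "\<forall>a\<in>ideal_power D_alg (max_ideal w) (Suc k). a \<odot>\<^bsub>M\<^esub> v = \<zero>\<^bsub>M\<^esub>"
    proof
      fix a assume "a \<in> ideal_power D_alg (max_ideal w) (Suc k)"
      then have "a \<in> ideal_prod D_alg (max_ideal w) J" by (simp add: J_def)
      then have "a \<in> carrier D_alg \<and> a \<odot>\<^bsub>M\<^esub> v = \<zero>\<^bsub>M\<^esub>"
      proof induction
        case (prod a b)
        have ab: "a \<in> carrier D_alg" "b \<in> carrier D_alg" using prod m J by auto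
        \<comment> \<open>The factor from the maximal ideal must act first: \<open>J\<close> is
          known to kill \<open>a \<odot> v\<close>, not \<open>v\<close>.\<close>
        have "(a \<circ> b) \<odot>\<^bsub>M\<^esub> v = b \<odot>\<^bsub>M\<^esub> (a \<odot>\<^bsub>M\<^esub> v)"
          using D_alg_commute[OF ab] op_comp[of b a v] ab v by (simp add: D_I_alg)
        also have "\<dots> = \<zero>\<^bsub>M\<^esub>" using A prod by blast
        finally show ?case using D_alg.m_closed[OF ab] by (simp only: D_alg_simps simp_thms)
      next
        case (sum a b)
        then have "(\<lambda>p. a p + b p) \<odot>\<^bsub>M\<^esub> v = a \<odot>\<^bsub>M\<^esub> v \<oplus>\<^bsub>M\<^esub> b \<odot>\<^bsub>M\<^esub> v"
          using v by (intro op_plus) (auto simp: D_I_alg)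
        then show ?case using sum D_alg.a_closed[of a b] by simp
      qed
      then show "a \<odot>\<^bsub>M\<^esub> v = \<zero>\<^bsub>M\<^esub>" by simp
    qed
  next
    assume R: "\<forall>a\<in>ideal_power D_alg (max_ideal w) (Suc k). a \<odot>\<^bsub>M\<^esub> v = \<zero>\<^bsub>M\<^esub>"
    have "b \<odot>\<^bsub>M\<^esub> (G_op i (w i) \<odot>\<^bsub>M\<^esub> v) = \<zero>\<^bsub>M\<^esub>" if b: "b \<in> J" for b i
    proof -
      have bD: "b \<in> carrier D_alg" using b J by blast
      have "G_op i (w i) \<circ> b \<in> ideal_power D_alg (max_ideal w) (Suc k)"
        using ideal_prod.prod[OF G_op_max_ideal b, of D_alg] by (simp add: J_def)
      then have "(G_op i (w i) \<circ> b) \<odot>\<^bsub>M\<^esub> v = \<zero>\<^bsub>M\<^esub>" using R by blast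
      then show ?thesis using D_swap[OF bD G_op_D_alg v] op_comp[of "G_op i (w i)" b v] bD v
        by (simp add: D_I_alg)
    qed
    then show "v \<in> gw (Suc k) w" using Suc.IH v by (simp add: J_def)
  qed
  then show ?case using gw_carrier[of _ "Suc k" w] by blast
qed

lemma gen_weight_comp_eq: "gen_weight_comp M w = GW_space w"
  unfolding gen_weight_comp_def GW_space_def gw_eq by blast

lemma weight_comp_subset: "weight_comp M w \<subseteq> GW_space w"
proof
  fix v assume "v \<in> weight_comp M w"
  then have "v \<in> carrier M" and "\<And>i. G_op i (w i) \<odot>\<^bsub>M\<^esub> v = \<zero>\<^bsub>M\<^esub>"
    using bspec[OF _ G_op_max_ideal[of _ w]] by (auto simp: weight_comp_def)
  then have "v \<in> gw (Suc 0) w" by simp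
  then show "v \<in> GW_space w" unfolding GW_space_def by blast
qed

lemma Supp_eq: "Supp M = {w. GW_space w \<noteq> {\<zero>\<^bsub>M\<^esub>}}"
  by (simp add: Supp_def gen_weight_comp_eq)

section \<open>Powers of integrations and derivations on weight vectors\<close>

lemma op_funpow_Suc:
  assumes "a \<in> carrier I_alg" "v \<in> carrier M"
  shows "(a ^^ Suc t) \<odot>\<^bsub>M\<^esub> v = a \<odot>\<^bsub>M\<^esub> ((a ^^ t) \<odot>\<^bsub>M\<^esub> v)"
    and "(a ^^ Suc t) \<odot>\<^bsub>M\<^esub> v = (a ^^ t) \<odot>\<^bsub>M\<^esub> (a \<odot>\<^bsub>M\<^esub> v)"
  using op_comp[of a "a ^^ t" v] op_comp[of "a ^^ t" a v] assms
  by (simp_all add: funpow_Suc_right del: funpow.simps) (simp add: funpow_Suc_right[symmetric] del: funpow_Suc_right)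

lemma op_funpow_add:
  assumes "a \<in> carrier I_alg" "v \<in> carrier M"
  shows "(a ^^ (s + t)) \<odot>\<^bsub>M\<^esub> v = (a ^^ s) \<odot>\<^bsub>M\<^esub> ((a ^^ t) \<odot>\<^bsub>M\<^esub> v)"
  using op_comp[of "a ^^ s" "a ^^ t" v] assms by (simp add: funpow_add)

lemma op_funpow_0 [simp]: "v \<in> carrier M \<Longrightarrow> (a ^^ 0) \<odot>\<^bsub>M\<^esub> v = v"
  by (simp add: op_id[unfolded id_def] id_def)

lemma d_int_funpow: "v \<in> carrier M \<Longrightarrow> (d_op i ^^ t) \<odot>\<^bsub>M\<^esub> ((int_op i ^^ t) \<odot>\<^bsub>M\<^esub> v) = v"
  using op_comp[of "d_op i ^^ t" "int_op i ^^ t" v] by (simp add: funpow_cancel[OF d_int_op])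

text \<open>The products cancel from the inside, and the innermost
  \<open>\<integral>\<partial>\<close> meets the vector \<open>\<partial>^t v\<close> with t below m
  only. This bound lets a path stop just before the weight where \<integral>\<partial> fails to be
  the identity.\<close>

lemma int_d_funpow:
  assumes "v \<in> carrier M"
    and "\<And>t. t < m \<Longrightarrow> int_op i \<odot>\<^bsub>M\<^esub> (d_op i \<odot>\<^bsub>M\<^esub> ((d_op i ^^ t) \<odot>\<^bsub>M\<^esub> v)) = (d_op i ^^ t) \<odot>\<^bsub>M\<^esub> v"
  shows "(int_op i ^^ m) \<odot>\<^bsub>M\<^esub> ((d_op i ^^ m) \<odot>\<^bsub>M\<^esub> v) = v"
  using assms(2)
proof (induction m)
  case 0
  then show ?case using assms(1) by (simp only: op_funpow_0)
next
  case (Suc m)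
  have "(int_op i ^^ Suc m) \<odot>\<^bsub>M\<^esub> ((d_op i ^^ Suc m) \<odot>\<^bsub>M\<^esub> v)
      = (int_op i ^^ m) \<odot>\<^bsub>M\<^esub> (int_op i \<odot>\<^bsub>M\<^esub> (d_op i \<odot>\<^bsub>M\<^esub> ((d_op i ^^ m) \<odot>\<^bsub>M\<^esub> v)))"
    using assms(1) by (simp only: op_funpow_Suc(1)[of "d_op i" v m] op_funpow_Suc(2)[of "int_op i" _ m] ops_I_alg
      op_closed funpow_I_alg)
  also have "\<dots> = v" using Suc by simp
  finally show ?case .
qed

lemma GW_space_d_funpow:
  "v \<in> GW_space w \<Longrightarrow> (d_op i ^^ t) \<odot>\<^bsub>M\<^esub> v \<in> GW_space (w(i := w i - of_nat t))"
proof (induction t)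
  case 0
  then have "v \<in> carrier M" using GW_space_carrier by blast
  then have "(d_op i ^^ 0) \<odot>\<^bsub>M\<^esub> v = v" by (rule op_funpow_0)
  moreover have "w(i := w i - of_nat 0) = w" by simp
  ultimately show ?case using 0 by (simp only:)
next
  case (Suc t)
  have "v \<in> carrier M" using Suc.prems GW_space_carrier by blast
  moreover have "(w(i := w i - of_nat t))(i := (w(i := w i - of_nat t)) i - 1) = w(i := w i - of_nat (Suc t))"
    by (rule ext) (simp add: algebra_simps)
  ultimately show ?case
    using GW_space_d[OF Suc.IH[OF Suc.prems], of i] by (simp only: op_funpow_Suc(1) ops_I_alg)
qed

text \<open>The defect \<open>E_op i \<odot> v\<close> has the same weight as \<open>v\<close> and
  is killed by \<open>H\<^sub>i - 1\<close>, which is injective on a weight space with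
  \<open>w i \<noteq> 1\<close>.\<close>

lemma GW_space_int_d:
  assumes v: "v \<in> GW_space w" and "w i \<noteq> 1"
  shows "int_op i \<odot>\<^bsub>M\<^esub> (d_op i \<odot>\<^bsub>M\<^esub> v) = v"
proof -
  have vc: "v \<in> carrier M" using v GW_space_carrier by blast
  have E: "E_op i \<odot>\<^bsub>M\<^esub> v \<in> GW_space w" by (rule GW_space_shift[OF _ _ v]) (simp_all add: G_E_op)
  have "G_op i 1 \<odot>\<^bsub>M\<^esub> (E_op i \<odot>\<^bsub>M\<^esub> v) = (G_op i 1 \<circ> E_op i) \<odot>\<^bsub>M\<^esub> v" using vc by (simp add: op_comp)
  also have "\<dots> = \<zero>\<^bsub>M\<^esub>" unfolding G_E_op_1 using vc by simp
  finally have "E_op i \<odot>\<^bsub>M\<^esub> v \<in> {\<zero>\<^bsub>M\<^esub>}"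
    using GW_space_cancel[OF left_submodule_zero E, of i 1] assms(2) by simp
  then show ?thesis using E_smult[OF vc, of i] vc by (simp add: M.minus_eq M.minus_equality) 
     (metis M.add.inv_closed M.minus_equality M.minus_minus op_closed ops_I_alg(3) ops_I_alg(4) M.a_comm)
qed

section \<open>Torsion and divisible parts\<close>

definition Tor :: "'n \<Rightarrow> 'm set" where
  "Tor i = {v \<in> carrier M. \<exists>m. (d_op i ^^ m) \<odot>\<^bsub>M\<^esub> v = \<zero>\<^bsub>M\<^esub>}"

text \<open>On this part \<integral> inverts \<partial>. Quantifying over all t, rather than
  requiring it of \<open>v\<close> alone, makes the set stable under \<partial>.\<close>

definition Div :: "'n \<Rightarrow> 'm set" where
  "Div i = {v \<in> carrier M. \<forall>t. int_op i \<odot>\<^bsub>M\<^esub> (d_op i \<odot>\<^bsub>M\<^esub> ((d_op i ^^ t) \<odot>\<^bsub>M\<^esub> v)) = (d_op i ^^ t) \<odot>\<^bsub>M\<^esub> v}"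

lemma Tor_mono:
  assumes "v \<in> carrier M" "(d_op i ^^ m) \<odot>\<^bsub>M\<^esub> v = \<zero>\<^bsub>M\<^esub>" "m \<le> l"
  shows "(d_op i ^^ l) \<odot>\<^bsub>M\<^esub> v = \<zero>\<^bsub>M\<^esub>"
  using op_funpow_add[of "d_op i" v "l - m" m] assms by (simp del: funpow.simps)

lemma d_funpow_commute:
  assumes "d_op i \<circ> a = a \<circ> d_op i" "a \<in> carrier I_alg" "v \<in> carrier M"
  shows "(d_op i ^^ t) \<odot>\<^bsub>M\<^esub> (a \<odot>\<^bsub>M\<^esub> v) = a \<odot>\<^bsub>M\<^esub> ((d_op i ^^ t) \<odot>\<^bsub>M\<^esub> v)"
  by (rule op_swap[OF funpow_comm[OF assms(1)]]) (use assms in auto)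

text \<open>Here \<open>G_op i (- of_nat t)\<close> is \<open>H\<^sub>i + t\<close>: each \<partial>
  that passes \<open>H\<^sub>i\<close> adds 1.\<close>

lemma d_funpow_H:
  assumes "v \<in> carrier M"
  shows "(d_op i ^^ t) \<odot>\<^bsub>M\<^esub> (H_op i \<odot>\<^bsub>M\<^esub> v) = G_op i (- of_nat t) \<odot>\<^bsub>M\<^esub> ((d_op i ^^ t) \<odot>\<^bsub>M\<^esub> v)"
  using op_swap[OF G_d_op_funpow[of i 0 t, unfolded G_op_0], where v = v] assms by simp

lemma Tor_submodule: "left_submodule I_alg (Tor i) M"
proof (rule I_submoduleI)
  show "\<zero>\<^bsub>M\<^esub> \<in> Tor i" by (simp add: Tor_def)
next
  fix x y assume "x \<in> Tor i" "y \<in> Tor i"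
  then obtain k l where xy: "x \<in> carrier M" "y \<in> carrier M"
    and "(d_op i ^^ k) \<odot>\<^bsub>M\<^esub> x = \<zero>\<^bsub>M\<^esub>" "(d_op i ^^ l) \<odot>\<^bsub>M\<^esub> y = \<zero>\<^bsub>M\<^esub>" by (auto simp: Tor_def)
  then have "(d_op i ^^ (max k l)) \<odot>\<^bsub>M\<^esub> x = \<zero>\<^bsub>M\<^esub>" "(d_op i ^^ (max k l)) \<odot>\<^bsub>M\<^esub> y = \<zero>\<^bsub>M\<^esub>"
    using Tor_mono by auto
  then have "(d_op i ^^ (max k l)) \<odot>\<^bsub>M\<^esub> (x \<oplus>\<^bsub>M\<^esub> y) = \<zero>\<^bsub>M\<^esub>" using xy by (simp add: smult_r_distr)
  then show "x \<oplus>\<^bsub>M\<^esub> y \<in> Tor i" using xy by (auto simp: Tor_def)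
next
  fix x assume "x \<in> Tor i"
  then obtain m where x: "x \<in> carrier M" and m: "(d_op i ^^ m) \<odot>\<^bsub>M\<^esub> x = \<zero>\<^bsub>M\<^esub>" by (auto simp: Tor_def)
  have comm: "a \<odot>\<^bsub>M\<^esub> x \<in> Tor i" if "d_op i \<circ> a = a \<circ> d_op i" "a \<in> carrier I_alg" for a
    using d_funpow_commute[OF that x, of m] m x that by (auto simp: Tor_def)
  show "scal c \<odot>\<^bsub>M\<^esub> x \<in> Tor i" for c by (rule comm) (simp_all add: scal_d_op)
  show "d_op j \<odot>\<^bsub>M\<^esub> x \<in> Tor i" for j by (rule comm) (simp_all add: d_d_op)
  show "int_op j \<odot>\<^bsub>M\<^esub> x \<in> Tor i" for j
  proof (cases "i = j")
    case True
    \<comment> \<open>One more power than for \<open>x\<close>, since the first \<partial> is spent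
      on \<integral>.\<close>
    have "(d_op i ^^ Suc m) \<odot>\<^bsub>M\<^esub> (int_op i \<odot>\<^bsub>M\<^esub> x) = \<zero>\<^bsub>M\<^esub>"
      using m x by (simp add: op_funpow_Suc(2) del: funpow.simps)
    then show ?thesis using True x by (auto simp: Tor_def simp del: funpow.simps)
  qed (rule comm, simp_all add: d_int_op_commute)
  show "H_op j \<odot>\<^bsub>M\<^esub> x \<in> Tor i" for j
  proof (cases "i = j")
    case True
    then show ?thesis using d_funpow_H[OF x, of m i] m x by (auto simp: Tor_def)
  qed (rule comm, simp_all add: H_d_op)
qed (auto simp: Tor_def)

lemma Div_submodule: "left_submodule I_alg (Div i) M"
proof (rule I_submoduleI)
  show "\<zero>\<^bsub>M\<^esub> \<in> Div i" by (simp add: Div_def)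
next
  fix x y assume "x \<in> Div i" "y \<in> Div i"
  then show "x \<oplus>\<^bsub>M\<^esub> y \<in> Div i" by (simp add: Div_def smult_r_distr)
next
  fix x assume "x \<in> Div i"
  then have x: "x \<in> carrier M"
    and t: "int_op i \<odot>\<^bsub>M\<^esub> (d_op i \<odot>\<^bsub>M\<^esub> ((d_op i ^^ t) \<odot>\<^bsub>M\<^esub> x)) = (d_op i ^^ t) \<odot>\<^bsub>M\<^esub> x" for t
    by (auto simp: Div_def)
  have comm: "a \<odot>\<^bsub>M\<^esub> x \<in> Div i"
    if a: "d_op i \<circ> a = a \<circ> d_op i" "a \<in> carrier I_alg" and ai: "int_op i \<circ> a = a \<circ> int_op i" for a
  proof -
    have "int_op i \<odot>\<^bsub>M\<^esub> (d_op i \<odot>\<^bsub>M\<^esub> (a \<odot>\<^bsub>M\<^esub> u)) = a \<odot>\<^bsub>M\<^esub> (int_op i \<odot>\<^bsub>M\<^esub> (d_op i \<odot>\<^bsub>M\<^esub> u))" if "u \<in> carrier M" for u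
      using op_swap[OF a(1), where v = u] op_swap[OF ai, where v = "d_op i \<odot>\<^bsub>M\<^esub> u"] a(2) that by simp
    then show ?thesis using d_funpow_commute[OF a x] t x a(2) by (simp add: Div_def)
  qed
  show "scal c \<odot>\<^bsub>M\<^esub> x \<in> Div i" for c by (rule comm) (simp_all add: scal_d_op scal_int_op)
  show "d_op j \<odot>\<^bsub>M\<^esub> x \<in> Div i" for j
  proof (cases "i = j")
    case True
    then show ?thesis using x t[of "Suc _"] by (simp add: Div_def op_funpow_Suc(2) del: funpow.simps)
  qed (rule comm, simp_all add: d_d_op d_int_op_commute)
  show "int_op j \<odot>\<^bsub>M\<^esub> x \<in> Div i" for j
  proof (cases "i = j")
    case True
    \<comment> \<open>For \<open>s = 0\<close> this is \<open>\<partial>\<integral> = 1\<close>;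
      otherwise one \<partial> cancels \<integral> and the condition on \<open>x\<close> for
      \<open>s - 1\<close> remains.\<close>
    have "int_op i \<odot>\<^bsub>M\<^esub> (d_op i \<odot>\<^bsub>M\<^esub> ((d_op i ^^ s) \<odot>\<^bsub>M\<^esub> (int_op i \<odot>\<^bsub>M\<^esub> x))) = (d_op i ^^ s) \<odot>\<^bsub>M\<^esub> (int_op i \<odot>\<^bsub>M\<^esub> x)" for s
      using t x by (cases s) (simp_all add: op_funpow_Suc(2) del: funpow.simps)
    then show ?thesis using True x by (simp add: Div_def)
  qed (rule comm, simp_all add: d_int_op_commute int_int_op)
  show "H_op j \<odot>\<^bsub>M\<^esub> x \<in> Div i" for j
  proof (cases "i = j")
    case True
    \<comment> \<open>Needed for \<open>c = - t\<close>, because \<open>\<partial>^t\<close> turns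
      \<open>H\<^sub>i\<close> into \<open>H\<^sub>i + t\<close>.\<close>
    have "int_op i \<odot>\<^bsub>M\<^esub> (d_op i \<odot>\<^bsub>M\<^esub> (G_op i c \<odot>\<^bsub>M\<^esub> u)) = G_op i c \<odot>\<^bsub>M\<^esub> (int_op i \<odot>\<^bsub>M\<^esub> (d_op i \<odot>\<^bsub>M\<^esub> u))"
      if "u \<in> carrier M" for u c
      using op_swap[OF G_int_d_op, where v = u] that by (simp add: op_comp I_alg_closed(2))
    then show ?thesis using True x t by (simp add: Div_def d_funpow_H)
  qed (rule comm, simp_all add: H_d_op H_int_op_commute)
qed (auto simp: Div_def)

lemma Tor_Div_disjoint: "Tor i \<inter> Div i = {\<zero>\<^bsub>M\<^esub>}"
proof -
  have "v = \<zero>\<^bsub>M\<^esub>" if v: "v \<in> Tor i" "v \<in> Div i" for v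
  proof -
    obtain m where m: "(d_op i ^^ m) \<odot>\<^bsub>M\<^esub> v = \<zero>\<^bsub>M\<^esub>" and vc: "v \<in> carrier M" using v(1) by (auto simp: Tor_def)
    have "(int_op i ^^ m) \<odot>\<^bsub>M\<^esub> ((d_op i ^^ m) \<odot>\<^bsub>M\<^esub> v) = v"
      by (rule int_d_funpow[OF vc]) (use v(2) in \<open>simp add: Div_def\<close>)
    then show ?thesis unfolding m by simp
  qed
  then show ?thesis
    using left_submoduleD(2)[OF Tor_submodule] left_submoduleD(2)[OF Div_submodule] by blast
qed

end

text \<open>Only the spanning half of the direct sum is assumed; independence of the weight spaces
  is \<open>submodule_graded\<close> for the zero submodule.\<close>

locale gw_module = I_module M for M :: "(('n::finite, 'k::field_char_0) op, 'm) module" +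
  assumes spanned: "v \<in> carrier M \<Longrightarrow> v \<in> additive_hull M (\<Union>w. GW_space w)"
begin

text \<open>For one weight vector, \<open>\<partial>^t v\<close> has i-th weight
  \<open>w i - t\<close>, which equals 1 for at most one t; a finite sum takes the maximum of the
  bounds.\<close>

lemma eventually_int_d:
  assumes "v \<in> carrier M"
  shows "\<exists>m. \<forall>t\<ge>m. int_op i \<odot>\<^bsub>M\<^esub> (d_op i \<odot>\<^bsub>M\<^esub> ((d_op i ^^ t) \<odot>\<^bsub>M\<^esub> v)) = (d_op i ^^ t) \<odot>\<^bsub>M\<^esub> v"
  using spanned[OF assms]
proof induction
  case zero
  then show ?case by simp
next
  case (plus x y)
  have U: "(\<Union>w. GW_space w) \<subseteq> carrier M" using GW_space_carrier by blast
  then have xy: "x \<in> carrier M" "y \<in> carrier M" using plus.hyps additive_hull_carrier[OF _ U] by auto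
  obtain l where l: "\<And>t. t \<ge> l \<Longrightarrow> int_op i \<odot>\<^bsub>M\<^esub> (d_op i \<odot>\<^bsub>M\<^esub> ((d_op i ^^ t) \<odot>\<^bsub>M\<^esub> y)) = (d_op i ^^ t) \<odot>\<^bsub>M\<^esub> y"
    using plus.IH by blast
  obtain w where x: "x \<in> GW_space w" using plus.hyps by blast
  \<comment> \<open>One more than the unique exponent at which the weight becomes 1, or 0 if this
    never happens.\<close>
  define k where "k = (if \<exists>s. w i = 1 + of_nat s then Suc (SOME s. w i = 1 + of_nat s) else 0)"
  have k: "w i - of_nat t \<noteq> 1" if "t \<ge> k" for t
  proof
    assume t: "w i - of_nat t = 1"
    then have w: "w i = 1 + of_nat t" by (simp add: algebra_simps)
    then have "w i = 1 + of_nat (SOME s. w i = 1 + of_nat s)" by (rule someI)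
    then have "t = (SOME s. w i = 1 + of_nat s)" using w by simp
    then show False using that w by (auto simp: k_def)
  qed
  have "int_op i \<odot>\<^bsub>M\<^esub> (d_op i \<odot>\<^bsub>M\<^esub> ((d_op i ^^ t) \<odot>\<^bsub>M\<^esub> x)) = (d_op i ^^ t) \<odot>\<^bsub>M\<^esub> x" if "t \<ge> k" for t
    by (rule GW_space_int_d[OF GW_space_d_funpow[OF x]]) (use k[OF that] in simp)
  then show ?case using l xy by (intro exI[of _ "max k l"]) (simp add: smult_r_distr)
qed

text \<open>A Fitting type splitting: for large m the vector \<open>\<partial>^m v\<close> lies in
  \<open>Div i\<close>, \<open>\<integral>^m\<close> brings it back to \<open>y\<close> there, and
  \<open>\<partial>^m\<close> kills \<open>v - y\<close>.\<close>

lemma Tor_plus_Div: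
  assumes v: "v \<in> carrier M"
  obtains x y where "x \<in> Tor i" "y \<in> Div i" "v = x \<oplus>\<^bsub>M\<^esub> y"
proof -
  obtain m where m: "\<And>t. t \<ge> m \<Longrightarrow> int_op i \<odot>\<^bsub>M\<^esub> (d_op i \<odot>\<^bsub>M\<^esub> ((d_op i ^^ t) \<odot>\<^bsub>M\<^esub> v)) = (d_op i ^^ t) \<odot>\<^bsub>M\<^esub> v"
    using eventually_int_d[OF v] by blast
  define z where "z = (d_op i ^^ m) \<odot>\<^bsub>M\<^esub> v"
  define y where "y = (int_op i ^^ m) \<odot>\<^bsub>M\<^esub> z"
  have zc: "z \<in> carrier M" and yc: "y \<in> carrier M" using v by (simp_all add: z_def y_def)
  have z: "z \<in> Div i"
    using m[of "t + m" for t] zc v by (simp add: Div_def z_def op_funpow_add[symmetric])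
  have y: "y \<in> Div i" unfolding y_def by (rule left_submoduleD(4)[OF Div_submodule _ z]) simp
  have dy: "(d_op i ^^ m) \<odot>\<^bsub>M\<^esub> y = z" unfolding y_def by (rule d_int_funpow[OF zc])
  have "(d_op i ^^ m) \<odot>\<^bsub>M\<^esub> (v \<ominus>\<^bsub>M\<^esub> y) = \<zero>\<^bsub>M\<^esub>"
    using v yc dy zc by (simp add: M.minus_eq smult_r_distr smult_minus_right z_def[symmetric] M.r_neg)
  then have "v \<ominus>\<^bsub>M\<^esub> y \<in> Tor i" using v yc by (auto simp: Tor_def)
  moreover have "v = (v \<ominus>\<^bsub>M\<^esub> y) \<oplus>\<^bsub>M\<^esub> y" using v yc by (simp add: M.minus_eq M.a_assoc M.l_neg)
  ultimately show ?thesis using that y by blast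
qed

lemma Tor_zero_int_d:
  assumes "Tor i = {\<zero>\<^bsub>M\<^esub>}" and v: "v \<in> carrier M"
  shows "int_op i \<odot>\<^bsub>M\<^esub> (d_op i \<odot>\<^bsub>M\<^esub> v) = v"
proof -
  obtain x y where x: "x \<in> Tor i" and y: "y \<in> Div i" and "v = x \<oplus>\<^bsub>M\<^esub> y" using Tor_plus_Div[OF v] .
  moreover have yc: "y \<in> carrier M" using y by (simp add: Div_def)
  ultimately have "v = y" using assms by simp
  moreover have "int_op i \<odot>\<^bsub>M\<^esub> (d_op i \<odot>\<^bsub>M\<^esub> ((d_op i ^^ 0) \<odot>\<^bsub>M\<^esub> y)) = (d_op i ^^ 0) \<odot>\<^bsub>M\<^esub> y"
    using y unfolding Div_def by blast
  ultimately show ?thesis using yc by (simp only: op_funpow_0)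
qed

lemma Div_zero_Tor:
  assumes "Div i = {\<zero>\<^bsub>M\<^esub>}" and v: "v \<in> carrier M"
  shows "v \<in> Tor i"
proof -
  obtain x y where x: "x \<in> Tor i" and y: "y \<in> Div i" and "v = x \<oplus>\<^bsub>M\<^esub> y" using Tor_plus_Div[OF v] .
  then show ?thesis using assms by (simp add: Tor_def)
qed

text \<open>The last nonzero vector \<open>\<partial>^s v\<close> is killed by \<partial>, so by
  \<open>GW_space_int_d\<close> its i-th weight is 1; counting back gives the weight of
  \<open>v\<close>.\<close>

lemma Div_zero_weight:
  assumes "Div i = {\<zero>\<^bsub>M\<^esub>}" and "GW_space w \<noteq> {\<zero>\<^bsub>M\<^esub>}"
  obtains s where "w i = 1 + of_nat s"
proof -
  have *: "\<exists>s. u i = 1 + of_nat s"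
    if "(d_op i ^^ m) \<odot>\<^bsub>M\<^esub> v = \<zero>\<^bsub>M\<^esub>" "v \<in> GW_space u" "v \<noteq> \<zero>\<^bsub>M\<^esub>" for m v u
    using that
  proof (induction m arbitrary: v u)
    case 0
    then have "v \<in> carrier M" using GW_space_carrier by blast
    then show ?case using 0 by (simp only: op_funpow_0)
  next
    case (Suc m)
    have v: "v \<in> carrier M" using Suc.prems(2) GW_space_carrier by blast
    show ?case
    proof (cases "d_op i \<odot>\<^bsub>M\<^esub> v = \<zero>\<^bsub>M\<^esub>")
      case True
      then have "u i = 1" using GW_space_int_d[OF Suc.prems(2), of i] Suc.prems(3) by auto
      then show ?thesis by (intro exI[of _ 0]) simp
    next
      case False
      have "\<exists>s. (u(i := u i - 1)) i = 1 + of_nat s"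
        using Suc.IH[OF _ GW_space_d[OF Suc.prems(2)] False] Suc.prems(1) v
        by (simp only: op_funpow_Suc(2) ops_I_alg)
      then obtain s where "u i - 1 = 1 + of_nat s" by auto
      then have "u i = 1 + of_nat (Suc s)" by (simp add: algebra_simps)
      then show ?thesis by blast
    qed
  qed
  obtain v where v: "v \<in> GW_space w" "v \<noteq> \<zero>\<^bsub>M\<^esub>" using assms(2) GW_space_zero by blast
  then have "v \<in> Tor i" using Div_zero_Tor[OF assms(1)] GW_space_carrier by blast
  then obtain m where "(d_op i ^^ m) \<odot>\<^bsub>M\<^esub> v = \<zero>\<^bsub>M\<^esub>" by (auto simp: Tor_def)
  then show ?thesis using *[OF _ v] that by blast
qed

text \<open>By \<open>submodule_graded\<close>, a submodule contains the weight components of each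
  of its elements.\<close>

lemma submodule_subsetI:
  assumes N: "left_submodule I_alg N M" and N': "left_submodule I_alg N' M"
    and sub: "\<And>w. N \<inter> GW_space w \<subseteq> N'"
  shows "N \<subseteq> N'"
proof
  fix v assume v: "v \<in> N"
  have vc: "v \<in> carrier M" using v left_submoduleD(1)[OF N] by blast
  obtain S f where S: "finite S" and f: "\<And>w. f w \<in> GW_space w" and vf: "v = finsum M f S"
    using additive_hull_decomp[OF spanned[OF vc] GW_space_carrier GW_space_zero GW_space_add] by metis
  have "f w \<in> N" if "w \<in> S" for w
    using submodule_graded[OF N S f _ that] v vf by blast
  then have "f w \<in> N'" if "w \<in> S" for w using sub f that by blast
  then show "v \<in> N'" unfolding vf by (rule left_submodule_finsum[OF N' S])
qed

end

lemma gw_moduleI: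
  assumes "gen_weight_module M"
  shows "gw_module M"
proof -
  interpret left_module I_alg M using assms by (simp add: gen_weight_module_def)
  interpret I_module M by unfold_locales
  show ?thesis
  proof
    fix v assume v: "v \<in> carrier M"
    have "internal_direct_sum M GW_space"
      using assms by (simp add: gen_weight_module_def gen_weight_comp_eq[abs_def])
    then show "v \<in> additive_hull M (\<Union>w. GW_space w)"
      using v GW_space_carrier by (rule direct_sum_additive_hull)
  qed
qed

lemma weight_comp_eq_gen_weight_comp:
  fixes M :: "(('n::finite, 'k::field_char_0) op, 'm) module"
  assumes "weight_module M" "gen_weight_module M"
  shows "weight_comp M w = gen_weight_comp M w"
proof -
  interpret left_module I_alg M using assms by (simp add: gen_weight_module_def)
  interpret I_module M by unfold_locales
  have "weight_comp M = gen_weight_comp M"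
    using assms by (intro direct_sum_eq)
      (auto simp: weight_module_def gen_weight_module_def gen_weight_comp_eq GW_space_zero
        dest: subsetD[OF weight_comp_subset] subsetD[OF GW_space_carrier])
  then show ?thesis by simp
qed

section \<open>Transport between weight spaces\<close>

definition T_op :: "'n \<Rightarrow> int \<Rightarrow> ('n, 'k::field_char_0) op" where
  "T_op i z = (if z \<ge> 0 then int_op i ^^ nat z else d_op i ^^ nat (- z))"

text \<open>A product over all variables in a noncommutative algebra needs an order, hence the list.
  Factors for different variables commute, so for distinct entries the order has no effect.\<close>

primrec transport :: "'n list \<Rightarrow> ('n \<Rightarrow> int) \<Rightarrow> ('n, 'k::field_char_0) op" where
  "transport [] z = id"
| "transport (i # xs) z = T_op i (z i) \<circ> transport xs z"

lemma T_op_I_alg [simp, intro]: "T_op i z \<in> carrier I_alg"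
  by (auto simp: T_op_def)

lemma transport_I_alg [simp, intro]: "transport xs z \<in> carrier I_alg"
  by (induction xs) (simp_all only: transport.simps I_alg_closed T_op_I_alg)

lemma G_int_op_funpow: "G_op i (c + of_nat m) \<circ> (int_op i ^^ m) = (int_op i ^^ m) \<circ> G_op i c"
proof (induction m)
  case (Suc m)
  have "G_op i (c + of_nat (Suc m)) \<circ> (int_op i ^^ Suc m) = (G_op i (c + of_nat m + 1) \<circ> int_op i) \<circ> (int_op i ^^ m)"
    by (simp only: funpow.simps(2) comp_assoc of_nat_Suc add.assoc add.commute[of 1])
  also have "\<dots> = int_op i \<circ> (G_op i (c + of_nat m) \<circ> (int_op i ^^ m))"
    by (simp only: G_int_op comp_assoc)
  also have "\<dots> = (int_op i ^^ Suc m) \<circ> G_op i c"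
    by (simp only: Suc comp_assoc funpow.simps(2))
  finally show ?case .
qed simp

lemma G_T_op: "G_op i (c + of_int z) \<circ> T_op i z = T_op i z \<circ> G_op i c"
proof (cases "z \<ge> 0")
  case True
  then show ?thesis using G_int_op_funpow[of i c "nat z"] by (simp only: T_op_def if_True of_nat_nat)
next
  case False
  then have "of_int z = - (of_nat (nat (- z)) :: 'b)" by simp
  then show ?thesis using G_d_op_funpow[of i c "nat (- z)"] False
    by (simp only: T_op_def if_False diff_conv_add_uminus)
qed

lemma T_op_comm:
  fixes a :: "('n, 'k::field_char_0) op"
  assumes "d_op i \<circ> a = a \<circ> d_op i" "int_op i \<circ> a = a \<circ> int_op i"
  shows "T_op i z \<circ> a = a \<circ> T_op i z"
  using funpow_comm[OF assms(1)] funpow_comm[OF assms(2)] by (cases "z \<ge> 0") (simp_all only: T_op_def if_True if_False)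

lemma G_T_op_commute: "i \<noteq> j \<Longrightarrow> G_op i c \<circ> T_op j z = T_op j z \<circ> G_op i c"
  by (rule T_op_comm[symmetric]) (rule G_d_op_commute[symmetric] G_int_op_commute[symmetric], assumption)+

lemma T_op_d_op: "i \<noteq> j \<Longrightarrow> T_op i z \<circ> d_op j = d_op j \<circ> T_op i z"
  by (rule T_op_comm, rule d_d_op) (rule d_int_op_commute[symmetric], simp)

lemma T_op_int_op: "i \<noteq> j \<Longrightarrow> T_op i z \<circ> int_op j = int_op j \<circ> T_op i z"
  by (rule T_op_comm, rule d_int_op_commute, assumption) (rule int_int_op)

lemma T_op_T_op: "i \<noteq> j \<Longrightarrow> T_op i z \<circ> T_op j y = T_op j y \<circ> T_op i z"
  by (rule T_op_comm) (rule T_op_d_op[symmetric] T_op_int_op[symmetric], simp)+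

lemma transport_comm:
  assumes "\<And>i. i \<in> set xs \<Longrightarrow> T_op i (z i) \<circ> a = a \<circ> T_op i (z i)"
  shows "transport xs z \<circ> a = a \<circ> transport xs z"
  using assms
proof (induction xs)
  case (Cons i xs)
  have "transport (i # xs) z \<circ> a = T_op i (z i) \<circ> (transport xs z \<circ> a)" by (simp only: transport.simps comp_assoc)
  also have "transport xs z \<circ> a = a \<circ> transport xs z" by (rule Cons.IH) (use Cons.prems in simp)
  also have "T_op i (z i) \<circ> (a \<circ> transport xs z) = (T_op i (z i) \<circ> a) \<circ> transport xs z" by (simp only: comp_assoc)
  also have "T_op i (z i) \<circ> a = a \<circ> T_op i (z i)" by (rule Cons.prems) simp
  also have "a \<circ> T_op i (z i) \<circ> transport xs z = a \<circ> transport (i # xs) z" by (simp only: transport.simps comp_assoc)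
  finally show ?case .
qed (simp only: transport.simps comp_id id_comp)

lemma transport_cong: "(\<And>i. i \<in> set xs \<Longrightarrow> z i = y i) \<Longrightarrow> transport xs z = transport xs y"
  by (induction xs) (simp_all only: transport.simps list.set_intros)

text \<open>Moving the factor of one variable to the right lets it act first, where it meets
  \<integral>, \<partial> or \<open>G_op\<close> of that variable.\<close>

lemma transport_remove1:
  assumes "distinct xs" "i \<in> set xs"
  shows "transport xs z = (transport (remove1 i xs) z \<circ> T_op i (z i) :: ('n, 'k::field_char_0) op)"
  using assms
proof (induction xs)
  case (Cons j xs)
  show ?case
  proof (cases "i = j")
    case True
    have "T_op i (z i) \<circ> transport xs z = (transport xs z \<circ> T_op i (z i) :: ('n, 'k) op)"
      by (rule transport_comm[symmetric], rule T_op_T_op) (use True Cons.prems in auto)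
    then show ?thesis unfolding True by (simp only: transport.simps remove1.simps simp_thms if_True)
  next
    case False
    have "transport xs z = (transport (remove1 i xs) z \<circ> T_op i (z i) :: ('n, 'k) op)"
      by (rule Cons.IH) (use Cons.prems False in auto)
    then show ?thesis using False by (simp only: transport.simps remove1.simps if_False not_sym comp_assoc)
  qed
qed simp

lemma transport_zero: "transport xs (\<lambda>_. 0) = id"
  by (induction xs) (simp_all add: T_op_def)

lemma G_transport:
  assumes "distinct xs"
  shows "G_op j (w j + (if j \<in> set xs then of_int (z j) else 0)) \<circ> transport xs z = transport xs z \<circ> G_op j (w j)"
proof (cases "j \<in> set xs")
  case True
  let ?R = "transport (remove1 j xs) z :: ('a, 'b) op"
  have R: "?R \<circ> G_op j c = G_op j c \<circ> ?R" for c :: 'b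
    by (rule transport_comm, rule G_T_op_commute[symmetric]) (use assms in auto)
  have "G_op j (w j + of_int (z j)) \<circ> transport xs z = G_op j (w j + of_int (z j)) \<circ> ?R \<circ> T_op j (z j)"
    by (simp only: transport_remove1[OF assms True, of z] comp_assoc)
  also have "\<dots> = ?R \<circ> (G_op j (w j + of_int (z j)) \<circ> T_op j (z j))" by (simp only: R[symmetric] comp_assoc)
  also have "\<dots> = transport xs z \<circ> G_op j (w j)"
    by (simp only: transport_remove1[OF assms True, of z] G_T_op comp_assoc)
  finally show ?thesis using True by simp
next
  case False
  have "transport xs z \<circ> G_op j (w j) = G_op j (w j) \<circ> transport xs z"
    by (rule transport_comm, rule G_T_op_commute[symmetric]) (use False in auto)
  then show ?thesis using False by (simp only: if_False add_0_right)
qed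

definition variables :: "'n::finite list" where
  "variables = (SOME xs. set xs = UNIV \<and> distinct xs)"

lemma variables: "set (variables :: 'n::finite list) = UNIV" "distinct (variables :: 'n list)"
proof -
  have "set (variables :: 'n list) = UNIV \<and> distinct (variables :: 'n list)"
    unfolding variables_def using finite_distinct_list[OF finite] by (rule someI_ex)
  then show "set (variables :: 'n list) = UNIV" "distinct (variables :: 'n list)" by auto
qed

definition shift :: "('n \<Rightarrow> 'k) \<Rightarrow> ('n \<Rightarrow> int) \<Rightarrow> ('n \<Rightarrow> 'k::field_char_0)" where
  "shift w z i = w i + of_int (z i)"

lemma shift_upd: "u(i := u i + of_int a) = shift w z \<Longrightarrow> u = shift w (z(i := z i - a))"
  by (rule ext) (metis (no_types, lifting) add_diff_cancel_right' add_diff_eq fun_upd_apply of_int_diff shift_def)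

lemma shift_upd_iff: "(\<exists>z. u(i := u i + of_int a) = shift w z) \<longleftrightarrow> (\<exists>z. u = shift w z)"
proof
  assume "\<exists>z. u = shift w z"
  then obtain z where "u = shift w z" by blast
  then have "u(i := u i + of_int a) = shift w (z(i := z i + a))" by (intro ext) (simp add: shift_def)
  then show "\<exists>z. u(i := u i + of_int a) = shift w z" by blast
next
  assume "\<exists>z. u(i := u i + of_int a) = shift w z"
  then obtain z where "u(i := u i + of_int a) = shift w z" ..
  then have "u = shift w (z(i := z i - a))" by (rule shift_upd)
  then show "\<exists>z. u = shift w z" by blast
qed

context I_module
begin

lemma GW_space_transport: "v \<in> GW_space w \<Longrightarrow> transport variables z \<odot>\<^bsub>M\<^esub> v \<in> GW_space (shift w z)"
  by (rule GW_space_shift) (use G_transport[OF variables(2), of _ w z] in \<open>simp_all only: variables(1) UNIV_I if_True shift_def transport_I_alg\<close>)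

text \<open>Inverse pairs are assumed to cancel on \<open>v\<close> itself, not on intermediate
  vectors. Commuting the remaining factors past each pair lets every pair act on
  \<open>v\<close>.\<close>

lemma transport_inverse:
  assumes "distinct xs" and v: "v \<in> carrier M"
    and "\<And>i. i \<in> set xs \<Longrightarrow> T_op i (- z i) \<odot>\<^bsub>M\<^esub> (T_op i (z i) \<odot>\<^bsub>M\<^esub> v) = v"
  shows "transport xs (- z) \<odot>\<^bsub>M\<^esub> (transport xs z \<odot>\<^bsub>M\<^esub> v) = v"
  using assms(1,3)
proof (induction xs)
  case (Cons i xs)
  have "transport xs (- z) \<circ> T_op i (z i) = T_op i (z i) \<circ> transport xs (- z)"
    by (rule transport_comm, rule T_op_T_op) (use Cons.prems in auto)
  then have "transport xs (- z) \<odot>\<^bsub>M\<^esub> (T_op i (z i) \<odot>\<^bsub>M\<^esub> u) = T_op i (z i) \<odot>\<^bsub>M\<^esub> (transport xs (- z) \<odot>\<^bsub>M\<^esub> u)"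
    if "u \<in> carrier M" for u
    by (rule op_swap) (use that in auto)
  then have "transport (i # xs) (- z) \<odot>\<^bsub>M\<^esub> (transport (i # xs) z \<odot>\<^bsub>M\<^esub> v)
      = T_op i (- z i) \<odot>\<^bsub>M\<^esub> (T_op i (z i) \<odot>\<^bsub>M\<^esub> (transport xs (- z) \<odot>\<^bsub>M\<^esub> (transport xs z \<odot>\<^bsub>M\<^esub> v)))"
    using v by (simp only: transport.simps op_comp T_op_I_alg transport_I_alg op_closed uminus_apply)
  also have "transport xs (- z) \<odot>\<^bsub>M\<^esub> (transport xs z \<odot>\<^bsub>M\<^esub> v) = v"
    by (rule Cons.IH) (use Cons.prems in auto)
  also have "T_op i (- z i) \<odot>\<^bsub>M\<^esub> (T_op i (z i) \<odot>\<^bsub>M\<^esub> v) = v" using Cons.prems by simp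
  finally show ?case .
qed (use op_id[OF v] in \<open>simp only: transport.simps\<close>)

text \<open>Used with \<open>a\<close> equal to \<open>int_op i\<close> or \<open>d_op i\<close>: a
  change of the i-th exponent compensates for \<open>a\<close>, and the other factors are
  unaffected.\<close>

lemma transport_comp_eq:
  assumes v: "v \<in> carrier M" and a: "a \<in> carrier I_alg"
    and "T_op i y \<odot>\<^bsub>M\<^esub> (a \<odot>\<^bsub>M\<^esub> v) = T_op i (z i) \<odot>\<^bsub>M\<^esub> v"
  shows "transport variables (z(i := y)) \<odot>\<^bsub>M\<^esub> (a \<odot>\<^bsub>M\<^esub> v) = transport variables z \<odot>\<^bsub>M\<^esub> v"
proof -
  have i: "i \<in> set variables" by (simp add: variables(1))
  have "transport (remove1 i variables) (z(i := y)) = (transport (remove1 i variables) z :: ('n, 'k) op)"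
    by (rule transport_cong) (auto simp: set_remove1_eq variables(2))
  then have "transport variables (z(i := y)) = transport (remove1 i variables) z \<circ> (T_op i y :: ('n, 'k) op)"
    by (subst transport_remove1[OF variables(2) i]) (simp only: fun_upd_same)
  moreover have "transport variables z = transport (remove1 i variables) z \<circ> (T_op i (z i) :: ('n, 'k) op)"
    by (rule transport_remove1[OF variables(2) i])
  ultimately show ?thesis
    using assms by (simp only: op_comp T_op_I_alg transport_I_alg op_closed)
qed

end

locale pure_module = gw_module M for M :: "(('n::finite, 'k::field_char_0) op, 'm) module" +
  assumes pure: "Tor i = {\<zero>\<^bsub>M\<^esub>} \<or> Div i = {\<zero>\<^bsub>M\<^esub>}"
begin

text \<open>The doubtful case is \<open>u i = 1\<close> with \<open>Div i\<close> zero. Then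
  \<partial> leads to i-th weight 0, outside the support by \<open>Div_zero_weight\<close>, so the
  image is zero.\<close>

lemma int_d_or_zero:
  assumes y: "y \<in> GW_space u"
  shows "int_op i \<odot>\<^bsub>M\<^esub> (d_op i \<odot>\<^bsub>M\<^esub> y) = y \<or> d_op i \<odot>\<^bsub>M\<^esub> y = \<zero>\<^bsub>M\<^esub>"
proof (cases "Tor i = {\<zero>\<^bsub>M\<^esub>} \<or> u i \<noteq> 1")
  case True
  have "y \<in> carrier M" using y GW_space_carrier by blast
  then show ?thesis using True Tor_zero_int_d GW_space_int_d[OF y] by blast
next
  case False
  then have D: "Div i = {\<zero>\<^bsub>M\<^esub>}" and "u i = 1" using pure[of i] by auto
  have "d_op i \<odot>\<^bsub>M\<^esub> y = \<zero>\<^bsub>M\<^esub>"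
  proof (rule ccontr)
    assume "d_op i \<odot>\<^bsub>M\<^esub> y \<noteq> \<zero>\<^bsub>M\<^esub>"
    then have "GW_space (u(i := u i - 1)) \<noteq> {\<zero>\<^bsub>M\<^esub>}" using GW_space_d[OF y, of i] by auto
    then obtain s where "(u(i := u i - 1)) i = 1 + of_nat s" using Div_zero_weight[OF D] by blast
    then have "of_nat (Suc s) = (0 :: 'k)" using \<open>u i = 1\<close> by simp
    then show False by (simp only: of_nat_eq_0_iff nat.simps)
  qed
  then show ?thesis ..
qed

text \<open>Going up, \<open>\<partial>\<integral> = 1\<close> is enough. Going down by n with
  \<open>Div i\<close> zero, the target lies in the support and has i-th weight
  \<open>1 + b\<close>; the weights met before the last step exceed it by \<open>n - t > 0\<close>
  and so are never 1.\<close>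

lemma T_op_inverse:
  assumes w: "GW_space w \<noteq> {\<zero>\<^bsub>M\<^esub>}" and w': "GW_space (shift w z) \<noteq> {\<zero>\<^bsub>M\<^esub>}" and v: "v \<in> GW_space w"
  shows "T_op i (- z i) \<odot>\<^bsub>M\<^esub> (T_op i (z i) \<odot>\<^bsub>M\<^esub> v) = v"
proof (cases "z i \<ge> 0")
  case True
  have vc: "v \<in> carrier M" using v GW_space_carrier by blast
  show ?thesis
  proof (cases "z i = 0")
    case True
    have "T_op i 0 = (id :: ('n, 'k) op)" by (simp add: T_op_def)
    then show ?thesis unfolding True using op_id[OF vc] by simp
  next
    case False
    then have "\<not> - z i \<ge> 0" using True by simp
    moreover have "nat (- (- z i)) = nat (z i)" by simp
    ultimately show ?thesis using d_int_funpow[OF vc, of "nat (z i)" i] True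
      by (simp only: T_op_def if_True if_False)
  qed
next
  case False
  define n where "n = nat (- z i)"
  have vc: "v \<in> carrier M" using v GW_space_carrier by blast
  have zi: "of_int (z i) = - (of_nat n :: 'k)" using False by (simp add: n_def)
  have "(int_op i ^^ n) \<odot>\<^bsub>M\<^esub> ((d_op i ^^ n) \<odot>\<^bsub>M\<^esub> v) = v"
  proof (rule int_d_funpow[OF vc])
    fix t assume t: "t < n"
    have dv: "(d_op i ^^ t) \<odot>\<^bsub>M\<^esub> v \<in> GW_space (w(i := w i - of_nat t))" by (rule GW_space_d_funpow[OF v])
    show "int_op i \<odot>\<^bsub>M\<^esub> (d_op i \<odot>\<^bsub>M\<^esub> ((d_op i ^^ t) \<odot>\<^bsub>M\<^esub> v)) = (d_op i ^^ t) \<odot>\<^bsub>M\<^esub> v"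
    proof (cases "Tor i = {\<zero>\<^bsub>M\<^esub>}")
      case True
      then show ?thesis by (rule Tor_zero_int_d) (use vc in auto)
    next
      case False
      then have D: "Div i = {\<zero>\<^bsub>M\<^esub>}" using pure by blast
      obtain b where "shift w z i = 1 + of_nat b" using Div_zero_weight[OF D w'] .
      then have b: "w i = 1 + of_nat b + of_nat n" using zi by (simp add: shift_def algebra_simps)
      have "w i - of_nat t \<noteq> 1"
      proof
        assume "w i - of_nat t = 1"
        then have "of_nat (b + n) = (of_nat t :: 'k)" using b by (simp add: algebra_simps)
        then have "b + n = t" by (simp only: of_nat_eq_iff)
        then show False using t by simp
      qed
      then show ?thesis by (intro GW_space_int_d[OF dv]) simp
    qed
  qed
  then show ?thesis using False by (simp add: T_op_def n_def del: op_comp)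
qed

lemma transport_transport:
  assumes "GW_space w \<noteq> {\<zero>\<^bsub>M\<^esub>}" and "GW_space (shift w z) \<noteq> {\<zero>\<^bsub>M\<^esub>}" and v: "v \<in> GW_space w"
  shows "transport variables (- z) \<odot>\<^bsub>M\<^esub> (transport variables z \<odot>\<^bsub>M\<^esub> v) = v"
  by (rule transport_inverse[OF variables(2)]) (use v GW_space_carrier T_op_inverse[OF assms] in auto)

lemma shift_uminus: "shift (shift w z) (- z) = w"
  by (rule ext) (simp add: shift_def)

lemma transport_bij_betw:
  assumes "GW_space w \<noteq> {\<zero>\<^bsub>M\<^esub>}" and "GW_space (shift w z) \<noteq> {\<zero>\<^bsub>M\<^esub>}"
  shows "bij_betw (\<lambda>v. transport variables z \<odot>\<^bsub>M\<^esub> v) (GW_space w) (GW_space (shift w z))"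
proof (rule bij_betw_byWitness[where f' = "\<lambda>v. transport variables (- z) \<odot>\<^bsub>M\<^esub> v"])
  show "\<forall>v\<in>GW_space w. transport variables (- z) \<odot>\<^bsub>M\<^esub> (transport variables z \<odot>\<^bsub>M\<^esub> v) = v"
    by (rule ballI, rule transport_transport[OF assms])
  show "\<forall>v\<in>GW_space (shift w z). transport variables z \<odot>\<^bsub>M\<^esub> (transport variables (- z) \<odot>\<^bsub>M\<^esub> v) = v"
  proof
    fix v assume "v \<in> GW_space (shift w z)"
    then have "transport variables (- (- z)) \<odot>\<^bsub>M\<^esub> (transport variables (- z) \<odot>\<^bsub>M\<^esub> v) = v"
      by (rule transport_transport[rotated 2]) (simp_all only: shift_uminus assms not_False_eq_True)
    moreover have "- (- z) = z" by (rule ext) simp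
    ultimately show "transport variables z \<odot>\<^bsub>M\<^esub> (transport variables (- z) \<odot>\<^bsub>M\<^esub> v) = v"
      by (simp only:)
  qed
  show "(\<lambda>v. transport variables z \<odot>\<^bsub>M\<^esub> v) ` GW_space w \<subseteq> GW_space (shift w z)"
    using GW_space_transport by blast
  show "(\<lambda>v. transport variables (- z) \<odot>\<^bsub>M\<^esub> v) ` GW_space (shift w z) \<subseteq> GW_space w"
    using GW_space_transport[of _ "shift w z" "- z"] unfolding shift_uminus by blast
qed

end

section \<open>Bases and dimension\<close>

text \<open>Zorn's lemma for independent sets: a linear dependence involves finitely many vectors
  and so lives in one member of a chain. Weight components of infinite dimension are thus
  included.\<close>

lemma (in vectorspace) basis_exists: "\<exists>B. basis B"
proof -
  define \<A> where "\<A> = {S. S \<subseteq> carrier V \<and> lin_indpt S}"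
  have "{} \<in> \<A>" by (simp add: \<A>_def lin_dep_def)
  moreover have "\<Union>\<C> \<in> \<A>" if \<C>: "\<C> \<noteq> {}" "subset.chain \<A> \<C>" for \<C>
  proof -
    have sub: "X \<subseteq> carrier V" "lin_indpt X" if "X \<in> \<C>" for X
      using \<C>(2) that by (auto simp: \<A>_def subset_chain_def)
    have "lin_indpt (\<Union>\<C>)"
    proof
      assume "lin_dep (\<Union>\<C>)"
      then obtain A a v where A: "finite A" "A \<subseteq> \<Union>\<C>" "a \<in> A \<rightarrow> carrier K" "lincomb a A = \<zero>\<^bsub>V\<^esub>" "v \<in> A" "a v \<noteq> \<zero>\<^bsub>K\<^esub>"
        unfolding lin_dep_def by auto
      obtain X where "X \<in> \<C>" "A \<subseteq> X"
        using finite_subset_Union_chain[OF A(1,2) \<C>] by auto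
      then have "lin_dep X" using A unfolding lin_dep_def by auto
      then show False using sub \<open>X \<in> \<C>\<close> by blast
    qed
    then show ?thesis using sub by (auto simp: \<A>_def)
  qed
  ultimately obtain B where "B \<in> \<A>" "\<And>X. X \<in> \<A> \<Longrightarrow> B \<subseteq> X \<Longrightarrow> X = B"
    using subset_Zorn_nonempty[of \<A>] by blast
  then have "VectorSpace.maximal B (\<lambda>S. S \<subseteq> carrier V \<and> lin_indpt S)"
    by (auto simp: VectorSpace.maximal_def \<A>_def)
  then show ?thesis using max_li_is_basis by blast
qed

lemma (in linear_map) bij_image_basis:
  assumes inj: "inj_on T (carrier V)" and surj: "T ` carrier V = carrier W" and B: "V.basis B"
  shows "W.basis (T ` B)"
proof -
  have Bc: "B \<subseteq> carrier V" and li: "V.module.lin_indpt B" and gen: "V.module.span B = carrier V"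
    using B unfolding V.basis_def by auto
  have "W.module.lin_indpt (T ` B)"
  proof
    assume "W.module.lin_dep (T ` B)"
    then obtain A' a v where A': "finite A'" "A' \<subseteq> T ` B" "a \<in> A' \<rightarrow> carrier K"
      "W.module.lincomb a A' = \<zero>\<^bsub>W\<^esub>" "v \<in> A'" "a v \<noteq> \<zero>\<^bsub>K\<^esub>"
      unfolding W.module.lin_dep_def by auto
    obtain A where A: "A \<subseteq> B" "finite A" "A' = T ` A" using finite_subset_image[OF A'(1,2)] by auto
    have Ac: "A \<subseteq> carrier V" using A(1) Bc by blast
    have aT: "a \<circ> T \<in> A \<rightarrow> carrier K" using A'(3) A(3) by auto
    have "T (V.module.lincomb (a \<circ> T) A) = \<zero>\<^bsub>W\<^esub>"
      using lincomb_linear_image[OF inj Ac _ A(2), of a] A'(3,4) A(3) by simp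
    moreover have "V.module.lincomb (a \<circ> T) A \<in> carrier V" using Ac aT by (rule V.module.lincomb_closed)
    ultimately have z: "V.module.lincomb (a \<circ> T) A = \<zero>\<^bsub>V\<^esub>"
      using inj f0_is_0 V.module.M.zero_closed by (metis inj_onD)
    obtain u where "u \<in> A" "v = T u" using A'(5) A(3) by auto
    then have "V.module.lin_dep B"
      unfolding V.module.lin_dep_def using A aT z A'(6)
      by (intro exI[of _ A] exI[of _ "a \<circ> T"] exI[of _ u]) auto
    then show False using li by blast
  qed
  moreover have TBc: "T ` B \<subseteq> carrier W" using Bc surj by blast
  moreover have "carrier W \<subseteq> W.module.span (T ` B)"
  proof
    fix w assume "w \<in> carrier W"
    then obtain v where v: "v \<in> carrier V" "w = T v" using surj by blast
    then have "v \<in> V.module.span B" using gen by simp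
    then obtain c A where A: "finite A" "A \<subseteq> B" "c \<in> A \<rightarrow> carrier K" "v = V.module.lincomb c A"
      unfolding V.module.span_def by blast
    have Ac: "A \<subseteq> carrier V" using A(2) Bc by blast
    define a where "a = c \<circ> inv_into A T"
    have injA: "inj_on T A" using inj Ac by (rule inj_on_subset)
    have ac: "(a \<circ> T) u = c u" if "u \<in> A" for u
      using that injA by (simp add: a_def)
    have aT: "a \<in> T ` A \<rightarrow> carrier K" using ac A(3) by auto
    have "V.module.lincomb (a \<circ> T) A = v"
      unfolding A(4) by (rule V.module.lincomb_cong[OF refl Ac ac A(3)])
    then have "W.module.lincomb a (T ` A) = w"
      using lincomb_linear_image[OF inj Ac aT A(1)] v(2) by simp
    then show "w \<in> W.module.span (T ` B)"
      unfolding W.module.span_def using A(1,2) aT by blast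
  qed
  moreover have "W.module.span (T ` B) \<subseteq> carrier W" by (rule W.module.span_is_subset2[OF TBc])
  ultimately show ?thesis unfolding W.basis_def by blast
qed

lemma enat_all_le_infinity: "(\<And>k. enat k \<le> x) \<Longrightarrow> x = \<infinity>"
proof (cases x)
  case (enat n)
  assume "\<And>k. enat k \<le> x"
  from this[of "Suc n"] show ?thesis using enat by simp
qed simp

text \<open>This gives dimension the shape of \<open>module_length\<close>, a supremum of natural
  numbers, so that finite and infinite cases are compared together.\<close>

lemma vs_dim_eq_Sup:
  fixes V :: "('k::field, 'm) module"
  assumes "vectorspace class_ring V"
  shows "vs_dim V = Sup {enat (card A) | A. finite A \<and> A \<subseteq> carrier V \<and> \<not> LinearCombinations.module.lin_dep class_ring V A}"
    (is "_ = Sup ?S")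
proof -
  interpret vectorspace class_ring V by fact
  show ?thesis
  proof (cases fin_dim)
    case True
    obtain B where B: "finite B" "basis B" using finite_basis_exists[OF True] by blast
    have "Sup ?S \<le> enat dim"
    proof (rule Sup_least)
      fix x assume "x \<in> ?S"
      then obtain A where "x = enat (card A)" "A \<subseteq> carrier V" "lin_indpt A" by blast
      then show "x \<le> enat dim" using li_le_dim(2)[OF True] by simp
    qed
    moreover have "enat dim \<le> Sup ?S"
      by (rule Sup_upper) (use B dim_basis[OF B] in \<open>auto simp: basis_def\<close>)
    ultimately show ?thesis using True by (simp add: vs_dim_def)
  next
    case False
    \<comment> \<open>No finite set spans, so a finite independent set can always be
      enlarged.\<close>
    have "\<exists>A. finite A \<and> card A = k \<and> A \<subseteq> carrier V \<and> lin_indpt A" for k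
    proof (induction k)
      case 0
      show ?case by (rule exI[of _ "{}"]) (simp add: lin_dep_def)
    next
      case (Suc k)
      then obtain A where A: "finite A" "card A = k" "A \<subseteq> carrier V" "lin_indpt A" by blast
      have "span A \<noteq> carrier V" using False A unfolding fin_dim_def by blast
      then obtain v where v: "v \<in> carrier V" "v \<notin> span A" using span_is_subset2[OF A(3)] by blast
      have "v \<notin> A" using v in_own_span[OF A(3)] by blast
      moreover have "lin_indpt (insert v A)"
        using lin_dep_iff_in_span[OF A(3,4) v(1) \<open>v \<notin> A\<close>] v(2) by simp
      ultimately show ?case using A v by (intro exI[of _ "insert v A"]) simp
    qed
    have "enat k \<le> Sup ?S" for k
    proof (rule Sup_upper)
      obtain A where "finite A" "card A = k" "A \<subseteq> carrier V" "lin_indpt A"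
        using \<open>\<exists>A. finite A \<and> card A = k \<and> A \<subseteq> carrier V \<and> lin_indpt A\<close> by blast
      then show "enat k \<in> ?S" by blast
    qed
    then have "Sup ?S = \<infinity>" by (rule enat_all_le_infinity)
    then show ?thesis using False by (simp add: vs_dim_def)
  qed
qed

lemma additive_hull_mono:
  assumes "G \<subseteq> H"
  shows "additive_hull M G \<subseteq> additive_hull M H"
proof
  fix v assume "v \<in> additive_hull M G"
  then show "v \<in> additive_hull M H"
  proof induction
    case (plus x y)
    show ?case by (rule additive_hull.plus[OF subsetD[OF assms plus.hyps(1)] plus.IH])
  qed (rule additive_hull.zero)
qed

section \<open>Equidimensionality and length\<close>

context I_module
begin

lemma K_subspace_simps [simp]:
  "carrier (K_subspace M U) = U" "add (K_subspace M U) = add M" "zero (K_subspace M U) = zero M"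
  "smult (K_subspace M U) c v = scal c \<odot>\<^bsub>M\<^esub> v"
  by (simp_all add: K_subspace_def restrict_scalars_def with_smult_def)

lemma scal_mult: "v \<in> carrier M \<Longrightarrow> scal (b * c) \<odot>\<^bsub>M\<^esub> v = scal b \<odot>\<^bsub>M\<^esub> (scal c \<odot>\<^bsub>M\<^esub> v)"
  unfolding scal_scal[symmetric] by (rule op_comp) simp_all

lemma scal_sum: "v \<in> carrier M \<Longrightarrow> scal (b + c) \<odot>\<^bsub>M\<^esub> v = scal b \<odot>\<^bsub>M\<^esub> v \<oplus>\<^bsub>M\<^esub> scal c \<odot>\<^bsub>M\<^esub> v"
  unfolding scal_plus by (rule op_plus) simp_all

lemma scal_1: "v \<in> carrier M \<Longrightarrow> scal 1 \<odot>\<^bsub>M\<^esub> v = v"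
  unfolding scal_one by (rule op_id)

lemma vectorspace_GW_space: "vectorspace class_ring (K_subspace M (GW_space w))"
proof -
  have c: "v \<in> carrier M" if "v \<in> GW_space w" for v using that GW_space_carrier by blast
  have neg: "\<exists>u\<in>GW_space w. v \<oplus>\<^bsub>M\<^esub> u = \<zero>\<^bsub>M\<^esub>" if "v \<in> GW_space w" for v
    using GW_space_uminus[OF that] M.r_neg[OF c[OF that]] by blast
  show ?thesis
    by (rule vs_criteria)
      (use c neg in \<open>simp_all add: class_field GW_space_zero GW_space_add GW_space_scal M.a_ac
        scal_mult scal_sum scal_1 smult_r_distr\<close>)
qed

lemma submodule_GW_spaceI:
  assumes "U \<subseteq> GW_space w" "\<zero>\<^bsub>M\<^esub> \<in> U" "\<And>x y. x \<in> U \<Longrightarrow> y \<in> U \<Longrightarrow> x \<oplus>\<^bsub>M\<^esub> y \<in> U"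
    "\<And>c x. x \<in> U \<Longrightarrow> scal c \<odot>\<^bsub>M\<^esub> x \<in> U"
  shows "submodule class_ring U (K_subspace M (GW_space w))"
  using assms vectorspace_GW_space[of w] unfolding submodule_def vectorspace_def by auto

text \<open>The \<open>D_alg\<close>-stable subspaces of the component at \<open>w\<close>.
  Stability is stated for the locally nilpotent \<open>G_op i (w i)\<close>; other constants differ
  by a scalar, see \<open>H_stable_G\<close>.\<close>

definition H_stable :: "('n \<Rightarrow> 'k) \<Rightarrow> 'm set \<Rightarrow> bool" where
  "H_stable w U \<longleftrightarrow> U \<subseteq> GW_space w \<and> \<zero>\<^bsub>M\<^esub> \<in> U \<and> (\<forall>x\<in>U. \<forall>y\<in>U. x \<oplus>\<^bsub>M\<^esub> y \<in> U)
     \<and> (\<forall>c. \<forall>x\<in>U. scal c \<odot>\<^bsub>M\<^esub> x \<in> U) \<and> (\<forall>i. \<forall>x\<in>U. G_op i (w i) \<odot>\<^bsub>M\<^esub> x \<in> U)"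

lemma H_stableD:
  assumes "H_stable w U"
  shows "U \<subseteq> GW_space w" "\<zero>\<^bsub>M\<^esub> \<in> U" "\<And>x y. x \<in> U \<Longrightarrow> y \<in> U \<Longrightarrow> x \<oplus>\<^bsub>M\<^esub> y \<in> U"
    "\<And>c x. x \<in> U \<Longrightarrow> scal c \<odot>\<^bsub>M\<^esub> x \<in> U" "\<And>i x. x \<in> U \<Longrightarrow> G_op i (w i) \<odot>\<^bsub>M\<^esub> x \<in> U"
  using assms by (auto simp: H_stable_def)

lemma H_stable_G:
  assumes U: "H_stable w U" and x: "x \<in> U"
  shows "G_op i c \<odot>\<^bsub>M\<^esub> x \<in> U"
proof -
  have "x \<in> carrier M" using x H_stableD(1)[OF U] GW_space_carrier by blast
  then have "(\<lambda>p. G_op i (w i) p + scal (w i - c) p) \<odot>\<^bsub>M\<^esub> x = G_op i (w i) \<odot>\<^bsub>M\<^esub> x \<oplus>\<^bsub>M\<^esub> scal (w i - c) \<odot>\<^bsub>M\<^esub> x"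
    by (intro op_plus) auto
  then have "G_op i c \<odot>\<^bsub>M\<^esub> x = G_op i (w i) \<odot>\<^bsub>M\<^esub> x \<oplus>\<^bsub>M\<^esub> scal (w i - c) \<odot>\<^bsub>M\<^esub> x"
    by (simp only: G_op_change[of i c "w i"])
  moreover have "G_op i (w i) \<odot>\<^bsub>M\<^esub> x \<oplus>\<^bsub>M\<^esub> scal (w i - c) \<odot>\<^bsub>M\<^esub> x \<in> U"
    by (rule H_stableD(3)[OF U H_stableD(5)[OF U x] H_stableD(4)[OF U x]])
  ultimately show ?thesis by simp
qed

text \<open>The operators \<open>G_op i (w i)\<close> are commuting and locally nilpotent on the quotient.\<close>

lemma H_stable_extend:
  assumes U: "H_stable w U" and u: "u \<in> GW_space w" "u \<notin> U"
  obtains v where "v \<in> GW_space w" "v \<notin> U" "\<And>i. G_op i (w i) \<odot>\<^bsub>M\<^esub> v \<in> U"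
proof -
  have "\<exists>v\<in>GW_space w. v \<notin> U \<and> (\<forall>i. G_op i (w i) \<odot>\<^bsub>M\<^esub> v \<in> U)" if "u \<in> gw k w" "u \<notin> U" for u k
    using that
  proof (induction k arbitrary: u)
    case 0
    then show ?case using H_stableD(2)[OF U] by simp
  next
    case (Suc k)
    show ?case
    proof (cases "\<forall>i. G_op i (w i) \<odot>\<^bsub>M\<^esub> u \<in> U")
      case True
      have "u \<in> GW_space w" using Suc.prems(1) unfolding GW_space_def by blast
      then show ?thesis using True Suc.prems(2) by blast
    next
      case False
      then obtain i where "G_op i (w i) \<odot>\<^bsub>M\<^esub> u \<notin> U" by blast
      then show ?thesis using Suc.IH[of "G_op i (w i) \<odot>\<^bsub>M\<^esub> u"] Suc.prems(1) by simp
    qed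
  qed
  moreover obtain k where "u \<in> gw k w" using u(1) by (auto simp: GW_space_def)
  ultimately show ?thesis using u(2) that by blast
qed

text \<open>The given set \<open>A\<close> supplies only a number: while fewer than
  \<open>card A\<close> vectors have been chosen, their span is not the whole component.
  \<open>H_stable_extend\<close> then offers a vector whose addition preserves stability.\<close>

lemma H_stable_flag:
  fixes w
  defines "V \<equiv> K_subspace M (GW_space w)"
  assumes A: "finite A" "A \<subseteq> GW_space w" "\<not> LinearCombinations.module.lin_dep class_ring V A"
  obtains N where "\<And>j. j \<le> card A \<Longrightarrow> H_stable w (N j)" "\<And>j. j < card A \<Longrightarrow> N j \<subset> N (Suc j)"
proof -
  interpret V: vectorspace class_ring V unfolding V_def by (rule vectorspace_GW_space)
  have Vc: "carrier V = GW_space w" by (simp add: V_def)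
  have "\<exists>N B. (\<forall>l\<le>j. H_stable w (N l)) \<and> (\<forall>l<j. N l \<subset> N (Suc l)) \<and> N j = V.span B
      \<and> finite B \<and> card B = j \<and> B \<subseteq> GW_space w \<and> V.lin_indpt B" if "j \<le> card A" for j
    using that
  proof (induction j)
    case 0
    have "H_stable w {\<zero>\<^bsub>M\<^esub>}" by (simp add: H_stable_def GW_space_zero)
    moreover have "V.span {} = {\<zero>\<^bsub>M\<^esub>}" using V.span_empty by (simp add: V_def)
    ultimately show ?case
      by (intro exI[of _ "\<lambda>_. {\<zero>\<^bsub>M\<^esub>}"] exI[of _ "{}"]) (simp add: V.lin_dep_def)
  next
    case (Suc j)
    then obtain N B where N: "\<And>l. l \<le> j \<Longrightarrow> H_stable w (N l)" "\<And>l. l < j \<Longrightarrow> N l \<subset> N (Suc l)" "N j = V.span B"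
      and B: "finite B" "card B = j" "B \<subseteq> GW_space w" "V.lin_indpt B" by auto
    have Bc: "B \<subseteq> carrier V" using B(3) Vc by simp
    have U: "H_stable w (V.span B)" using N(1)[of j] N(3) by simp
    have "V.span B \<noteq> GW_space w"
    proof
      assume "V.span B = GW_space w"
      then have "card A \<le> card B"
        using V.li_smaller_than_gen[OF A(1) B(1) _ Bc A(3)] A(2) Vc by simp
      then show False using Suc.prems B(2) by simp
    qed
    then obtain u where "u \<in> GW_space w" "u \<notin> V.span B" using H_stableD(1)[OF U] by blast
    then obtain v where v: "v \<in> GW_space w" "v \<notin> V.span B" and Gv: "\<And>i. G_op i (w i) \<odot>\<^bsub>M\<^esub> v \<in> V.span B"
      by (rule H_stable_extend[OF U]) blast
    have vB: "v \<notin> B" using v(2) V.in_own_span[OF Bc] by blast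
    define B' where "B' = insert v B"
    have B'c: "B' \<subseteq> carrier V" using Bc v(1) Vc by (simp add: B'_def)
    have li: "V.lin_indpt B'"
      using V.lin_dep_iff_in_span[OF Bc B(4) _ vB] v Vc by (simp add: B'_def)
    have BB': "V.span B \<subseteq> V.span B'" by (rule V.span_is_monotone) (auto simp: B'_def)
    have vB': "v \<in> V.span B'" using V.in_own_span[OF B'c] by (auto simp: B'_def)
    have S: "submodule class_ring (V.span B') V" by (rule V.span_is_submodule[OF B'c])
    have S_closed: "V.span B' \<subseteq> GW_space w" "\<zero>\<^bsub>M\<^esub> \<in> V.span B'"
      "\<And>x y. x \<in> V.span B' \<Longrightarrow> y \<in> V.span B' \<Longrightarrow> x \<oplus>\<^bsub>M\<^esub> y \<in> V.span B'"
      "\<And>c x. x \<in> V.span B' \<Longrightarrow> scal c \<odot>\<^bsub>M\<^esub> x \<in> V.span B'"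
      using S unfolding submodule_def by (auto simp: V_def)
    \<comment> \<open>Stability of the enlarged span is checked on its spanning set, because the
      vectors sent into that span by all operators form a subspace.\<close>
    define Y where "Y = {y \<in> GW_space w. \<forall>i. G_op i (w i) \<odot>\<^bsub>M\<^esub> y \<in> V.span B'}"
    have "submodule class_ring Y V"
      unfolding V_def
    proof (rule submodule_GW_spaceI)
      show "\<zero>\<^bsub>M\<^esub> \<in> Y" using S_closed(2) by (simp add: Y_def GW_space_zero)
      show "x \<oplus>\<^bsub>M\<^esub> y \<in> Y" if "x \<in> Y" "y \<in> Y" for x y
      proof -
        have "x \<in> carrier M" "y \<in> carrier M" using that GW_space_carrier by (auto simp: Y_def)
        then show ?thesis using that S_closed(3) by (simp add: Y_def GW_space_add smult_r_distr)
      qed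
      show "scal c \<odot>\<^bsub>M\<^esub> x \<in> Y" if "x \<in> Y" for c x
      proof -
        have "x \<in> carrier M" using that GW_space_carrier by (auto simp: Y_def)
        then have "G_op i (w i) \<odot>\<^bsub>M\<^esub> (scal c \<odot>\<^bsub>M\<^esub> x) = scal c \<odot>\<^bsub>M\<^esub> (G_op i (w i) \<odot>\<^bsub>M\<^esub> x)" for i
          by (intro op_swap[OF G_scal_commute]) auto
        then show ?thesis using that S_closed(4) by (simp add: Y_def GW_space_scal)
      qed
    qed (auto simp: Y_def)
    moreover have "B' \<subseteq> Y"
    proof
      fix b assume "b \<in> B'"
      then consider "b = v" | "b \<in> B" by (auto simp: B'_def)
      then show "b \<in> Y"
      proof cases
        case 1
        then show ?thesis using v(1) Gv BB' by (auto simp: Y_def)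
      next
        case 2
        then have "b \<in> V.span B" using V.in_own_span[OF Bc] by blast
        then have "G_op i (w i) \<odot>\<^bsub>M\<^esub> b \<in> V.span B" for i by (rule H_stableD(5)[OF U])
        then show ?thesis using 2 B(3) BB' by (auto simp: Y_def)
      qed
    qed
    ultimately have "V.span B' \<subseteq> Y" by (intro V.span_is_subset)
    then have "H_stable w (V.span B')" using S_closed unfolding H_stable_def Y_def by blast
    moreover have "V.span B \<subset> V.span B'" using BB' vB' v(2) by blast
    ultimately have "(\<forall>l\<le>Suc j. H_stable w ((N(Suc j := V.span B')) l))
        \<and> (\<forall>l<Suc j. (N(Suc j := V.span B')) l \<subset> (N(Suc j := V.span B')) (Suc l))"
      using N by (auto simp: less_Suc_eq le_Suc_eq)
    moreover have "finite B' \<and> card B' = Suc j \<and> B' \<subseteq> GW_space w"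
      using B v(1) vB by (simp add: B'_def)
    ultimately show ?case using li by (intro exI[of _ "N(Suc j := V.span B')"] exI[of _ B']) simp
  qed
  from this[OF order_refl] show ?thesis using that by blast
qed

end

text \<open>Connectedness means that the support lies in a single orbit.\<close>

locale connected_pure_module = pure_module M for M :: "(('n::finite, 'k::field_char_0) op, 'm) module" +
  assumes connected: "GW_space w \<noteq> {\<zero>\<^bsub>M\<^esub>} \<Longrightarrow> GW_space u \<noteq> {\<zero>\<^bsub>M\<^esub>} \<Longrightarrow> \<exists>z. u = shift w z"
begin

lemma same_dim_GW_space:
  assumes w: "GW_space w \<noteq> {\<zero>\<^bsub>M\<^esub>}" and u: "GW_space u \<noteq> {\<zero>\<^bsub>M\<^esub>}"
  shows "same_dim (K_subspace M (GW_space w)) (K_subspace M (GW_space u))"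
proof -
  obtain z where z: "u = shift w z" using connected[OF w u] by blast
  define T where "T = (\<lambda>v. transport variables z \<odot>\<^bsub>M\<^esub> v)"
  have bij: "bij_betw T (GW_space w) (GW_space u)"
    using transport_bij_betw[of w z] w u unfolding z T_def by blast
  have c: "v \<in> carrier M" if "v \<in> GW_space w" for v using that GW_space_carrier by blast
  have "transport variables z \<odot>\<^bsub>M\<^esub> (scal a \<odot>\<^bsub>M\<^esub> v) = scal a \<odot>\<^bsub>M\<^esub> (transport variables z \<odot>\<^bsub>M\<^esub> v)"
    if "v \<in> GW_space w" for a v
    by (rule op_swap[OF transport_comm[OF T_op_comm]]) (use c[OF that] in \<open>simp_all add: scal_d_op scal_int_op\<close>)
  then have hom: "T \<in> LinearCombinations.module_hom class_ring (K_subspace M (GW_space w)) (K_subspace M (GW_space u))"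
    using bij c by (auto simp: LinearCombinations.module_hom_def T_def bij_betw_def smult_r_distr)
  interpret V: vectorspace class_ring "K_subspace M (GW_space w)" by (rule vectorspace_GW_space)
  interpret W: vectorspace class_ring "K_subspace M (GW_space u)" by (rule vectorspace_GW_space)
  interpret linear_map class_ring "K_subspace M (GW_space w)" "K_subspace M (GW_space u)" T
    by unfold_locales (rule hom)
  obtain B where B: "V.basis B" using V.basis_exists by blast
  have inj: "inj_on T (GW_space w)" and surj: "T ` GW_space w = GW_space u"
    using bij by (auto simp: bij_betw_def)
  have "W.basis (T ` B)" by (rule bij_image_basis[OF _ _ B]) (use inj surj in simp_all)
  moreover have "B \<subseteq> GW_space w" using B by (simp add: V.basis_def)
  then have "B \<approx> T ` B" using inj by (meson eqpoll_def inj_on_subset inj_on_imp_bij_betw)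
  ultimately show ?thesis unfolding same_dim_def using B by blast
qed

text \<open>A missing vector of any weight can be transported to \<open>w\<close> inside
  \<open>N'\<close> and back inside \<open>N\<close>, so agreement at \<open>w\<close> would force
  agreement everywhere.\<close>

lemma submodule_strict_GW_space:
  assumes N: "left_submodule I_alg N M" and N': "left_submodule I_alg N' M" and "N \<subset> N'"
    and w: "GW_space w \<noteq> {\<zero>\<^bsub>M\<^esub>}"
  obtains v where "v \<in> GW_space w" "v \<in> N'" "v \<notin> N"
proof -
  have "\<not> N' \<inter> GW_space w \<subseteq> N"
  proof
    assume sub: "N' \<inter> GW_space w \<subseteq> N"
    have "N' \<inter> GW_space u \<subseteq> N" for u
    proof (cases "GW_space u = {\<zero>\<^bsub>M\<^esub>}")
      case True
      then show ?thesis using left_submoduleD(2)[OF N] by auto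
    next
      case False
      obtain z where z: "w = shift u z" using connected[OF False w] by blast
      show ?thesis
      proof
        fix v assume v: "v \<in> N' \<inter> GW_space u"
        define y where "y = transport variables z \<odot>\<^bsub>M\<^esub> v"
        have "y \<in> N'" unfolding y_def by (rule left_submoduleD(4)[OF N']) (use v in auto)
        moreover have "y \<in> GW_space w" unfolding y_def z by (rule GW_space_transport) (use v in auto)
        ultimately have "y \<in> N" using sub by blast
        then have "transport variables (- z) \<odot>\<^bsub>M\<^esub> y \<in> N" by (rule left_submoduleD(4)[OF N transport_I_alg])
        moreover have "transport variables (- z) \<odot>\<^bsub>M\<^esub> y = v"
          unfolding y_def by (rule transport_transport[OF False]) (use v w z in auto)
        ultimately show "v \<in> N" by simp
      qed
    qed
    then have "N' \<subseteq> N" by (rule submodule_subsetI[OF N' N])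
    then show False using assms(3) by blast
  qed
  then show ?thesis using that by blast
qed

text \<open>Each strict inclusion contributes a vector of weight \<open>w\<close> outside the
  smaller submodule, whose component at \<open>w\<close> is a subspace containing all earlier
  choices.\<close>

lemma lin_indpt_of_chain:
  assumes w: "GW_space w \<noteq> {\<zero>\<^bsub>M\<^esub>}"
    and N: "\<And>j. j \<le> k \<Longrightarrow> left_submodule I_alg (N j) M" "\<And>j. j < k \<Longrightarrow> N j \<subset> N (Suc j)"
  shows "\<exists>A. finite A \<and> card A = k \<and> A \<subseteq> GW_space w
    \<and> \<not> LinearCombinations.module.lin_dep class_ring (K_subspace M (GW_space w)) A"
proof -
  interpret V: vectorspace class_ring "K_subspace M (GW_space w)" by (rule vectorspace_GW_space)
  have "\<exists>A. finite A \<and> card A = j \<and> A \<subseteq> N j \<inter> GW_space w \<and> V.lin_indpt A" if "j \<le> k" for j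
    using that
  proof (induction j)
    case 0
    show ?case by (rule exI[of _ "{}"]) (simp add: V.lin_dep_def)
  next
    case (Suc j)
    then obtain A where A: "finite A" "card A = j" "A \<subseteq> N j \<inter> GW_space w" "V.lin_indpt A" by auto
    have Nj: "left_submodule I_alg (N j) M" "left_submodule I_alg (N (Suc j)) M" "N j \<subset> N (Suc j)"
      using N Suc.prems by auto
    note D = left_submoduleD[OF Nj(1)]
    obtain v where v: "v \<in> GW_space w" "v \<in> N (Suc j)" "v \<notin> N j"
      using submodule_strict_GW_space[OF Nj w] .
    have "submodule class_ring (N j \<inter> GW_space w) (K_subspace M (GW_space w))"
      by (rule submodule_GW_spaceI) (use D GW_space_zero GW_space_add GW_space_scal in auto)
    then have "V.span A \<subseteq> N j \<inter> GW_space w" by (rule V.span_is_subset[OF A(3)])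
    then have "v \<notin> V.span A" using v by blast
    moreover have "v \<notin> A" using A(3) v by blast
    ultimately have "V.lin_indpt (insert v A)"
      using V.lin_dep_iff_in_span[of A v] A v by auto
    then show ?case using A v Nj \<open>v \<notin> A\<close> by (intro exI[of _ "insert v A"]) auto
  qed
  from this[OF order_refl] show ?thesis by blast
qed

text \<open>The submodule generated by \<open>U\<close>, described by transporting back to \<open>w\<close>: this makes it visible that
  its component at \<open>w\<close> is not larger than \<open>U\<close>.\<close>

definition induced :: "('n \<Rightarrow> 'k) \<Rightarrow> 'm set \<Rightarrow> ('n \<Rightarrow> 'k) \<Rightarrow> 'm set" where
  "induced w U u = {y \<in> GW_space u. \<forall>z. u = shift w z \<longrightarrow> transport variables (- z) \<odot>\<^bsub>M\<^esub> y \<in> U}"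

text \<open>For \<open>k \<le> 0\<close> the \<integral> is absorbed by one of the
  \<open>1 - k\<close> derivations through \<open>\<partial>\<integral> = 1\<close>. The counterpart
  \<open>T_op_d\<close> has to assume \<open>\<integral>\<partial> v = v\<close>.\<close>

lemma T_op_int:
  assumes "v \<in> carrier M"
  shows "T_op i (k - 1) \<odot>\<^bsub>M\<^esub> (int_op i \<odot>\<^bsub>M\<^esub> v) = T_op i k \<odot>\<^bsub>M\<^esub> v"
proof (cases "k \<ge> 1")
  case True
  then have "nat k = Suc (nat (k - 1))" by simp
  then show ?thesis using True assms op_funpow_Suc(2)[of "int_op i" v "nat (k - 1)"]
    by (simp only: T_op_def) simp
next
  case False
  then have n: "nat (- (k - 1)) = Suc (nat (- k))" by simp
  have "T_op i k = (d_op i ^^ nat (- k) :: ('n, 'k) op)" using False by (cases "k = 0") (simp_all add: T_op_def)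
  moreover have "T_op i (k - 1) = (d_op i ^^ Suc (nat (- k)) :: ('n, 'k) op)"
    using False n by (simp only: T_op_def) simp
  ultimately show ?thesis using assms op_funpow_Suc(2)[of "d_op i" "int_op i \<odot>\<^bsub>M\<^esub> v" "nat (- k)"]
    by (simp only: ops_I_alg op_closed d_int)
qed

lemma T_op_d:
  assumes "v \<in> carrier M" and int_d: "int_op i \<odot>\<^bsub>M\<^esub> (d_op i \<odot>\<^bsub>M\<^esub> v) = v"
  shows "T_op i (k + 1) \<odot>\<^bsub>M\<^esub> (d_op i \<odot>\<^bsub>M\<^esub> v) = T_op i k \<odot>\<^bsub>M\<^esub> v"
  using T_op_int[of "d_op i \<odot>\<^bsub>M\<^esub> v" i "k + 1"] assms by simp

text \<open>Off the orbit of \<open>w\<close> the condition in \<open>induced\<close> is vacuous; on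
  it, z is determined by u in characteristic zero. A step by \<integral> or \<partial> changes z by
  one, and transport back absorbs the step, unless \<partial> gives zero, which lies in every
  piece.\<close>

lemma induced_submodule:
  assumes U: "H_stable w U"
  shows "left_submodule I_alg (additive_hull M (\<Union>u. induced w U u)) M"
proof (rule additive_hull_submodule)
  show "induced w U u \<subseteq> carrier M" for u using GW_space_carrier by (auto simp: induced_def)
next
  fix u c x assume x: "x \<in> induced w U u"
  then have xc: "x \<in> carrier M" using GW_space_carrier by (auto simp: induced_def)
  have "transport variables z \<odot>\<^bsub>M\<^esub> (scal c \<odot>\<^bsub>M\<^esub> x) = scal c \<odot>\<^bsub>M\<^esub> (transport variables z \<odot>\<^bsub>M\<^esub> x)" for z
    by (rule op_swap[OF transport_comm[OF T_op_comm]]) (use xc in \<open>simp_all add: scal_d_op scal_int_op\<close>)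
  then show "scal c \<odot>\<^bsub>M\<^esub> x \<in> induced w U u"
    using x H_stableD(4)[OF U] by (simp add: induced_def GW_space_scal)
next
  fix u i x assume x: "x \<in> induced w U u"
  then have xc: "x \<in> carrier M" and xu: "x \<in> GW_space u" using GW_space_carrier by (auto simp: induced_def)
  show "int_op i \<odot>\<^bsub>M\<^esub> x \<in> induced w U (u(i := u i + 1))"
    unfolding induced_def
  proof (intro CollectI conjI allI impI)
    show "int_op i \<odot>\<^bsub>M\<^esub> x \<in> GW_space (u(i := u i + 1))" by (rule GW_space_int[OF xu])
    fix z assume "u(i := u i + 1) = shift w z"
    then have u: "u = shift w (z(i := z i - 1))" using shift_upd[of u i 1 w z] by simp
    have "transport variables ((- (z(i := z i - 1)))(i := - z i)) \<odot>\<^bsub>M\<^esub> (int_op i \<odot>\<^bsub>M\<^esub> x)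
        = transport variables (- (z(i := z i - 1))) \<odot>\<^bsub>M\<^esub> x"
      by (rule transport_comp_eq[OF xc]) (use T_op_int[OF xc, of i "- (z i - 1)"] in simp_all)
    moreover have "(- (z(i := z i - 1)))(i := - z i) = - z" by (rule ext) simp
    ultimately show "transport variables (- z) \<odot>\<^bsub>M\<^esub> (int_op i \<odot>\<^bsub>M\<^esub> x) \<in> U"
      using x u by (simp add: induced_def)
  qed
  show "d_op i \<odot>\<^bsub>M\<^esub> x \<in> induced w U (u(i := u i - 1))"
    unfolding induced_def
  proof (intro CollectI conjI allI impI)
    show "d_op i \<odot>\<^bsub>M\<^esub> x \<in> GW_space (u(i := u i - 1))" by (rule GW_space_d[OF xu])
    fix z assume "u(i := u i - 1) = shift w z"
    then have u: "u = shift w (z(i := z i + 1))" using shift_upd[of u i "- 1" w z] by simp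
    show "transport variables (- z) \<odot>\<^bsub>M\<^esub> (d_op i \<odot>\<^bsub>M\<^esub> x) \<in> U"
    proof (cases "d_op i \<odot>\<^bsub>M\<^esub> x = \<zero>\<^bsub>M\<^esub>")
      case True
      then show ?thesis using H_stableD(2)[OF U] by simp
    next
      case False
      then have int_d: "int_op i \<odot>\<^bsub>M\<^esub> (d_op i \<odot>\<^bsub>M\<^esub> x) = x" using int_d_or_zero[OF xu, of i] by blast
      have "transport variables ((- (z(i := z i + 1)))(i := - z i)) \<odot>\<^bsub>M\<^esub> (d_op i \<odot>\<^bsub>M\<^esub> x)
          = transport variables (- (z(i := z i + 1))) \<odot>\<^bsub>M\<^esub> x"
        by (rule transport_comp_eq[OF xc]) (use T_op_d[OF xc int_d, of "- (z i + 1)"] in simp_all)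
      moreover have "(- (z(i := z i + 1)))(i := - z i) = - z" by (rule ext) simp
      ultimately show ?thesis using x u by (simp add: induced_def)
    qed
  qed
  show "H_op i \<odot>\<^bsub>M\<^esub> x \<in> induced w U u"
    unfolding induced_def
  proof (intro CollectI conjI allI impI)
    show "H_op i \<odot>\<^bsub>M\<^esub> x \<in> GW_space u" by (rule GW_space_H[OF xu])
    fix z assume u: "u = shift w z"
    \<comment> \<open>With \<open>H\<^sub>i\<close> written as \<open>G_op i 0\<close>, passing the
      transport changes the constant to \<open>- z i\<close>; \<open>U\<close> is stable for every
      constant.\<close>
    have "transport variables (- z) \<odot>\<^bsub>M\<^esub> (G_op i 0 \<odot>\<^bsub>M\<^esub> x) = G_op i (of_int (- z i)) \<odot>\<^bsub>M\<^esub> (transport variables (- z) \<odot>\<^bsub>M\<^esub> x)"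
    proof (rule op_swap)
      show "transport variables (- z) \<circ> G_op i 0 = (G_op i (of_int (- z i)) \<circ> transport variables (- z) :: ('n, 'k) op)"
        by (rule sym) (use G_transport[OF variables(2), where w = "\<lambda>_. 0" and z = "- z" and j = i]
          in \<open>simp only: variables(1) UNIV_I if_True add_0_left uminus_apply\<close>)
    qed (use xc in auto)
    then show "transport variables (- z) \<odot>\<^bsub>M\<^esub> (H_op i \<odot>\<^bsub>M\<^esub> x) \<in> U"
      using x u H_stable_G[OF U] by (simp add: induced_def G_op_0)
  qed
qed

text \<open>Only \<open>z = 0\<close> fixes \<open>w\<close>, so the condition at \<open>w\<close>
  is membership in \<open>U\<close>; independence of the weight spaces then recovers this piece from
  the hull.\<close>

lemma induced_GW_space:
  assumes U: "H_stable w U"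
  shows "additive_hull M (\<Union>u. induced w U u) \<inter> GW_space w = U"
proof -
  have z: "z = (\<lambda>_. 0)" if "w = shift w z" for z
  proof
    fix i show "z i = 0" using fun_cong[OF that, of i] by (simp add: shift_def)
  qed
  have "- (\<lambda>_. 0) = (\<lambda>_ :: 'n. 0 :: int)" by (rule ext) simp
  then have tr: "transport variables (- (\<lambda>_. 0)) = (id :: ('n, 'k) op)"
    using transport_zero[where xs = variables] by metis
  have s: "w = shift w (\<lambda>_. 0)" by (rule ext) (simp add: shift_def)
  have ind: "induced w U w = U"
  proof
    show "induced w U w \<subseteq> U"
    proof
      fix y assume y: "y \<in> induced w U w"
      then have yc: "y \<in> carrier M" using GW_space_carrier by (auto simp: induced_def)
      have "transport variables (- (\<lambda>_. 0)) \<odot>\<^bsub>M\<^esub> y \<in> U" using y s unfolding induced_def by blast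
      then show "y \<in> U" unfolding tr op_id[OF yc] .
    qed
    show "U \<subseteq> induced w U w"
    proof
      fix y assume y: "y \<in> U"
      then have yw: "y \<in> GW_space w" using H_stableD(1)[OF U] by blast
      then have yc: "y \<in> carrier M" using GW_space_carrier by blast
      have "transport variables (- z) \<odot>\<^bsub>M\<^esub> y \<in> U" if "w = shift w z" for z
        unfolding z[OF that] tr op_id[OF yc] by (rule y)
      then show "y \<in> induced w U w" using yw by (simp add: induced_def)
    qed
  qed
  have A: "induced w U u \<subseteq> GW_space u" "\<zero>\<^bsub>M\<^esub> \<in> induced w U u" for u
    using H_stableD(2)[OF U] GW_space_zero by (auto simp: induced_def)
  have A3: "x \<oplus>\<^bsub>M\<^esub> y \<in> induced w U u" if "x \<in> induced w U u" "y \<in> induced w U u" for x y u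
  proof -
    have "x \<in> carrier M" "y \<in> carrier M" using that GW_space_carrier by (auto simp: induced_def)
    then show ?thesis using that H_stableD(3)[OF U] by (simp add: induced_def GW_space_add smult_r_distr)
  qed
  have "v \<in> U" if "v \<in> additive_hull M (\<Union>u. induced w U u)" "v \<in> GW_space w" for v
    using additive_hull_component[OF that A A3] ind by simp
  moreover have "v \<in> additive_hull M (\<Union>u. induced w U u)" if "v \<in> U" for v
    by (rule additive_hull_incl) (use that ind A GW_space_carrier in blast)+
  ultimately show ?thesis using H_stableD(1)[OF U] by blast
qed

text \<open>The sets of numbers under the two suprema are equal: \<open>lin_indpt_of_chain\<close>
  gives one direction, and flags extended by \<open>induced\<close> the other.\<close>

lemma module_length_eq_vs_dim:
  assumes w: "GW_space w \<noteq> {\<zero>\<^bsub>M\<^esub>}"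
  shows "module_length I_alg M = vs_dim (K_subspace M (GW_space w))"
proof -
  let ?V = "K_subspace M (GW_space w)"
  have "(\<exists>N. (\<forall>j\<le>k. left_submodule I_alg (N j) M) \<and> (\<forall>j<k. N j \<subset> N (Suc j)))
      \<longleftrightarrow> (\<exists>A. finite A \<and> card A = k \<and> A \<subseteq> GW_space w \<and> \<not> LinearCombinations.module.lin_dep class_ring ?V A)" for k
  proof
    assume "\<exists>N. (\<forall>j\<le>k. left_submodule I_alg (N j) M) \<and> (\<forall>j<k. N j \<subset> N (Suc j))"
    then obtain N where "\<And>j. j \<le> k \<Longrightarrow> left_submodule I_alg (N j) M" "\<And>j. j < k \<Longrightarrow> N j \<subset> N (Suc j)" by blast
    then show "\<exists>A. finite A \<and> card A = k \<and> A \<subseteq> GW_space w \<and> \<not> LinearCombinations.module.lin_dep class_ring ?V A"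
      by (rule lin_indpt_of_chain[OF w])
  next
    assume "\<exists>A. finite A \<and> card A = k \<and> A \<subseteq> GW_space w \<and> \<not> LinearCombinations.module.lin_dep class_ring ?V A"
    then obtain A where A: "finite A" "card A = k" "A \<subseteq> GW_space w" "\<not> LinearCombinations.module.lin_dep class_ring ?V A"
      by blast
    obtain N where N: "\<And>j. j \<le> k \<Longrightarrow> H_stable w (N j)" "\<And>j. j < k \<Longrightarrow> N j \<subset> N (Suc j)"
      using H_stable_flag[OF A(1,3,4)] A(2) by blast
    define L where "L j = additive_hull M (\<Union>u. induced w (N j) u)" for j
    have "left_submodule I_alg (L j) M" if "j \<le> k" for j
      unfolding L_def by (rule induced_submodule[OF N(1)[OF that]])
    moreover have "L j \<subset> L (Suc j)" if j: "j < k" for j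
    proof -
      have s: "H_stable w (N j)" "H_stable w (N (Suc j))" using N(1) j by auto
      have "induced w (N j) u \<subseteq> induced w (N (Suc j)) u" for u
        using N(2)[OF j] by (auto simp: induced_def)
      then have G: "(\<Union>u. induced w (N j) u) \<subseteq> (\<Union>u. induced w (N (Suc j)) u)" by blast
      have "L j \<subseteq> L (Suc j)"
        unfolding L_def by (rule additive_hull_mono[OF G])
      \<comment> \<open>Strictness of the flag survives because it is still visible at weight
        \<open>w\<close>.\<close>
      moreover have "L j \<inter> GW_space w \<noteq> L (Suc j) \<inter> GW_space w"
        unfolding L_def induced_GW_space[OF s(1)] induced_GW_space[OF s(2)] using N(2)[OF j] by blast
      ultimately show ?thesis by blast
    qed
    ultimately show "\<exists>N. (\<forall>j\<le>k. left_submodule I_alg (N j) M) \<and> (\<forall>j<k. N j \<subset> N (Suc j))" by blast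
  qed
  then have "{enat k |k. \<exists>N. (\<forall>j\<le>k. left_submodule I_alg (N j) M) \<and> (\<forall>j<k. N j \<subset> N (Suc j))}
      = {enat (card A) |A. finite A \<and> A \<subseteq> carrier ?V \<and> \<not> LinearCombinations.module.lin_dep class_ring ?V A}"
    by auto
  then show ?thesis
    unfolding module_length_def vs_dim_eq_Sup[OF vectorspace_GW_space] by simp
qed

end

section \<open>Purity and connectedness\<close>

context I_module
begin

text \<open>\<open>d_op i\<close> is nilpotent on every element of a subquotient of \<open>Tor i\<close>, but injective on
  a subquotient of \<open>Div i\<close>.\<close>

lemma Tor_Div_subquotients_not_isomorphic:
  assumes L1: "left_submodule I_alg L1 M" and Q1: "left_submodule I_alg Q1 M" and QL1: "Q1 \<subseteq> L1" and T: "L1 \<subseteq> Tor i"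
    and L2: "left_submodule I_alg L2 M" and Q2: "left_submodule I_alg Q2 M" and QL2: "Q2 \<subseteq> L2" and D: "L2 \<subseteq> Div i"
    and S1: "simple_module I_alg (quot_module (M\<lparr>carrier := L1\<rparr>) Q1)"
  shows "\<not> isomorphic_modules I_alg (quot_module (M\<lparr>carrier := L1\<rparr>) Q1) (quot_module (M\<lparr>carrier := L2\<rparr>) Q2)"
    (is "\<not> isomorphic_modules _ ?S1 ?S2")
proof
  assume "isomorphic_modules I_alg ?S1 ?S2"
  then obtain g where g: "g \<in> LinearCombinations.module_hom I_alg ?S1 ?S2" "bij_betw g (carrier ?S1) (carrier ?S2)"
    unfolding isomorphic_modules_def by blast
  let ?M1 = "M\<lparr>carrier := L1\<rparr>" and ?M2 = "M\<lparr>carrier := L2\<rparr>"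
  interpret M1: left_module I_alg ?M1 by (rule left_module_restrict[OF L1])
  interpret M2: left_module I_alg ?M2 by (rule left_module_restrict[OF L2])
  have Q1': "left_submodule I_alg Q1 ?M1" using left_submodule_restrict_iff[OF L1] Q1 QL1 by blast
  have Q2': "left_submodule I_alg Q2 ?M2" using left_submodule_restrict_iff[OF L2] Q2 QL2 by blast
  interpret S1: left_module I_alg ?S1 by (rule M1.left_module_quot[OF Q1'])
  interpret S2: left_module I_alg ?S2 by (rule M2.left_module_quot[OF Q2'])
  have zero: "(\<lambda>_. 0) \<odot>\<^bsub>?S1\<^esub> X = \<zero>\<^bsub>?S1\<^esub>" if "X \<in> carrier ?S1" for X
    using S1.smult_zero_left[OF that] by simp
  have zero': "(\<lambda>_. 0) \<odot>\<^bsub>?S2\<^esub> X = \<zero>\<^bsub>?S2\<^esub>" if "X \<in> carrier ?S2" for X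
    using S2.smult_zero_left[OF that] by simp
  have g0: "g \<zero>\<^bsub>?S1\<^esub> = \<zero>\<^bsub>?S2\<^esub>"
  proof -
    have c: "\<zero>\<^bsub>?S1\<^esub> \<in> carrier ?S1" by (rule S1.M.zero_closed)
    have "g ((\<lambda>_. 0) \<odot>\<^bsub>?S1\<^esub> \<zero>\<^bsub>?S1\<^esub>) = (\<lambda>_. 0) \<odot>\<^bsub>?S2\<^esub> g \<zero>\<^bsub>?S1\<^esub>"
      by (rule LinearCombinations.module_hom_smult[OF g(1) _ c]) (use R.zero_closed in simp)
    moreover have "g \<zero>\<^bsub>?S1\<^esub> \<in> carrier ?S2" using g(2) c by (auto simp: bij_betw_def)
    ultimately show ?thesis unfolding zero[OF c] using zero' by simp
  qed
  obtain X where X: "X \<in> carrier ?S1" "X \<noteq> \<zero>\<^bsub>?S1\<^esub>"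
    using S1 S1.M.zero_closed unfolding simple_module_def by blast
  obtain x where x: "x \<in> carrier ?M1" "X = Q1 +>\<^bsub>?M1\<^esub> x"
    using M1.quot_carrierE[OF Q1'] X(1) M1.quot_module_simps(1)[OF Q1'] by metis
  obtain m where m: "(d_op i ^^ m) \<odot>\<^bsub>M\<^esub> x = \<zero>\<^bsub>M\<^esub>" using x(1) T by (auto simp: Tor_def)
  have dI: "d_op i ^^ m \<in> carrier I_alg" by (intro funpow_I_alg ops_I_alg)
  have "(d_op i ^^ m) \<odot>\<^bsub>?S1\<^esub> X = Q1 +>\<^bsub>?M1\<^esub> ((d_op i ^^ m) \<odot>\<^bsub>?M1\<^esub> x)"
    unfolding x(2) by (rule M1.quot_smult[OF Q1' dI x(1)])
  also have "(d_op i ^^ m) \<odot>\<^bsub>?M1\<^esub> x = \<zero>\<^bsub>?M1\<^esub>" using m by simp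
  also have "Q1 +>\<^bsub>?M1\<^esub> \<zero>\<^bsub>?M1\<^esub> = \<zero>\<^bsub>?S1\<^esub>"
    using M1.coset_eq_zero_iff[OF Q1' M1.M.zero_closed] left_submoduleD(2)[OF Q1']
    unfolding M1.quot_module_simps(2)[OF Q1'] by blast
  finally have dX: "(d_op i ^^ m) \<odot>\<^bsub>?S1\<^esub> X = \<zero>\<^bsub>?S1\<^esub>" .
  have gX: "g X \<in> carrier ?S2" using g(2) X(1) by (auto simp: bij_betw_def)
  obtain y where y: "y \<in> carrier ?M2" "g X = Q2 +>\<^bsub>?M2\<^esub> y"
    using M2.quot_carrierE[OF Q2'] gX M2.quot_module_simps(1)[OF Q2'] by metis
  have "Q2 +>\<^bsub>?M2\<^esub> ((d_op i ^^ m) \<odot>\<^bsub>?M2\<^esub> y) = (d_op i ^^ m) \<odot>\<^bsub>?S2\<^esub> g X"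
    unfolding y(2) by (rule M2.quot_smult[OF Q2' dI y(1), symmetric])
  also have "\<dots> = g ((d_op i ^^ m) \<odot>\<^bsub>?S1\<^esub> X)"
    by (rule LinearCombinations.module_hom_smult[OF g(1) dI X(1), symmetric])
  also have "\<dots> = Q2" unfolding dX g0 by (rule M2.quot_module_simps(2)[OF Q2'])
  finally have "(d_op i ^^ m) \<odot>\<^bsub>?M2\<^esub> y \<in> Q2"
    using M2.coset_eq_zero_iff[OF Q2' M2.smult_closed[OF dI y(1)]] by blast
  then have "(d_op i ^^ m) \<odot>\<^bsub>M\<^esub> y \<in> Q2" by simp
  \<comment> \<open>Applying \<open>\<integral>^m\<close> stays in the submodule \<open>Q2\<close>
    and recovers \<open>y\<close>, as \<integral> inverts \<partial> on
    \<open>Div i\<close>.\<close>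
  then have "(int_op i ^^ m) \<odot>\<^bsub>M\<^esub> ((d_op i ^^ m) \<odot>\<^bsub>M\<^esub> y) \<in> Q2"
    by (rule left_submoduleD(4)[OF Q2, rotated]) (intro funpow_I_alg ops_I_alg)
  moreover have "(int_op i ^^ m) \<odot>\<^bsub>M\<^esub> ((d_op i ^^ m) \<odot>\<^bsub>M\<^esub> y) = y"
    by (rule int_d_funpow) (use y(1) D in \<open>auto simp: Div_def\<close>)
  ultimately have "y \<in> Q2" by simp
  then have "g X = g \<zero>\<^bsub>?S1\<^esub>"
    unfolding g0 M2.quot_module_simps(2)[OF Q2'] y(2) using M2.coset_eq_zero_iff[OF Q2' y(1)] by blast
  then have "X = \<zero>\<^bsub>?S1\<^esub>"
    using g(2) X(1) S1.M.zero_closed unfolding bij_betw_def by (meson inj_onD)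
  then show False using X(2) by blast
qed

end

section \<open>Indecomposable modules and modules with a single type of simple subquotient\<close>

context gw_module
begin

lemma Tor_or_Div_zero_if_indecomposable:
  assumes "indecomposable_module I_alg M"
  shows "Tor i = {\<zero>\<^bsub>M\<^esub>} \<or> Div i = {\<zero>\<^bsub>M\<^esub>}"
proof -
  have "Tor i <+>\<^bsub>M\<^esub> Div i = carrier M"
  proof
    show "Tor i <+>\<^bsub>M\<^esub> Div i \<subseteq> carrier M" by (auto simp: set_add_def' Tor_def Div_def)
    show "carrier M \<subseteq> Tor i <+>\<^bsub>M\<^esub> Div i"
    proof
      fix v assume "v \<in> carrier M"
      then obtain x y where "x \<in> Tor i" "y \<in> Div i" "v = x \<oplus>\<^bsub>M\<^esub> y" by (rule Tor_plus_Div)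
      then show "v \<in> Tor i <+>\<^bsub>M\<^esub> Div i" by (auto simp: set_add_def')
    qed
  qed
  then show ?thesis
    using assms Tor_submodule Div_submodule Tor_Div_disjoint unfolding indecomposable_module_def by metis
qed

text \<open>For \<open>P\<close> invariant under integer translations this is a direct summand. The
  value zero off \<open>P\<close> keeps the family indexed by all weights, as
  \<open>additive_hull_component\<close> requires.\<close>

definition block :: "(('n \<Rightarrow> 'k) \<Rightarrow> bool) \<Rightarrow> 'm set" where
  "block P = additive_hull M (\<Union>w. if P w then GW_space w else {\<zero>\<^bsub>M\<^esub>})"

lemma block_submodule:
  assumes P: "\<And>u i a. P (u(i := u i + of_int a)) \<longleftrightarrow> P u"
  shows "left_submodule I_alg (block P) M"
  unfolding block_def
proof (rule additive_hull_submodule)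
  show "(if P w then GW_space w else {\<zero>\<^bsub>M\<^esub>}) \<subseteq> carrier M" for w using GW_space_carrier by auto
  have P1: "P (u(i := u i + 1)) \<longleftrightarrow> P u" "P (u(i := u i - 1)) \<longleftrightarrow> P u" for u i
    using P[of u i 1] P[of u i "- 1"] by simp_all
  show "scal c \<odot>\<^bsub>M\<^esub> x \<in> (if P w then GW_space w else {\<zero>\<^bsub>M\<^esub>})"
    if "x \<in> (if P w then GW_space w else {\<zero>\<^bsub>M\<^esub>})" for w c x
    using that GW_space_scal by (cases "P w") auto
  show "d_op i \<odot>\<^bsub>M\<^esub> x \<in> (if P (w(i := w i - 1)) then GW_space (w(i := w i - 1)) else {\<zero>\<^bsub>M\<^esub>})"
    if "x \<in> (if P w then GW_space w else {\<zero>\<^bsub>M\<^esub>})" for w i x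
    using that GW_space_d P1 by (cases "P w") auto
  show "int_op i \<odot>\<^bsub>M\<^esub> x \<in> (if P (w(i := w i + 1)) then GW_space (w(i := w i + 1)) else {\<zero>\<^bsub>M\<^esub>})"
    if "x \<in> (if P w then GW_space w else {\<zero>\<^bsub>M\<^esub>})" for w i x
    using that GW_space_int P1 by (cases "P w") auto
  show "H_op i \<odot>\<^bsub>M\<^esub> x \<in> (if P w then GW_space w else {\<zero>\<^bsub>M\<^esub>})"
    if "x \<in> (if P w then GW_space w else {\<zero>\<^bsub>M\<^esub>})" for w i x
    using that GW_space_H by (cases "P w") auto
qed

lemma block_GW_space: "v \<in> GW_space w \<Longrightarrow> P w \<Longrightarrow> v \<in> block P"
  unfolding block_def
proof (rule additive_hull_incl)
  assume "v \<in> GW_space w" "P w"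
  then show "v \<in> (\<Union>w. if P w then GW_space w else {\<zero>\<^bsub>M\<^esub>})" by (intro UN_I[of w]) simp_all
  show "(\<Union>w. if P w then GW_space w else {\<zero>\<^bsub>M\<^esub>}) \<subseteq> carrier M"
    using GW_space_carrier by (auto split: if_splits)
qed

lemma block_component:
  assumes "v \<in> block P" "v \<in> GW_space w"
  shows "v \<in> (if P w then GW_space w else {\<zero>\<^bsub>M\<^esub>})"
  using assms(1) unfolding block_def
  by (rule additive_hull_component[OF _ assms(2)]) (auto simp: GW_space_zero GW_space_add split: if_splits)

text \<open>The orbit of \<open>w\<close> and its complement are both invariant under translations,
  so their blocks split the module; a weight \<open>u\<close> off the orbit would make both
  nonzero.\<close>

lemma connected_if_indecomposable:
  assumes "indecomposable_module I_alg M" and w: "GW_space w \<noteq> {\<zero>\<^bsub>M\<^esub>}" and u: "GW_space u \<noteq> {\<zero>\<^bsub>M\<^esub>}"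
  shows "\<exists>z. u = shift w z"
proof (rule ccontr)
  assume not: "\<not> (\<exists>z. u = shift w z)"
  define P where "P = (\<lambda>v. \<exists>z. v = shift w z)"
  define N1 where "N1 = block P"
  define N2 where "N2 = block (\<lambda>v. \<not> P v)"
  have N1: "left_submodule I_alg N1 M" unfolding N1_def
    by (rule block_submodule) (simp only: P_def shift_upd_iff)
  have N2: "left_submodule I_alg N2 M" unfolding N2_def
    by (rule block_submodule) (simp only: P_def shift_upd_iff)
  have "left_submodule I_alg (\<Inter>{N1, N2}) M" by (rule left_submodule_Inter) (use N1 N2 in auto)
  then have N12: "left_submodule I_alg (N1 \<inter> N2) M" by simp
  have "N1 \<inter> N2 \<subseteq> {\<zero>\<^bsub>M\<^esub>}"
  proof (rule submodule_subsetI[OF N12 left_submodule_zero], rule subsetI)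
    fix v x assume "x \<in> (N1 \<inter> N2) \<inter> GW_space v"
    then show "x \<in> {\<zero>\<^bsub>M\<^esub>}"
      using block_component[of x P v] block_component[of x "\<lambda>v. \<not> P v" v]
      by (cases "P v") (simp_all add: N1_def N2_def)
  qed
  then have disj: "N1 \<inter> N2 = {\<zero>\<^bsub>M\<^esub>}" using left_submoduleD(2)[OF N12] by blast
  have "v \<in> N1 <+>\<^bsub>M\<^esub> N2" if "v \<in> carrier M" for v
    using spanned[OF that]
  proof induction
    case zero
    then show ?case
      using left_submoduleD(2)[OF N1] left_submoduleD(2)[OF N2] M.l_zero[OF M.zero_closed]
      by (force simp: set_add_def')
  next
    case (plus x y)
    then obtain a b v where ab: "a \<in> N1" "b \<in> N2" "y = a \<oplus>\<^bsub>M\<^esub> b" and x: "x \<in> GW_space v"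
      by (auto simp: set_add_def')
    have c: "a \<in> carrier M" "b \<in> carrier M" "x \<in> carrier M"
      using ab x left_submoduleD(1)[OF N1] left_submoduleD(1)[OF N2] GW_space_carrier by auto
    show ?case
    proof (cases "P v")
      case True
      then have "x \<oplus>\<^bsub>M\<^esub> a \<in> N1"
        using left_submoduleD(3)[OF N1 _ ab(1), of x] block_GW_space[OF x] by (simp add: N1_def)
      moreover have "x \<oplus>\<^bsub>M\<^esub> y = (x \<oplus>\<^bsub>M\<^esub> a) \<oplus>\<^bsub>M\<^esub> b" using ab(3) c by (simp add: M.a_assoc)
      ultimately show ?thesis using ab(2) by (auto simp: set_add_def')
    next
      case False
      then have "x \<oplus>\<^bsub>M\<^esub> b \<in> N2"
        using left_submoduleD(3)[OF N2 _ ab(2), of x] block_GW_space[OF x, of "\<lambda>v. \<not> P v"] by (simp add: N2_def)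
      moreover have "x \<oplus>\<^bsub>M\<^esub> y = a \<oplus>\<^bsub>M\<^esub> (x \<oplus>\<^bsub>M\<^esub> b)" using ab(3) c by (simp add: M.a_ac)
      ultimately show ?thesis using ab(1) by (auto simp: set_add_def')
    qed
  qed
  moreover have "N1 <+>\<^bsub>M\<^esub> N2 \<subseteq> carrier M"
    by (rule M.set_add_closed[OF left_submoduleD(1)[OF N1] left_submoduleD(1)[OF N2]])
  ultimately have "N1 <+>\<^bsub>M\<^esub> N2 = carrier M" by blast
  then have "N1 = {\<zero>\<^bsub>M\<^esub>} \<or> N2 = {\<zero>\<^bsub>M\<^esub>}"
    using assms(1) N1 N2 disj unfolding indecomposable_module_def by metis
  moreover have "P w" unfolding P_def by (rule exI[of _ "\<lambda>_. 0"]) (simp add: shift_def fun_eq_iff)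
  then have "GW_space w \<subseteq> N1" using block_GW_space[of _ w P] by (auto simp: N1_def)
  moreover have "\<not> P u" using not by (simp add: P_def)
  then have "GW_space u \<subseteq> N2" using block_GW_space[of _ u "\<lambda>v. \<not> P v"] by (auto simp: N2_def)
  ultimately show False using w u GW_space_zero by blast
qed

text \<open>A simple subquotient of \<open>Tor i\<close> and one of \<open>Div i\<close> would both be isomorphic to the given
  simple module, hence to each other; nothing has to be known about that module.\<close>

lemma Tor_or_Div_zero_if_GW:
  assumes "M \<in> GW \<O> \<D> rep"
  shows "Tor i = {\<zero>\<^bsub>M\<^esub>} \<or> Div i = {\<zero>\<^bsub>M\<^esub>}"
proof (rule ccontr)
  assume neg: "\<not> ?thesis"
  obtain v where v: "v \<in> Tor i" "v \<noteq> \<zero>\<^bsub>M\<^esub>" using neg left_submoduleD(2)[OF Tor_submodule, of i] by blast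
  obtain L1 Q1 where 1: "left_submodule I_alg L1 M" "left_submodule I_alg Q1 M" "Q1 \<subseteq> L1" "L1 \<subseteq> Tor i"
    "simple_module I_alg (quot_module (M\<lparr>carrier := L1\<rparr>) Q1)"
    by (rule exists_simple_subquotient[OF Tor_submodule v])
  obtain u where u: "u \<in> Div i" "u \<noteq> \<zero>\<^bsub>M\<^esub>" using neg left_submoduleD(2)[OF Div_submodule, of i] by blast
  obtain L2 Q2 where 2: "left_submodule I_alg L2 M" "left_submodule I_alg Q2 M" "Q2 \<subseteq> L2" "L2 \<subseteq> Div i"
    "simple_module I_alg (quot_module (M\<lparr>carrier := L2\<rparr>) Q2)"
    by (rule exists_simple_subquotient[OF Div_submodule u])
  have iso: "isomorphic_modules I_alg (quot_module (M\<lparr>carrier := L\<rparr>) Q) (M_simple \<O> \<D> rep)"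
    if "left_submodule I_alg L M" "left_submodule I_alg Q M" "Q \<subseteq> L"
      "simple_module I_alg (quot_module (M\<lparr>carrier := L\<rparr>) Q)" for L Q
    using assms that unfolding GW_def by blast
  have "isomorphic_modules I_alg (quot_module (M\<lparr>carrier := L1\<rparr>) Q1) (quot_module (M\<lparr>carrier := L2\<rparr>) Q2)"
    by (rule isomorphic_modules_common[OF iso[OF 1(1-3,5)] iso[OF 2(1-3,5)]])
      (rule 2(5)[unfolded simple_module_def, THEN conjunct1])
  then show False
    using Tor_Div_subquotients_not_isomorphic[OF 1(1-4) 2(1-4) 1(5)] by blast
qed

end

section \<open>Assembly of the theorem\<close>

lemma connected_pure_moduleI_GW:
  fixes M :: "(('n::finite, 'k::field_char_0) op, 'm) module"
  assumes \<O>: "\<O> \<in> orbits" and M: "M \<in> GW \<O> \<D> rep"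
  shows "connected_pure_module M"
proof -
  interpret gw_module M using M by (intro gw_moduleI) (simp add: GW_def GW_orbit_def)
  obtain v where v: "\<O> = {w. \<exists>z. \<forall>i. w i = v i + of_int (z i)}"
    using \<O> unfolding orbits_def quotient_def by auto
  have "\<exists>z. u = shift w z" if wu: "w \<in> \<O>" "u \<in> \<O>" for u w
  proof -
    obtain x y where "\<forall>i. w i = v i + of_int (x i)" "\<forall>i. u i = v i + of_int (y i)" using wu v by auto
    then have "u = shift w (\<lambda>i. y i - x i)" by (intro ext) (simp add: shift_def)
    then show ?thesis by blast
  qed
  moreover have "w \<in> \<O>" if "GW_space w \<noteq> {\<zero>\<^bsub>M\<^esub>}" for w
    using M that by (auto simp: GW_def GW_orbit_def Supp_eq)
  ultimately show ?thesis
    using Tor_or_Div_zero_if_GW[OF M] by unfold_locales blast+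
qed

lemma connected_pure_moduleI_indecomposable:
  fixes M :: "(('n::finite, 'k::field_char_0) op, 'm) module"
  assumes "gen_weight_module M" "indecomposable_module I_alg M"
  shows "connected_pure_module M"
proof -
  interpret gw_module M using assms(1) by (rule gw_moduleI)
  show ?thesis
    using Tor_or_Div_zero_if_indecomposable[OF assms(2)] connected_if_indecomposable[OF assms(2)]
    by unfold_locales blast+
qed

lemma (in connected_pure_module) gen_equidimensional: "gen_equidimensional M"
  unfolding gen_equidimensional_def gen_weight_comp_eq Supp_eq using same_dim_GW_space by blast

lemma (in connected_pure_module) module_length_Supp:
  "w \<in> Supp M \<Longrightarrow> module_length I_alg M = vs_dim (K_subspace M (gen_weight_comp M w))"
  unfolding gen_weight_comp_eq Supp_eq using module_length_eq_vs_dim by blast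

theorem corollary3p8:
  fixes \<O> :: "('n::finite \<Rightarrow> 'k::field_char_0) set"
    and \<D> :: "'n set"
    and rep :: "'k set \<Rightarrow> 'k"
  assumes "\<O> \<in> orbits"
    and "\<D> \<subseteq> integral_indices \<O>"
    and "\<forall>C\<in>cosets_Z. rep C \<in> C"
    and "rep \<int> = 0"
  shows
    "(\<forall>M :: (('n, 'k) op, 'm) module. M \<in> GW \<O> \<D> rep \<longrightarrow>
        gen_equidimensional M \<and>
        (\<forall>w\<in>Supp M. module_length I_alg M = vs_dim (K_subspace M (gen_weight_comp M w)))) \<and>
     (\<forall>M :: (('n, 'k) op, 'm) module. M \<in> W \<O> \<D> rep \<longrightarrow>
        equidimensional M \<and>
        (\<forall>w\<in>Supp M. module_length I_alg M = vs_dim (K_subspace M (weight_comp M w)))) \<and>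
     (\<forall>M :: (('n, 'k) op, 'm) module.
        gen_weight_module M \<and> indecomposable_module I_alg M \<longrightarrow> gen_equidimensional M)"
proof (intro conjI allI impI)
  fix M :: "(('n, 'k) op, 'm) module"
  {
    assume "M \<in> GW \<O> \<D> rep"
    then interpret connected_pure_module M by (rule connected_pure_moduleI_GW[OF assms(1)])
    show "gen_equidimensional M" by (rule gen_equidimensional)
    show "\<forall>w\<in>Supp M. module_length I_alg M = vs_dim (K_subspace M (gen_weight_comp M w))"
      using module_length_Supp by blast
  }
  {
    assume W: "M \<in> W \<O> \<D> rep"
    then have GW: "M \<in> GW \<O> \<D> rep" and "weight_module M" by (auto simp: W_def)
    \<comment> \<open>Both families decompose the module and one is contained in the other, so the
      weight case reduces to the generalized one.\<close>
    then have eq: "weight_comp M w = gen_weight_comp M w" for w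
      by (intro weight_comp_eq_gen_weight_comp) (auto simp: GW_def GW_orbit_def)
    interpret connected_pure_module M by (rule connected_pure_moduleI_GW[OF assms(1) GW])
    show "equidimensional M"
      using gen_equidimensional by (simp add: equidimensional_def gen_equidimensional_def eq)
    show "\<forall>w\<in>Supp M. module_length I_alg M = vs_dim (K_subspace M (weight_comp M w))"
      unfolding eq using module_length_Supp by blast
  }
  assume "gen_weight_module M \<and> indecomposable_module I_alg M"
  then interpret connected_pure_module M by (intro connected_pure_moduleI_indecomposable) auto
  show "gen_equidimensional M" by (rule gen_equidimensional)
qed

end
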